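(* Let $\bar A=(A_0,A_1)$ be a compatible couple of (quasi-)Banach spaces with $A_0\cap A_1\neq\{0\}$. Let $0<q_1,r_1\le\infty$ and $a_1,b_1\in SV$ be such that $\left\|s^{-1/r_1}b_1(s)\|u^{-1/q_1}a_1(u)\|_{q_1,(s,1)}\right\|_{r_1,(0,1)}<\infty$, and put $$\chi_1(t)=\left\|s^{-1/r_1}b_1(s)\|u^{-1/q_1}a_1(u)\|_{q_1,(s,t)}\right\|_{r_1,(0,t)}.$$ Let $0<\theta_0<1$, $0<r,r_0\le\infty$, and $a,b_0\in SV$. Put $\rho(t)=t^{1-\theta_0}\frac{b_0(t)}{\chi_1(t)}$. For given $0\le\theta\le1$ denote $a^{\#}=b_0^{1-\theta}\chi_1^{\theta}\,(a\circ\rho)$ and $\eta=(1-\theta)\theta_0+\theta$. (i) If $0<\theta<1$, then $\left(\bar A_{\theta_0,r_0,b_0},\bar A^{\mathcal R}_{1,r_1,b_1,q_1,a_1}\right)_{\theta,r,a}=\bar A_{\eta,r,a^{\#}}$. (ii) If $\|s^{-1/r}a(s)\|_{r,(1,\infty)}<\infty$, then $\left(\bar A_{\theta_0,r_0,b_0},\bar A^{\mathcal R}_{1,r_1,b_1,q_1,a_1}\right)_{0,r,a}=\bar A^{\mathcal L}_{\theta_0,r,a\circ\rho,r_0,b_0}$. (iii) If $\|s^{-1/r}a(s)\|_{r,(0,1)}<\infty$, then, with $\theta=1$ (i.e. $a^{\#}=\chi_1\,(a\circ\rho)$), $$\left(\bar A_{\theta_0,r_0,b_0},\bar A^{\mathcal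 R}_{1,r_1,b_1,q_1,a_1}\right)_{1,r,a}=\bar A_{1,r,a^{\#}}\cap\bar A^{\mathcal R}_{1,r,B_1,q_1,a_1}\cap\bar A^{\mathcal R,\mathcal R}_{1,r,a\circ\rho,r_1,b_1,q_1,a_1},$$ where $B_1(t)=\|s^{-1/r_1}b_1(s)\|_{r_1,(0,t)}\,a(\rho(t))$.
   Context: Conventions: $1/\infty=0$; $\|\cdot\|_{q,(a,b)}$ is the usual (quasi-)norm of $L_q$ on the interval $(a,b)$, $0<q\le\infty$. Two positive functions satisfy $f\approx g$ (are equivalent) if $C^{-1}g\le f\le Cg$ for some constant $C>0$ independent of all significant quantities. $b\in SV$ (slowly varying) means that $b$ is a positive Lebesgue measurable function on $(0,\infty)$ such that for each $\varepsilon>0$ the function $t^{\varepsilon}b(t)$ is equivalent to an increasing function and $t^{-\varepsilon}b(t)$ is equivalent to a decreasing function. For a compatible couple $(X_0,X_1)$ of (quasi-)normed spaces, $K(t,f;X_0,X_1)=\inf\{\|f_0\|_{X_0}+t\|f_1\|_{X_1}: f=f_0+f_1,\ f_i\in X_i\}$ for $f\in X_0+X_1$, $t>0$; $K(t,f):=K(t,f;A_0,A_1)$. For $0\le\theta\le1$, $0<q\le\infty$, $b\in SV$, $(X_0,X_1)_{\theta,q,b}$ is the space of all $f\in X_0+X_1$ with finite (quasi-)norm $\|u^{-\theta-1/q}b(u)K(u,f;X_0,X_1)\|_{q,(0,\infty)}$, and $\bar A_{\theta,q,b}:=(A_0,A_1)_{\theta,q,b}$. For $0<p,r,q\le\infty$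 and $a,b,c\in SV$, the following are the spaces of all $f\in A_0+A_1$ with finite (quasi-)norm: - $\bar A^{\mathcal L}_{\theta,r,b,q,a}$: $\left\|t^{-1/r}b(t)\|u^{-\theta-1/q}a(u)K(u,f)\|_{q,(0,t)}\right\|_{r,(0,\infty)}$; - $\bar A^{\mathcal R}_{\theta,r,b,q,a}$: $\left\|t^{-1/r}b(t)\|u^{-\theta-1/q}a(u)K(u,f)\|_{q,(t,\infty)}\right\|_{r,(0,\infty)}$; - $\bar A^{\mathcal R,\mathcal R}_{\theta,p,c,r,b,q,a}$: $\left\|t^{-1/p}c(t)\left\|u^{-1/r}b(u)\|v^{-\theta-1/q}a(v)K(v,f)\|_{q,(u,\infty)}\right\|_{r,(t,\infty)}\right\|_{p,(0,\infty)}$. Equality of (quasi-)normed spaces means that each is continuously embedded in the other; intersections carry the maximum (equivalently, the sum) of the (quasi-)norms. Standing assumption: none of the spaces under consideration is $\{0\}$. *)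

theory Defs
  imports "HOL-Analysis.Analysis"
begin

section \<open>Norms of \<open>L\<^sub>q\<close> type on subsets of the real line\<close>

text \<open>Exponents \<open>q\<close> range over \<open>(0, \<infinity>]\<close> and are elements of \<^typ>\<open>ennreal\<close>; the convention
  \<open>1/\<infinity> = 0\<close> is that of \<^const>\<open>inverse\<close> on this type.\<close>

definition recip :: "ennreal \<Rightarrow> real" where
  "recip q = enn2real (inverse q)"

text \<open>Real powers on \<open>[0, \<infinity>]\<close>, for positive exponents only.\<close>

definition epow :: "ennreal \<Rightarrow> real \<Rightarrow> ennreal" where
  "epow x p = (if x = \<infinity> then \<infinity> else ennreal (enn2real x powr p))"

text \<open>For \<open>q = \<infinity>\<close> the least almost-everywhere bound is written out: the constant \<open>esssup\<close> of the
  library is \<open>\<infinity>\<close> by fiat on non-measurable functions. The composition of two Lebesgue measurable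
  functions, as in \<open>a \<circ> \<rho>\<close> below, need not be Lebesgue measurable, but there it is equivalent to a
  measurable function. Both branches below are monotone in \<open>f\<close> without any measurability
  assumption, so such norms still have the intended value up to equivalence.\<close>

definition Lnorm :: "ennreal \<Rightarrow> real set \<Rightarrow> (real \<Rightarrow> ennreal) \<Rightarrow> ennreal" where
  "Lnorm q I f =
    (if q = \<infinity> then Inf {C. AE t in lebesgue. t \<in> I \<longrightarrow> f t \<le> C}
     else epow (\<integral>\<^sup>+ t\<in>I. epow (f t) (enn2real q) \<partial>lebesgue) (recip q))"

text \<open>The weighted norm \<open>\<parallel>u\<^bsup>- \<theta> - 1/q\<^esup> w(u) F(u)\<parallel>\<close> in \<open>L\<^sub>q(I)\<close>.\<close>

definition wnorm ::
    "ennreal \<Rightarrow> real \<Rightarrow> (real \<Rightarrow> real) \<Rightarrow> real set \<Rightarrow> (real \<Rightarrow> ennreal) \<Rightarrow> ennreal" where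
  "wnorm q \<theta> w I F = Lnorm q I (\<lambda>u. ennreal (u powr (- \<theta> - recip q) * w u) * F u)"


section \<open>Slowly varying functions\<close>

definition equivalent_on_pos :: "(real \<Rightarrow> real) \<Rightarrow> (real \<Rightarrow> real) \<Rightarrow> bool" where
  "equivalent_on_pos f g \<longleftrightarrow> (\<exists>C>0. \<forall>t>0. inverse C * g t \<le> f t \<and> f t \<le> C * g t)"

definition SV :: "(real \<Rightarrow> real) set" where
  "SV = {b. b \<in> borel_measurable (lebesgue_on {0<..}) \<and> (\<forall>t>0. 0 < b t) \<and>
    (\<forall>\<epsilon>>0.
      (\<exists>g. (\<forall>t>0. 0 < g t) \<and> mono_on {0<..} g \<and>
           equivalent_on_pos (\<lambda>t. t powr \<epsilon> * b t) g) \<and>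
      (\<exists>g. (\<forall>t>0. 0 < g t) \<and> antimono_on {0<..} g \<and>
           equivalent_on_pos (\<lambda>t. t powr (- \<epsilon>) * b t) g))}"


section \<open>Compatible couples of quasi-Banach spaces\<close>

class hausdorff_tvs = real_vector + topological_ab_group_add + t2_space +
  assumes tendsto_scaleR_tvs:
    "filterlim (\<lambda>p. fst p *\<^sub>R snd p) (nhds (c *\<^sub>R x)) (nhds c \<times>\<^sub>F nhds x)"

text \<open>A (quasi-)normed space inside an ambient vector space: its set of elements and its
  (quasi-)norm, whose values are relevant on that set only.\<close>

record 'v qspace =
  points :: "'v set"
  qnorm :: "'v \<Rightarrow> real"

definition quasi_normed :: "'v::real_vector qspace \<Rightarrow> bool" where
  "quasi_normed X \<longleftrightarrow> subspace (points X) \<and>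
    (\<forall>x\<in>points X. 0 \<le> qnorm X x \<and> (qnorm X x = 0 \<longleftrightarrow> x = 0)) \<and>
    (\<forall>c. \<forall>x\<in>points X. qnorm X (c *\<^sub>R x) = \<bar>c\<bar> * qnorm X x) \<and>
    (\<exists>C. \<forall>x\<in>points X. \<forall>y\<in>points X. qnorm X (x + y) \<le> C * (qnorm X x + qnorm X y))"

definition quasi_banach :: "'v::real_vector qspace \<Rightarrow> bool" where
  "quasi_banach X \<longleftrightarrow> quasi_normed X \<and>
    (\<forall>x::nat \<Rightarrow> 'v. (\<forall>n. x n \<in> points X) \<and>
        (\<forall>e>0. \<exists>M. \<forall>m\<ge>M. \<forall>n\<ge>M. qnorm X (x m - x n) < e) \<longrightarrow>
      (\<exists>y\<in>points X. (\<lambda>n. qnorm X (x n - y)) \<longlonglongrightarrow> 0))"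

text \<open>Continuity at \<open>0\<close> (hence everywhere, by linearity) of the inclusion into the ambient
  space.\<close>

definition embedded_in_ambient :: "'v::hausdorff_tvs qspace \<Rightarrow> bool" where
  "embedded_in_ambient X \<longleftrightarrow>
    (\<forall>U. open U \<and> 0 \<in> U \<longrightarrow> (\<exists>\<delta>>0. \<forall>x\<in>points X. qnorm X x < \<delta> \<longrightarrow> x \<in> U))"

definition compatible_couple :: "'v::hausdorff_tvs qspace \<Rightarrow> 'v qspace \<Rightarrow> bool" where
  "compatible_couple X0 X1 \<longleftrightarrow> quasi_normed X0 \<and> quasi_normed X1 \<and>
    embedded_in_ambient X0 \<and> embedded_in_ambient X1"

definition cont_embedded :: "'v qspace \<Rightarrow> 'v qspace \<Rightarrow> bool" where
  "cont_embedded X Y \<longleftrightarrow> points X \<subseteq> points Y \<and>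
    (\<exists>C. \<forall>x\<in>points X. qnorm Y x \<le> C * qnorm X x)"

definition space_eq :: "'v qspace \<Rightarrow> 'v qspace \<Rightarrow> bool" where
  "space_eq X Y \<longleftrightarrow> cont_embedded X Y \<and> cont_embedded Y X"

definition space_inter :: "'v qspace \<Rightarrow> 'v qspace \<Rightarrow> 'v qspace" where
  "space_inter X Y = \<lparr>points = points X \<inter> points Y, qnorm = (\<lambda>f. max (qnorm X f) (qnorm Y f))\<rparr>"


section \<open>The K-functional and interpolation spaces\<close>

definition sum_points :: "'v::real_vector qspace \<Rightarrow> 'v qspace \<Rightarrow> 'v set" where
  "sum_points X0 X1 = {f0 + f1 | f0 f1. f0 \<in> points X0 \<and> f1 \<in> points X1}"

definition K :: "'v::real_vector qspace \<Rightarrow> 'v qspace \<Rightarrow> real \<Rightarrow> 'v \<Rightarrow> ennreal" where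
  "K X0 X1 t f = Inf {ennreal (qnorm X0 f0 + t * qnorm X1 f1) | f0 f1.
      f0 \<in> points X0 \<and> f1 \<in> points X1 \<and> f = f0 + f1}"

definition finite_space :: "'v set \<Rightarrow> ('v \<Rightarrow> ennreal) \<Rightarrow> 'v qspace" where
  "finite_space S N = \<lparr>points = {f \<in> S. N f < \<infinity>}, qnorm = (\<lambda>f. enn2real (N f))\<rparr>"

definition interp ::
    "'v::real_vector qspace \<Rightarrow> 'v qspace \<Rightarrow> real \<Rightarrow> ennreal \<Rightarrow> (real \<Rightarrow> real) \<Rightarrow> 'v qspace" where
  "interp X0 X1 \<theta> q b = finite_space (sum_points X0 X1)
    (\<lambda>f. wnorm q \<theta> b {0<..} (\<lambda>u. K X0 X1 u f))"

definition interp_L ::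
    "'v::real_vector qspace \<Rightarrow> 'v qspace \<Rightarrow> real \<Rightarrow> ennreal \<Rightarrow> (real \<Rightarrow> real) \<Rightarrow>
     ennreal \<Rightarrow> (real \<Rightarrow> real) \<Rightarrow> 'v qspace" where
  "interp_L A0 A1 \<theta> r b q a = finite_space (sum_points A0 A1)
    (\<lambda>f. wnorm r 0 b {0<..} (\<lambda>t. wnorm q \<theta> a {0<..<t} (\<lambda>u. K A0 A1 u f)))"

definition interp_R ::
    "'v::real_vector qspace \<Rightarrow> 'v qspace \<Rightarrow> real \<Rightarrow> ennreal \<Rightarrow> (real \<Rightarrow> real) \<Rightarrow>
     ennreal \<Rightarrow> (real \<Rightarrow> real) \<Rightarrow> 'v qspace" where
  "interp_R A0 A1 \<theta> r b q a = finite_space (sum_points A0 A1)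
    (\<lambda>f. wnorm r 0 b {0<..} (\<lambda>t. wnorm q \<theta> a {t<..} (\<lambda>u. K A0 A1 u f)))"

definition interp_RR ::
    "'v::real_vector qspace \<Rightarrow> 'v qspace \<Rightarrow> real \<Rightarrow> ennreal \<Rightarrow> (real \<Rightarrow> real) \<Rightarrow>
     ennreal \<Rightarrow> (real \<Rightarrow> real) \<Rightarrow> ennreal \<Rightarrow> (real \<Rightarrow> real) \<Rightarrow> 'v qspace" where
  "interp_RR A0 A1 \<theta> p c r b q a = finite_space (sum_points A0 A1)
    (\<lambda>f. wnorm p 0 c {0<..} (\<lambda>t. wnorm r 0 b {t<..} (\<lambda>u. wnorm q \<theta> a {u<..} (\<lambda>v. K A0 A1 v f))))"


section \<open>The auxiliary functions \<open>\<chi>\<^sub>1\<close>, \<open>\<rho>\<close>, \<open>a\<^sup>#\<close> and \<open>B\<^sub>1\<close>\<close>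

definition chi ::
    "ennreal \<Rightarrow> (real \<Rightarrow> real) \<Rightarrow> ennreal \<Rightarrow> (real \<Rightarrow> real) \<Rightarrow> real \<Rightarrow> real" where
  "chi r1 b1 q1 a1 t =
    enn2real (wnorm r1 0 b1 {0<..<t} (\<lambda>s. wnorm q1 0 a1 {s<..<t} (\<lambda>u. 1)))"

definition rho :: "real \<Rightarrow> (real \<Rightarrow> real) \<Rightarrow> (real \<Rightarrow> real) \<Rightarrow> real \<Rightarrow> real" where
  "rho \<theta>0 b0 \<chi>1 t = t powr (1 - \<theta>0) * (b0 t / \<chi>1 t)"

definition a_sharp ::
    "real \<Rightarrow> (real \<Rightarrow> real) \<Rightarrow> (real \<Rightarrow> real) \<Rightarrow> (real \<Rightarrow> real) \<Rightarrow> (real \<Rightarrow> real) \<Rightarrow> real \<Rightarrow> real" where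
  "a_sharp \<theta> b0 \<chi>1 a \<rho> t = b0 t powr (1 - \<theta>) * \<chi>1 t powr \<theta> * a (\<rho> t)"

definition B_one ::
    "ennreal \<Rightarrow> (real \<Rightarrow> real) \<Rightarrow> (real \<Rightarrow> real) \<Rightarrow> (real \<Rightarrow> real) \<Rightarrow> real \<Rightarrow> real" where
  "B_one r1 b1 a \<rho> t = enn2real (wnorm r1 0 b1 {0<..<t} (\<lambda>s. 1)) * a (\<rho> t)"

end

theory Submission
  imports Defs
begin

text \<open>
  Write \<open>K(t)\<close> for the K-functional of \<open>f\<close> with respect to \<open>(A\<^sub>0, A\<^sub>1)\<close>, and \<open>X\<^sub>0\<close>, \<open>X\<^sub>1\<close> for the
  two spaces to which the outer interpolation functor is applied. The theorem follows from a
  formula of Holmstedt type,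
  \<open>K(\<rho>(t), f; X\<^sub>0, X\<^sub>1) \<approx> J(t) + \<rho>(t) (\<beta>(t) R(t) + S(t))\<close>,
  where \<open>J(t)\<close> is the norm of \<open>u\<^bsup>-\<theta>\<^sub>0 - 1/r\<^sub>0\<^esup> b\<^sub>0(u) K(u)\<close> over \<open>(0, t)\<close>, \<open>R(t)\<close> is the norm of
  \<open>u\<^bsup>-1 - 1/q\<^sub>1\<^esup> a\<^sub>1(u) K(u)\<close> over \<open>(t, \<infinity>)\<close>, \<open>S(t)\<close> is the norm of \<open>s\<^bsup>-1/r\<^sub>1\<^esup> b\<^sub>1(s) R(s)\<close> over
  \<open>(t, \<infinity>)\<close>, and \<open>\<beta>(t)\<close> is the norm of \<open>s\<^bsup>-1/r\<^sub>1\<^esup> b\<^sub>1(s)\<close> over \<open>(0, t)\<close>.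

  For the upper estimate (lemma \<open>K_le_holmstedt\<close>), a decomposition \<open>f = f\<^sub>0 + f\<^sub>1\<close> that is nearly optimal
  for \<open>K(t)\<close> has \<open>K(u, f\<^sub>0) \<lesssim> min(K(u), K(t))\<close> and \<open>K(u, f\<^sub>1) \<lesssim> min(1, u/t) K(max(u, t))\<close>. The norms of
  \<open>f\<^sub>0\<close> and \<open>f\<^sub>1\<close> give the terms of the formula and, in addition, \<open>\<rho>(t) \<chi>\<^sub>1(t) K(t) / t\<close>. The function
  \<open>\<rho>\<close> is chosen so that this is \<open>t\<^bsup>-\<theta>\<^sub>0\<^esup> b\<^sub>0(t) K(t)\<close>, which \<open>J(t)\<close> absorbs. For the lower estimate
  (lemma \<open>holmstedt_le_K\<close>) the right-hand side is quasi-subadditive in \<open>f\<close>, so it is enough to bound it by the norm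
  of \<open>X\<^sub>0\<close> and by \<open>\<rho>(t)\<close> times the norm of \<open>X\<^sub>1\<close>. The first bound uses \<open>\<beta> a\<^sub>1 \<lesssim> \<chi>\<^sub>1\<close>. The second uses
  \<open>\<chi>\<^sub>1(u) K(u) \<lesssim> u \<parallel>f\<parallel>\<close> in \<open>X\<^sub>1\<close>, which holds because \<open>K(u) / u\<close> is decreasing.

  Now take the outer norm and substitute \<open>\<rho>(t)\<close> for its variable (lemma \<open>snorm_change_variable\<close>). The weight
  in front of \<open>J\<close> becomes \<open>\<rho>\<^bsup>-\<theta>\<^esup> (a \<circ> \<rho>)\<close> and the weight in front of \<open>\<beta> R + S\<close> becomes
  \<open>\<rho>\<^bsup>1-\<theta>\<^esup> (a \<circ> \<rho>)\<close>. A Hardy inequality removes an inner norm over \<open>(0, t)\<close> when the outer weight decays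
  like a power, and an inner norm over \<open>(t, \<infinity>)\<close> when it grows like a power. For \<open>0 < \<theta> < 1\<close> all
  inner norms disappear, and what remains is the norm with weight \<open>t\<^bsup>-\<eta>\<^esup> a\<^sup>#(t)\<close>. For \<open>\<theta> = 0\<close> the term
  \<open>J\<close> survives and gives the space of type L. For \<open>\<theta> = 1\<close> the terms \<open>\<beta> R\<close> and \<open>S\<close> survive and give the spaces
  of types R and R,R.

  All norms are first replaced by sequence norms, with functions sampled at the powers of 2. On sequences the Hardy
  inequalities hold for all exponents in \<open>(0, \<infinity>]\<close>, because a geometrically decaying kernel can be
  split between a supremum and a sum. A change of variable becomes a reindexing with bounded
  fibres, and the slow variation of \<open>\<chi>\<^sub>1\<close> becomes an index shift. The comparison with sequences squeezes
  an integrand between two step functions, so it applies to \<open>a \<circ> \<rho>\<close>, which need not be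
  measurable.
\<close>

section \<open>Powers and quasi-norms of sequences\<close>

lemma epow_simps [simp]: "epow \<infinity> p = \<infinity>" "epow top p = top"
  by (auto simp: epow_def)

lemma epow_ennreal: "0 \<le> x \<Longrightarrow> epow (ennreal x) p = ennreal (x powr p)"
  by (simp add: epow_def)

lemma epow_0 [simp]: "epow 0 p = 0"
  by (simp add: epow_def)

lemma epow_1 [simp]: "epow 1 p = 1"
  by (simp add: epow_def)

lemma epow_mono: "0 \<le> p \<Longrightarrow> x \<le> y \<Longrightarrow> epow x p \<le> epow y p"
  by (cases x; cases y) (auto simp: epow_ennreal top_unique intro!: ennreal_leI powr_mono2)

lemma epow_mult: "0 < p \<Longrightarrow> epow (x * y) p = epow x p * epow y p"
  by (cases x; cases y)
     (auto simp: epow_ennreal powr_mult ennreal_mult_top ennreal_top_mult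
       simp flip: ennreal_mult)

lemma epow_epow: "0 < p \<Longrightarrow> epow (epow x p) (1 / p) = x" "0 < p \<Longrightarrow> epow (epow x (1 / p)) p = x"
  by (cases x; simp add: epow_ennreal powr_powr)+

lemma epow_less_top: "x < top \<Longrightarrow> epow x p < top"
  by (cases x) (auto simp: epow_ennreal)

lemma epow_add_le:
  assumes "0 < p"
  shows "epow (x + y) p \<le> ennreal (2 powr p) * (epow x p + epow y p)"
proof -
  have "x + y \<le> ennreal 2 * max x y"
    by (simp add: mult_2 add_mono)
  then have "epow (x + y) p \<le> epow (ennreal 2 * max x y) p"
    using assms by (intro epow_mono) auto
  also have "\<dots> = ennreal (2 powr p) * epow (max x y) p"
    using assms by (subst epow_mult, simp, subst epow_ennreal) auto
  also have "\<dots> \<le> ennreal (2 powr p) * (epow x p + epow y p)"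
    by (intro mult_left_mono) (auto simp: max_def)
  finally show ?thesis .
qed

text \<open>The quasi-norm of \<open>\<ell>\<^sub>q\<close> over the integers. It is the discrete counterpart of the norm of
  \<open>t\<^bsup>-1/q\<^esup> F(t)\<close> over \<open>(0, \<infinity>)\<close>, since \<open>dt/t\<close> gives equal mass to all dyadic intervals.\<close>
definition snorm :: "ennreal \<Rightarrow> (int \<Rightarrow> ennreal) \<Rightarrow> ennreal" where
  "snorm q x = (if q = \<infinity> then (SUP i. x i)
     else epow (\<integral>\<^sup>+ i. epow (x i) (enn2real q) \<partial>count_space UNIV) (recip q))"

definition snorm_on :: "ennreal \<Rightarrow> int set \<Rightarrow> (int \<Rightarrow> ennreal) \<Rightarrow> ennreal" where
  "snorm_on q S x = snorm q (\<lambda>i. if i \<in> S then x i else 0)"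

lemma recip_infinity [simp]: "recip \<infinity> = 0" "recip top = 0"
  by (auto simp: recip_def)

lemma recip_finite: "0 < q \<Longrightarrow> q \<noteq> \<infinity> \<Longrightarrow> 0 < enn2real q \<and> recip q = 1 / enn2real q"
  by (cases q) (auto simp: recip_def inverse_ennreal inverse_eq_divide)

lemma recip_nonneg [simp]: "0 \<le> recip q"
  by (simp add: recip_def)

lemma exponent_cases:
  assumes "0 < (q :: ennreal)"
  obtains "q = \<infinity>" | p where "0 < p" "q \<noteq> \<infinity>" "enn2real q = p" "recip q = 1 / p"
  using recip_finite[OF assms] by metis

lemma snorm_mono:
  assumes "0 < q" "\<And>i. x i \<le> y i"
  shows "snorm q x \<le> snorm q y"
  using assms(1)
proof (cases rule: exponent_cases)
  case 1
  then show ?thesis using assms(2) by (auto simp: snorm_def intro: SUP_mono)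
next
  case (2 p)
  then show ?thesis using assms(2)
    by (auto simp: snorm_def intro!: epow_mono nn_integral_mono)
qed

lemma snorm_cmult:
  assumes "0 < q"
  shows "snorm q (\<lambda>i. c * x i) = c * snorm q x"
  using assms
proof (cases rule: exponent_cases)
  case 1
  then show ?thesis by (simp add: snorm_def SUP_mult_left_ennreal)
next
  case (2 p)
  then show ?thesis
    by (simp add: snorm_def epow_mult nn_integral_cmult epow_epow)
qed

lemma snorm_point:
  assumes "0 < q"
  shows "x i \<le> snorm q x"
  using assms
proof (cases rule: exponent_cases)
  case 1
  then show ?thesis by (auto simp: snorm_def intro: SUP_upper)
next
  case (2 p)
  have "epow (epow (x i) p) (1 / p) \<le> epow (\<integral>\<^sup>+ i. epow (x i) p \<partial>count_space UNIV) (1 / p)"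
    using 2 by (intro epow_mono nn_integral_ge_point) auto
  then show ?thesis using 2 by (simp add: snorm_def epow_epow)
qed

text \<open>Tonelli for the sums of powers. The Hardy inequality uses this to sum its kernel over the
  outer index first.\<close>
lemma snorm_swap:
  assumes "0 < q"
  shows "snorm q (\<lambda>k. snorm q (\<lambda>i. y k i)) = snorm q (\<lambda>i. snorm q (\<lambda>k. y k i))"
  using assms
proof (cases rule: exponent_cases)
  case 1
  then show ?thesis by (simp add: snorm_def) (rule SUP_commute)
next
  case (2 p)
  have "(\<integral>\<^sup>+ k. \<integral>\<^sup>+ i. epow (y k i) p \<partial>count_space UNIV \<partial>count_space UNIV)
      = (\<integral>\<^sup>+ i. \<integral>\<^sup>+ k. epow (y k i) p \<partial>count_space UNIV \<partial>count_space UNIV)"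
    by (rule nn_integral_count_space_nn_integral) auto
  with 2 show ?thesis by (simp add: snorm_def epow_epow)
qed

lemma snorm_add:
  assumes "0 < q"
  shows "\<exists>C::real. \<forall>x y. snorm q (\<lambda>i. x i + y i) \<le> ennreal C * (snorm q x + snorm q y)"
  using assms
proof (cases rule: exponent_cases)
  case 1
  have "(SUP i. x i + y i) \<le> (SUP i. x i) + (SUP i. y i)" for x y :: "int \<Rightarrow> ennreal"
    by (intro SUP_least add_mono SUP_upper) auto
  with 1 show ?thesis by (intro exI[of _ 1]) (auto simp: snorm_def)
next
  case (2 p)
  have "snorm q (\<lambda>i. x i + y i) \<le> ennreal (2 * 2 powr (1 / p)) * (snorm q x + snorm q y)" for x y
  proof -
    let ?N = "\<lambda>x. \<integral>\<^sup>+ i. epow (x i) p \<partial>count_space UNIV"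
    have "?N (\<lambda>i. x i + y i) \<le> (\<integral>\<^sup>+ i. ennreal (2 powr p) * (epow (x i) p + epow (y i) p) \<partial>count_space UNIV)"
      using 2 by (intro nn_integral_mono epow_add_le)
    also have "\<dots> = ennreal (2 powr p) * (?N x + ?N y)"
      by (simp add: nn_integral_cmult nn_integral_add)
    finally have "epow (?N (\<lambda>i. x i + y i)) (1 / p) \<le> epow (ennreal (2 powr p) * (?N x + ?N y)) (1 / p)"
      using 2 by (intro epow_mono) auto
    also have "\<dots> = ennreal 2 * epow (?N x + ?N y) (1 / p)"
      using 2 by (simp add: epow_mult epow_ennreal powr_powr)
    also have "\<dots> \<le> ennreal 2 * (ennreal (2 powr (1 / p)) * (epow (?N x) (1 / p) + epow (?N y) (1 / p)))"
      using 2 by (intro mult_left_mono epow_add_le) auto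
    finally show ?thesis using 2
      by (simp add: snorm_def ennreal_mult mult.assoc)
  qed
  then show ?thesis by blast
qed

lemma snorm_shift:
  assumes "0 < q"
  shows "snorm q (\<lambda>i. x (i + m)) = snorm q x"
proof -
  have bij: "bij (\<lambda>i::int. i + m)"
    by (intro bijI' ) (auto intro: exI[of _ "_ - m"] simp: algebra_simps)
  have 1: "(SUP i. x (i + m)) = (SUP i. x i)"
    using bij by (metis bij_is_surj image_image)
  have 2: "(\<integral>\<^sup>+ i. epow (x (i + m)) p \<partial>count_space UNIV) = (\<integral>\<^sup>+ i. epow (x i) p \<partial>count_space UNIV)" for p
    using nn_integral_bij_count_space[OF bij, of "\<lambda>i. epow (x i) p"] by simp
  show ?thesis by (simp add: snorm_def 1 2)
qed

text \<open>Each value of \<open>h\<close> is repeated at most \<open>N\<close> times. This replaces the Jacobian in the discrete change of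
  variables.\<close>
lemma snorm_map:
  assumes "0 < q"
    and "\<And>j. finite {k. \<sigma> k = j} \<and> card {k. \<sigma> k = j} \<le> N"
  shows "\<exists>C::real. \<forall>h. snorm q (\<lambda>k. h (\<sigma> k)) \<le> ennreal C * snorm q h"
  using assms(1)
proof (cases rule: exponent_cases)
  case 1
  then show ?thesis
    by (intro exI[of _ 1]) (auto simp: snorm_def intro!: SUP_least SUP_upper)
next
  case (2 p)
  have "snorm q (\<lambda>k. h (\<sigma> k)) \<le> ennreal (real N powr (1 / p)) * snorm q h" for h
  proof -
    have "(\<integral>\<^sup>+ k. epow (h (\<sigma> k)) p \<partial>count_space UNIV)
        = (\<integral>\<^sup>+ k. \<integral>\<^sup>+ j. epow (h j) p * indicator {k. \<sigma> k = j} k \<partial>count_space UNIV \<partial>count_space UNIV)"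
    proof (intro nn_integral_cong)
      fix k
      have "(\<integral>\<^sup>+ j. epow (h j) p * indicator {k. \<sigma> k = j} k \<partial>count_space UNIV)
          = (\<Sum>j\<in>{\<sigma> k}. epow (h j) p * indicator {k. \<sigma> k = j} k)"
        by (rule nn_integral_count_space') auto
      then show "epow (h (\<sigma> k)) p = (\<integral>\<^sup>+ j. epow (h j) p * indicator {k. \<sigma> k = j} k \<partial>count_space UNIV)"
        by simp
    qed
    also have "\<dots> = (\<integral>\<^sup>+ j. \<integral>\<^sup>+ k. epow (h j) p * indicator {k. \<sigma> k = j} k \<partial>count_space UNIV \<partial>count_space UNIV)"
      by (rule nn_integral_count_space_nn_integral) auto
    also have "\<dots> \<le> (\<integral>\<^sup>+ j. of_nat N * epow (h j) p \<partial>count_space UNIV)"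
    proof (intro nn_integral_mono)
      fix j
      have "(\<integral>\<^sup>+ k. epow (h j) p * indicator {k. \<sigma> k = j} k \<partial>count_space UNIV)
          = epow (h j) p * of_nat (card {k. \<sigma> k = j})"
        using assms(2)[of j] by (simp add: nn_integral_cmult_indicator)
      also have "\<dots> \<le> of_nat N * epow (h j) p"
        using assms(2)[of j] by (subst mult.commute) (intro mult_right_mono, auto)
      finally show "(\<integral>\<^sup>+ k. epow (h j) p * indicator {k. \<sigma> k = j} k \<partial>count_space UNIV) \<le> of_nat N * epow (h j) p" .
    qed
    also have "\<dots> = ennreal (real N) * (\<integral>\<^sup>+ j. epow (h j) p \<partial>count_space UNIV)"
      by (simp add: nn_integral_cmult ennreal_of_nat_eq_real_of_nat)
    finally have "epow (\<integral>\<^sup>+ k. epow (h (\<sigma> k)) p \<partial>count_space UNIV) (1 / p)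
        \<le> epow (ennreal (real N) * (\<integral>\<^sup>+ j. epow (h j) p \<partial>count_space UNIV)) (1 / p)"
      using 2 by (intro epow_mono) auto
    then show ?thesis using 2 by (simp add: snorm_def epow_mult epow_ennreal)
  qed
  then show ?thesis by blast
qed

text \<open>Summing over the spheres \<open>{n, -n}\<close> compares the norm with a geometric series.\<close>
lemma snorm_geometric_finite:
  assumes "0 < q" "0 < \<gamma>"
  shows "snorm q (\<lambda>i. ennreal (2 powr (- \<gamma> * \<bar>real_of_int i\<bar>))) < \<infinity>"
  using assms(1)
proof (cases rule: exponent_cases)
  case 1
  have "(SUP i::int. ennreal (2 powr (- \<gamma> * \<bar>real_of_int i\<bar>))) \<le> ennreal (2 powr 0)"
    using assms by (intro SUP_least ennreal_leI powr_mono) auto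
  also have "\<dots> < \<infinity>" by simp
  finally show ?thesis using 1 by (simp add: snorm_def)
next
  case (2 p)
  define c where "c = 2 powr (- \<gamma> * p)"
  have c: "0 \<le> c" "c < 1" using assms 2 by (auto simp: c_def intro!: powr_less_one)
  have pw: "2 powr (- \<gamma> * p * real n) = c ^ n" for n
    by (simp add: c_def powr_power mult_ac)
  have "(\<integral>\<^sup>+ i. ennreal ((2 powr (- \<gamma> * \<bar>real_of_int i\<bar>)) powr p) \<partial>count_space (UNIV :: int set))
      \<le> (\<integral>\<^sup>+ i. (\<Sum>n. ennreal (c ^ n) * indicator {int n, - int n} i) \<partial>count_space (UNIV :: int set))"
  proof (intro nn_integral_mono)
    fix i :: int
    have "ennreal ((2 powr (- \<gamma> * \<bar>real_of_int i\<bar>)) powr p) = ennreal (c ^ nat \<bar>i\<bar>) * indicator {int (nat \<bar>i\<bar>), - int (nat \<bar>i\<bar>)} i"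
      using pw[of "nat \<bar>i\<bar>"] by (auto simp: powr_powr indicator_def mult_ac)
    also have "\<dots> \<le> (\<Sum>n. ennreal (c ^ n) * indicator {int n, - int n} i)" (is "_ \<le> suminf ?f")
    proof -
      have "sum ?f {nat \<bar>i\<bar>} \<le> suminf ?f"
        by (intro sum_le_suminf) auto
      then show ?thesis by (simp only: sum.insert sum.empty finite.emptyI empty_iff not_False_eq_True add_0_right)
    qed
    finally show "ennreal ((2 powr (- \<gamma> * \<bar>real_of_int i\<bar>)) powr p)
        \<le> (\<Sum>n. ennreal (c ^ n) * indicator {int n, - int n} i)" .
  qed
  also have "\<dots> = (\<Sum>n. \<integral>\<^sup>+ i. ennreal (c ^ n) * indicator {int n, - int n} i \<partial>count_space (UNIV :: int set))"
    by (rule nn_integral_suminf) auto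
  also have "\<dots> \<le> (\<Sum>n. ennreal (2 * c ^ n))"
  proof (intro suminf_le)
    fix n
    have "(\<integral>\<^sup>+ i. ennreal (c ^ n) * indicator {int n, - int n} i \<partial>count_space (UNIV :: int set))
        = ennreal (c ^ n) * of_nat (card {int n, - int n})"
      by (simp add: nn_integral_cmult_indicator)
    also have "\<dots> \<le> ennreal (c ^ n) * of_nat 2"
      by (intro mult_left_mono) (auto simp: card_insert_if)
    also have "\<dots> = ennreal (2 * c ^ n)"
      using c by (simp add: ennreal_mult mult.commute)
    finally show "(\<integral>\<^sup>+ i. ennreal (c ^ n) * indicator {int n, - int n} i \<partial>count_space (UNIV :: int set)) \<le> ennreal (2 * c ^ n)" .
  qed auto
  also have "\<dots> = ennreal (\<Sum>n. 2 * c ^ n)"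
    using c by (intro suminf_ennreal2) (auto intro!: summable_mult summable_geometric)
  also have "\<dots> < \<infinity>" by simp
  finally show ?thesis using 2 by (simp add: snorm_def epow_ennreal epow_less_top)
qed

section \<open>Domination with a uniform constant\<close>

text \<open>Domination of functionals on \<open>P\<close> with a constant that is uniform over \<open>P\<close>. The parameter is a vector,
  a sequence, or a tuple of such objects and indices; stating estimates in this way keeps constants
  independent of the vector without carrying them through every argument.\<close>
definition dominated :: "'p set \<Rightarrow> ('p \<Rightarrow> ennreal) \<Rightarrow> ('p \<Rightarrow> ennreal) \<Rightarrow> bool" where
  "dominated P A B \<longleftrightarrow> (\<exists>C::real. \<forall>p\<in>P. A p \<le> ennreal C * B p)"

lemma dominatedI: "(\<And>p. p \<in> P \<Longrightarrow> A p \<le> ennreal C * B p) \<Longrightarrow> dominated P A B"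
  by (auto simp: dominated_def)

lemma dominatedE:
  assumes "dominated P A B"
  obtains C :: real where "0 < C" "\<And>p. p \<in> P \<Longrightarrow> A p \<le> ennreal C * B p"
proof -
  from assms obtain C :: real where C: "\<And>p. p \<in> P \<Longrightarrow> A p \<le> ennreal C * B p"
    by (auto simp: dominated_def)
  show thesis
  proof (rule that[of "max C 1"])
    fix p assume "p \<in> P"
    then show "A p \<le> ennreal (max C 1) * B p"
      using C by (meson ennreal_leI max.cobounded1 mult_right_mono order_trans zero_le)
  qed auto
qed

lemma dominated_le: "(\<And>p. p \<in> P \<Longrightarrow> A p \<le> B p) \<Longrightarrow> dominated P A B"
  by (rule dominatedI[where C = 1]) simp

lemma dominated_refl [simp, intro]: "dominated P A A"
  by (rule dominated_le) simp

lemma dominated_trans [trans]: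
  assumes "dominated P A B" "dominated P B D" shows "dominated P A D"
proof -
  obtain c d :: real where cd: "0 < c" "0 < d"
    "\<And>p. p \<in> P \<Longrightarrow> A p \<le> ennreal c * B p" "\<And>p. p \<in> P \<Longrightarrow> B p \<le> ennreal d * D p"
    using dominatedE[OF assms(1)] dominatedE[OF assms(2)] by metis
  show ?thesis
  proof (rule dominatedI)
    fix p assume p: "p \<in> P"
    have "A p \<le> ennreal c * B p" using cd p by auto
    also have "\<dots> \<le> ennreal c * (ennreal d * D p)" using cd p by (intro mult_left_mono) auto
    also have "\<dots> = ennreal (c * d) * D p" using cd by (simp add: ennreal_mult mult.assoc)
    finally show "A p \<le> ennreal (c * d) * D p" .
  qed
qed

lemma dominated_comp: "dominated P A B \<Longrightarrow> (\<And>p. p \<in> Q \<Longrightarrow> g p \<in> P) \<Longrightarrow> dominated Q (\<lambda>p. A (g p)) (\<lambda>p. B (g p))"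
  unfolding dominated_def by blast

lemma dominated_add_least:
  assumes "dominated P A D" "dominated P B D"
  shows "dominated P (\<lambda>p. A p + B p) D"
proof -
  obtain c d :: real where cd: "0 < c" "0 < d"
    "\<And>p. p \<in> P \<Longrightarrow> A p \<le> ennreal c * D p" "\<And>p. p \<in> P \<Longrightarrow> B p \<le> ennreal d * D p"
    using dominatedE[OF assms(1)] dominatedE[OF assms(2)] by metis
  show ?thesis
  proof (rule dominatedI)
    fix p assume p: "p \<in> P"
    then have "A p + B p \<le> ennreal c * D p + ennreal d * D p"
      using cd by (intro add_mono) auto
    also have "\<dots> = ennreal (c + d) * D p" using cd by (simp add: distrib_right)
    finally show "A p + B p \<le> ennreal (c + d) * D p" .
  qed
qed

lemma dominated_add1: "dominated P A B \<Longrightarrow> dominated P A (\<lambda>p. B p + D p)"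
  by (erule dominated_trans) (auto intro: dominated_le)

lemma dominated_add2: "dominated P A D \<Longrightarrow> dominated P A (\<lambda>p. B p + D p)"
  by (erule dominated_trans) (auto intro: dominated_le)

lemma dominated_add: "dominated P A B \<Longrightarrow> dominated P A' B' \<Longrightarrow> dominated P (\<lambda>p. A p + A' p) (\<lambda>p. B p + B' p)"
  by (intro dominated_add_least dominated_add1 dominated_add2)

lemma dominated_mult_left: "dominated P A B \<Longrightarrow> dominated P (\<lambda>p. w p * A p) (\<lambda>p. w p * B p)"
proof (erule dominatedE)
  fix C :: real assume C: "0 < C" "\<And>p. p \<in> P \<Longrightarrow> A p \<le> ennreal C * B p"
  show ?thesis
  proof (rule dominatedI)
    fix p assume "p \<in> P"
    then have "w p * A p \<le> w p * (ennreal C * B p)" using C by (intro mult_left_mono) auto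
    then show "w p * A p \<le> ennreal C * (w p * B p)" by (simp add: mult_ac)
  qed
qed

lemma dominated_cmult_left: "dominated P (\<lambda>p. ennreal c * A p) A"
  by (rule dominatedI) auto

lemma dominated_max: "dominated P A D \<Longrightarrow> dominated P B D \<Longrightarrow> dominated P (\<lambda>p. max (A p) (B p)) D"
  by (rule dominated_trans[OF dominated_le[where B = "\<lambda>p. A p + B p"] dominated_add_least]) (auto simp: max_def)

section \<open>Dominated sequence norms\<close>

lemma dominated_snorm:
  assumes "0 < q" "dominated (P \<times> UNIV) (\<lambda>(p, k). x p k) (\<lambda>(p, k). y p k)"
  shows "dominated P (\<lambda>p. snorm q (x p)) (\<lambda>p. snorm q (y p))"
proof -
  obtain C :: real where C: "0 < C" "\<And>p k. p \<in> P \<Longrightarrow> x p k \<le> ennreal C * y p k"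
    using dominatedE[OF assms(2)] by (metis (mono_tags, lifting) UNIV_I case_prod_conv mem_Sigma_iff)
  have "snorm q (x p) \<le> ennreal C * snorm q (y p)" if "p \<in> P" for p
    using snorm_mono[OF assms(1), of "x p" "\<lambda>k. ennreal C * y p k"] C that
    by (simp add: snorm_cmult[OF assms(1)])
  then show ?thesis by (rule dominatedI)
qed

lemma dominated_snorm_add:
  assumes "0 < q"
  shows "dominated P (\<lambda>p. snorm q (\<lambda>k. x p k + y p k)) (\<lambda>p. snorm q (x p) + snorm q (y p))"
  using snorm_add[OF assms] unfolding dominated_def by blast

lemma dominated_snorm_add_least:
  assumes "0 < q" "dominated P (\<lambda>p. snorm q (x p)) D" "dominated P (\<lambda>p. snorm q (y p)) D"
  shows "dominated P (\<lambda>p. snorm q (\<lambda>k. x p k + y p k)) D"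
  by (rule dominated_trans[OF dominated_snorm_add[OF assms(1)] dominated_add_least]) (use assms in auto)

lemma dominated_snorm_map:
  assumes "0 < q"
    and fin: "\<And>j. finite {k. \<sigma> k = j} \<and> card {k. \<sigma> k = j} \<le> N"
    and xy: "dominated (P \<times> UNIV) (\<lambda>(p, k). x p k) (\<lambda>(p, k). y p (\<sigma> k))"
  shows "dominated P (\<lambda>p. snorm q (x p)) (\<lambda>p. snorm q (y p))"
proof -
  have "dominated P (\<lambda>p. snorm q (x p)) (\<lambda>p. snorm q (\<lambda>k. y p (\<sigma> k)))"
    using assms(1) xy by (rule dominated_snorm)
  also have "dominated P (\<lambda>p. snorm q (\<lambda>k. y p (\<sigma> k))) (\<lambda>p. snorm q (y p))"
    using snorm_map[OF assms(1) fin] unfolding dominated_def by blast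
  finally show ?thesis .
qed

lemma snorm_on_UNIV [simp]: "snorm_on q UNIV x = snorm q x"
  by (simp add: snorm_on_def)

lemma snorm_on_mono:
  assumes "0 < q" "\<And>i. i \<in> S \<Longrightarrow> i \<in> T \<and> x i \<le> y i"
  shows "snorm_on q S x \<le> snorm_on q T y"
  unfolding snorm_on_def using assms by (intro snorm_mono) auto

lemma snorm_on_le_snorm: "0 < q \<Longrightarrow> snorm_on q S x \<le> snorm q x"
  using snorm_on_mono[of q S UNIV x x] by simp

lemma snorm_on_cong:
  "(\<And>i. i \<in> S \<Longrightarrow> x i = y i) \<Longrightarrow> snorm_on q S x = snorm_on q S y"
  unfolding snorm_on_def by (metis (mono_tags, lifting))

lemma snorm_on_cmult: "0 < q \<Longrightarrow> snorm_on q S (\<lambda>i. c * x i) = c * snorm_on q S x"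
  unfolding snorm_on_def by (subst snorm_cmult[symmetric]) (auto intro!: arg_cong[of _ _ "snorm q"])

lemma snorm_on_point: "0 < q \<Longrightarrow> i \<in> S \<Longrightarrow> x i \<le> snorm_on q S x"
  unfolding snorm_on_def using snorm_point[of q "\<lambda>i. if i \<in> S then x i else 0" i] by simp

lemma dominated_snorm_on:
  assumes "0 < q" "dominated {(p, i). p \<in> P \<and> i \<in> S p} (\<lambda>(p, i). x p i) (\<lambda>(p, i). y p i)"
  shows "dominated P (\<lambda>p. snorm_on q (S p) (x p)) (\<lambda>p. snorm_on q (S p) (y p))"
  unfolding snorm_on_def
proof (rule dominated_snorm[OF assms(1)])
  obtain C :: real where C: "\<And>p k. p \<in> P \<Longrightarrow> k \<in> S p \<Longrightarrow> x p k \<le> ennreal C * y p k"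
    using assms(2) unfolding dominated_def by fastforce
  show "dominated (P \<times> UNIV) (\<lambda>(p, k). if k \<in> S p then x p k else 0)
      (\<lambda>(p, k). if k \<in> S p then y p k else 0)"
    by (rule dominatedI[where C = C]) (use C in auto)
qed

lemma dominated_snorm_on_add:
  assumes "0 < q"
  shows "dominated P (\<lambda>p. snorm_on q (S p) (\<lambda>k. x p k + y p k))
    (\<lambda>p. snorm_on q (S p) (x p) + snorm_on q (S p) (y p))"
proof -
  have eq: "(\<lambda>p. snorm_on q (S p) (\<lambda>k. x p k + y p k)) =
     (\<lambda>p. snorm q (\<lambda>k. (if k \<in> S p then x p k else 0) + (if k \<in> S p then y p k else 0)))"
    unfolding snorm_on_def by (auto intro!: ext arg_cong[of _ _ "snorm q"])
  show ?thesis unfolding eq unfolding snorm_on_def by (rule dominated_snorm_add[OF assms])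
qed

lemma dominated_snorm_on_split:
  assumes "0 < q" "\<And>p. p \<in> P \<Longrightarrow> S p \<subseteq> T p \<union> U p"
  shows "dominated P (\<lambda>p. snorm_on q (S p) (x p)) (\<lambda>p. snorm_on q (T p) (x p) + snorm_on q (U p) (x p))"
proof -
  have "dominated P (\<lambda>p. snorm_on q (S p) (x p))
    (\<lambda>p. snorm q (\<lambda>k. (if k \<in> T p then x p k else 0) + (if k \<in> U p then x p k else 0)))"
    unfolding snorm_on_def
    by (rule dominated_snorm[OF assms(1)], rule dominated_le) (use assms(2) in \<open>fastforce split: if_splits\<close>)
  also have "dominated P \<dots> (\<lambda>p. snorm_on q (T p) (x p) + snorm_on q (U p) (x p))"
    unfolding snorm_on_def by (rule dominated_snorm_add[OF assms(1)])
  finally show ?thesis .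
qed

text \<open>A fixed index shift costs only a constant when consecutive terms are comparable.\<close>
lemma dominated_snorm_on_shift:
  assumes "0 < q"
    and "\<And>p i. p \<in> P \<Longrightarrow> i \<in> S p \<Longrightarrow> i + m \<in> T p"
    and "dominated {(p, i). p \<in> P \<and> i \<in> S p} (\<lambda>(p, i). x p i) (\<lambda>(p, i). y p (i + m))"
  shows "dominated P (\<lambda>p. snorm_on q (S p) (x p)) (\<lambda>p. snorm_on q (T p) (y p))"
proof -
  have "dominated P (\<lambda>p. snorm_on q (S p) (x p)) (\<lambda>p. snorm_on q (S p) (\<lambda>i. y p (i + m)))"
    by (rule dominated_snorm_on[OF assms(1,3)])
  also have "dominated P \<dots> (\<lambda>p. snorm_on q (T p) (y p))"
  proof (rule dominated_le)
    fix p assume p: "p \<in> P"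
    have "snorm_on q (S p) (\<lambda>i. y p (i + m)) \<le> snorm q (\<lambda>i. if i + m \<in> T p then y p (i + m) else 0)"
      unfolding snorm_on_def using assms(2)[OF p] by (intro snorm_mono assms(1)) auto
    also have "\<dots> = snorm q (\<lambda>i. if i \<in> T p then y p i else 0)"
      using snorm_shift[OF assms(1), of "\<lambda>i. if i \<in> T p then y p i else 0" m] by simp
    finally show "snorm_on q (S p) (\<lambda>i. y p (i + m)) \<le> snorm_on q (T p) (y p)"
      by (simp add: snorm_on_def)
  qed
  finally show ?thesis .
qed

section \<open>Regularly varying weights\<close>

text \<open>Regular variation of index \<open>\<delta>\<close> in the sense of Potter bounds: \<open>w\<close> is \<open>t\<^bsup>\<delta>\<^esup>\<close> times a slowly varying
  factor. In contrast to the class \<open>SV\<close> it does not ask for measurability, so it is stable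
  under composition.\<close>
definition regvar :: "real \<Rightarrow> (real \<Rightarrow> real) \<Rightarrow> bool" where
  "regvar \<delta> w \<longleftrightarrow> (\<forall>t>0. 0 < w t) \<and>
    (\<forall>\<epsilon>>0. \<exists>C>0. \<forall>s>0. \<forall>t\<ge>s. w t \<le> C * (t / s) powr (\<delta> + \<epsilon>) * w s \<and>
       w s \<le> C * (t / s) powr (\<epsilon> - \<delta>) * w t)"

lemma regvarI:
  assumes "\<And>t. 0 < t \<Longrightarrow> 0 < w t"
    and "\<And>\<epsilon>. 0 < \<epsilon> \<Longrightarrow> \<exists>C>0. \<forall>s t. 0 < s \<and> s \<le> t \<longrightarrow> w t \<le> C * (t / s) powr (\<delta> + \<epsilon>) * w s \<and>
       w s \<le> C * (t / s) powr (\<epsilon> - \<delta>) * w t"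
  shows "regvar \<delta> w"
  unfolding regvar_def
proof (intro conjI allI impI)
  show "0 < w t" if "0 < t" for t using assms(1) that .
  fix \<epsilon> :: real assume "0 < \<epsilon>"
  from assms(2)[OF this] show "\<exists>C>0. \<forall>s>0. \<forall>t\<ge>s. w t \<le> C * (t / s) powr (\<delta> + \<epsilon>) * w s \<and>
       w s \<le> C * (t / s) powr (\<epsilon> - \<delta>) * w t" by auto
qed

lemma regvar_pos: "regvar \<delta> w \<Longrightarrow> 0 < t \<Longrightarrow> 0 < w t"
  by (auto simp: regvar_def)

lemma regvarE:
  assumes "regvar \<delta> w" "0 < \<epsilon>"
  obtains C where "0 < C" "\<And>s t. 0 < s \<Longrightarrow> s \<le> t \<Longrightarrow> w t \<le> C * (t / s) powr (\<delta> + \<epsilon>) * w s"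
    "\<And>s t. 0 < s \<Longrightarrow> s \<le> t \<Longrightarrow> w s \<le> C * (t / s) powr (\<epsilon> - \<delta>) * w t"
proof -
  from assms have "\<exists>C>0. \<forall>s>0. \<forall>t\<ge>s. w t \<le> C * (t / s) powr (\<delta> + \<epsilon>) * w s \<and>
       w s \<le> C * (t / s) powr (\<epsilon> - \<delta>) * w t" by (simp add: regvar_def)
  then show ?thesis using that by blast
qed

text \<open>The increasing and the decreasing function in the definition of slow variation give the two Potter
  bounds.\<close>
lemma regvar_SV:
  assumes "b \<in> SV"
  shows "regvar 0 b"
proof (rule regvarI)
  show "0 < b t" if "0 < t" for t using assms that by (auto simp: SV_def)
  fix \<epsilon> :: real assume e: "0 < \<epsilon>"
  have "\<exists>g. (\<forall>t>0. 0 < g t) \<and> mono_on {0<..} g \<and> equivalent_on_pos (\<lambda>t. t powr \<epsilon> * b t) g"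
    using assms e by (simp add: SV_def)
  then obtain g where g: "mono_on {0<..} g" "equivalent_on_pos (\<lambda>t. t powr \<epsilon> * b t) g"
    by auto
  then obtain c where c: "0 < c"
    "\<And>t. 0 < t \<Longrightarrow> inverse c * g t \<le> t powr \<epsilon> * b t \<and> t powr \<epsilon> * b t \<le> c * g t"
    unfolding equivalent_on_pos_def by auto
  have "\<exists>g. (\<forall>t>0. 0 < g t) \<and> antimono_on {0<..} g \<and> equivalent_on_pos (\<lambda>t. t powr (- \<epsilon>) * b t) g"
    using assms e by (simp add: SV_def)
  then obtain h where h: "antimono_on {0<..} h" "equivalent_on_pos (\<lambda>t. t powr (- \<epsilon>) * b t) h"
    by auto
  then obtain d where d: "0 < d"
    "\<And>t. 0 < t \<Longrightarrow> inverse d * h t \<le> t powr (- \<epsilon>) * b t \<and> t powr (- \<epsilon>) * b t \<le> d * h t"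
    unfolding equivalent_on_pos_def by auto
  show "\<exists>C>0. \<forall>s t. 0 < s \<and> s \<le> t \<longrightarrow> b t \<le> C * (t / s) powr (0 + \<epsilon>) * b s \<and>
       b s \<le> C * (t / s) powr (\<epsilon> - 0) * b t"
  proof (intro exI[of _ "max (c\<^sup>2) (d\<^sup>2)"] conjI allI impI; (elim conjE)?)
    show "0 < max (c\<^sup>2) (d\<^sup>2)" using c by (simp add: less_max_iff_disj)
    fix s t :: real assume st: "0 < s" "s \<le> t"
    have bp: "0 < b s" "0 < b t" using assms st by (auto simp: SV_def)
    have "t powr (- \<epsilon>) * b t \<le> d * h t" using d st by auto
    also have "\<dots> \<le> d * h s" using h st d by (intro mult_left_mono) (auto simp: monotone_on_def)
    also have "\<dots> = d * d * (inverse d * h s)" using d by simp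
    also have "\<dots> \<le> d * d * (s powr (- \<epsilon>) * b s)" using d st by (intro mult_left_mono) auto
    finally have "b t \<le> d\<^sup>2 * ((t / s) powr \<epsilon> * b s)"
      using st by (simp add: powr_minus powr_divide divide_simps power2_eq_square mult_ac)
    also have "\<dots> \<le> max (c\<^sup>2) (d\<^sup>2) * ((t / s) powr \<epsilon> * b s)"
      using bp by (intro mult_right_mono) auto
    finally show "b t \<le> max (c\<^sup>2) (d\<^sup>2) * (t / s) powr (0 + \<epsilon>) * b s" by (simp add: mult.assoc)
    have "s powr \<epsilon> * b s \<le> c * g s" using c st by auto
    also have "\<dots> \<le> c * g t" using g st c by (intro mult_left_mono) (auto simp: monotone_on_def)
    also have "\<dots> = c * c * (inverse c * g t)" using c by simp
    also have "\<dots> \<le> c * c * (t powr \<epsilon> * b t)" using c st by (intro mult_left_mono) auto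
    finally have "b s \<le> c\<^sup>2 * ((t / s) powr \<epsilon> * b t)"
      using st by (simp add: powr_divide divide_simps power2_eq_square mult_ac)
    also have "\<dots> \<le> max (c\<^sup>2) (d\<^sup>2) * ((t / s) powr \<epsilon> * b t)"
      using bp by (intro mult_right_mono) auto
    finally show "b s \<le> max (c\<^sup>2) (d\<^sup>2) * (t / s) powr (\<epsilon> - 0) * b t" by (simp add: mult.assoc)
  qed
qed

lemma regvar_mult:
  assumes "regvar \<delta> v" "regvar \<delta>' w"
  shows "regvar (\<delta> + \<delta>') (\<lambda>t. v t * w t)"
proof (rule regvarI)
  show "0 < v t * w t" if "0 < t" for t using assms that by (simp add: regvar_pos)
  fix \<epsilon> :: real assume "0 < \<epsilon>"
  then have e: "0 < \<epsilon> / 2" by simp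
  obtain c where c: "0 < c" "\<And>s t. 0 < s \<Longrightarrow> s \<le> t \<Longrightarrow> v t \<le> c * (t / s) powr (\<delta> + \<epsilon> / 2) * v s"
    "\<And>s t. 0 < s \<Longrightarrow> s \<le> t \<Longrightarrow> v s \<le> c * (t / s) powr (\<epsilon> / 2 - \<delta>) * v t"
    using regvarE[OF assms(1) e] by blast
  obtain d where d: "0 < d" "\<And>s t. 0 < s \<Longrightarrow> s \<le> t \<Longrightarrow> w t \<le> d * (t / s) powr (\<delta>' + \<epsilon> / 2) * w s"
    "\<And>s t. 0 < s \<Longrightarrow> s \<le> t \<Longrightarrow> w s \<le> d * (t / s) powr (\<epsilon> / 2 - \<delta>') * w t"
    using regvarE[OF assms(2) e] by blast
  show "\<exists>C>0. \<forall>s t. 0 < s \<and> s \<le> t \<longrightarrow>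
      v t * w t \<le> C * (t / s) powr (\<delta> + \<delta>' + \<epsilon>) * (v s * w s) \<and>
      v s * w s \<le> C * (t / s) powr (\<epsilon> - (\<delta> + \<delta>')) * (v t * w t)"
  proof (intro exI[of _ "c * d"] conjI allI impI; (elim conjE)?)
    show "0 < c * d" using c d by simp
    fix s t :: real assume st: "0 < s" "s \<le> t"
    have p: "0 < v s" "0 < w s" "0 < v t" "0 < w t" using assms st by (auto simp: regvar_pos)
    have "v t * w t \<le> (c * (t / s) powr (\<delta> + \<epsilon> / 2) * v s) * (d * (t / s) powr (\<delta>' + \<epsilon> / 2) * w s)"
      using c d st p by (intro mult_mono) auto
    also have "\<dots> = c * d * ((t / s) powr (\<delta> + \<epsilon> / 2) * (t / s) powr (\<delta>' + \<epsilon> / 2)) * (v s * w s)"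
      by (simp add: mult_ac)
    also have "(t / s) powr (\<delta> + \<epsilon> / 2) * (t / s) powr (\<delta>' + \<epsilon> / 2) = (t / s) powr (\<delta> + \<delta>' + \<epsilon>)"
      by (simp add: powr_add[symmetric] algebra_simps)
    finally show "v t * w t \<le> c * d * (t / s) powr (\<delta> + \<delta>' + \<epsilon>) * (v s * w s)" .
    have "v s * w s \<le> (c * (t / s) powr (\<epsilon> / 2 - \<delta>) * v t) * (d * (t / s) powr (\<epsilon> / 2 - \<delta>') * w t)"
      using c d st p by (intro mult_mono) auto
    also have "\<dots> = c * d * ((t / s) powr (\<epsilon> / 2 - \<delta>) * (t / s) powr (\<epsilon> / 2 - \<delta>')) * (v t * w t)"
      by (simp add: mult_ac)
    also have "(t / s) powr (\<epsilon> / 2 - \<delta>) * (t / s) powr (\<epsilon> / 2 - \<delta>') = (t / s) powr (\<epsilon> - (\<delta> + \<delta>'))"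
      by (simp add: powr_add[symmetric] algebra_simps)
    finally show "v s * w s \<le> c * d * (t / s) powr (\<epsilon> - (\<delta> + \<delta>')) * (v t * w t)" .
  qed
qed

lemma regvar_inverse:
  assumes "regvar \<delta> w"
  shows "regvar (- \<delta>) (\<lambda>t. 1 / w t)"
proof (rule regvarI)
  show "0 < 1 / w t" if "0 < t" for t using assms that by (simp add: regvar_pos)
  fix \<epsilon> :: real assume e: "0 < \<epsilon>"
  obtain c where c: "0 < c" "\<And>s t. 0 < s \<Longrightarrow> s \<le> t \<Longrightarrow> w t \<le> c * (t / s) powr (\<delta> + \<epsilon>) * w s"
    "\<And>s t. 0 < s \<Longrightarrow> s \<le> t \<Longrightarrow> w s \<le> c * (t / s) powr (\<epsilon> - \<delta>) * w t"
    using regvarE[OF assms(1) e] by blast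
  show "\<exists>C>0. \<forall>s t. 0 < s \<and> s \<le> t \<longrightarrow>
      1 / w t \<le> C * (t / s) powr (- \<delta> + \<epsilon>) * (1 / w s) \<and>
      1 / w s \<le> C * (t / s) powr (\<epsilon> - (- \<delta>)) * (1 / w t)"
  proof (intro exI[of _ c] conjI allI impI; (elim conjE)?)
    show "0 < c" by fact
    fix s t :: real assume st: "0 < s" "s \<le> t"
    have p: "0 < w s" "0 < w t" using assms st by (auto simp: regvar_pos)
    show "1 / w t \<le> c * (t / s) powr (- \<delta> + \<epsilon>) * (1 / w s)"
      using c(3)[OF st] p by (simp add: field_simps)
    show "1 / w s \<le> c * (t / s) powr (\<epsilon> - (- \<delta>)) * (1 / w t)"
      using c(2)[OF st] p by (simp add: field_simps)
  qed
qed

lemma regvar_powr_id: "regvar \<delta> (\<lambda>t. t powr \<delta>)"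
proof (rule regvarI)
  fix \<epsilon> :: real assume e: "0 < \<epsilon>"
  show "\<exists>C>0. \<forall>s t. 0 < s \<and> s \<le> t \<longrightarrow>
      t powr \<delta> \<le> C * (t / s) powr (\<delta> + \<epsilon>) * s powr \<delta> \<and>
      s powr \<delta> \<le> C * (t / s) powr (\<epsilon> - \<delta>) * t powr \<delta>"
  proof (intro exI[of _ 1] conjI allI impI; (elim conjE)?)
    fix s t :: real assume st: "0 < s" "s \<le> t"
    have "1 \<le> (t / s) powr \<epsilon>" using st e by (intro ge_one_powr_ge_zero) auto
    then show "t powr \<delta> \<le> 1 * (t / s) powr (\<delta> + \<epsilon>) * s powr \<delta>"
      "s powr \<delta> \<le> 1 * (t / s) powr (\<epsilon> - \<delta>) * t powr \<delta>"
      using st by (simp_all add: powr_add powr_diff powr_divide field_simps)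
  qed auto
qed auto

lemma regvar_powr_nonneg:
  assumes "regvar \<delta> w" "0 \<le> p"
  shows "regvar (p * \<delta>) (\<lambda>t. w t powr p)"
proof (rule regvarI)
  show "0 < w t powr p" if "0 < t" for t using regvar_pos[OF assms(1) that] by simp
  fix \<epsilon> :: real assume "0 < \<epsilon>"
  then have e: "0 < \<epsilon> / (p + 1)" using assms by simp
  obtain c where c: "0 < c" "\<And>s t. 0 < s \<Longrightarrow> s \<le> t \<Longrightarrow> w t \<le> c * (t / s) powr (\<delta> + \<epsilon> / (p + 1)) * w s"
    "\<And>s t. 0 < s \<Longrightarrow> s \<le> t \<Longrightarrow> w s \<le> c * (t / s) powr (\<epsilon> / (p + 1) - \<delta>) * w t"
    using regvarE[OF assms(1) e] by blast
  have pe: "\<epsilon> / (p + 1) * p \<le> \<epsilon>"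
    using \<open>0 < \<epsilon>\<close> assms(2) by (simp add: field_simps)
  show "\<exists>C>0. \<forall>s t. 0 < s \<and> s \<le> t \<longrightarrow>
      w t powr p \<le> C * (t / s) powr (p * \<delta> + \<epsilon>) * w s powr p \<and>
      w s powr p \<le> C * (t / s) powr (\<epsilon> - p * \<delta>) * w t powr p"
  proof (intro exI[of _ "c powr p"] conjI allI impI; (elim conjE)?)
    show "0 < c powr p" using c by simp
    fix s t :: real assume st: "0 < s" "s \<le> t"
    have pos: "0 < w s" "0 < w t" using assms st by (auto simp: regvar_pos)
    have "w t powr p \<le> (c * (t / s) powr (\<delta> + \<epsilon> / (p + 1)) * w s) powr p"
      using c(2)[OF st] pos assms by (intro powr_mono2) auto
    also have "\<dots> = c powr p * (t / s) powr ((\<delta> + \<epsilon> / (p + 1)) * p) * w s powr p"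
      using c pos by (simp add: powr_mult powr_powr)
    also have "\<dots> \<le> c powr p * (t / s) powr (p * \<delta> + \<epsilon>) * w s powr p"
      using st pe by (intro mult_right_mono mult_left_mono powr_mono) (auto simp: algebra_simps)
    finally show "w t powr p \<le> c powr p * (t / s) powr (p * \<delta> + \<epsilon>) * w s powr p" .
    have "w s powr p \<le> (c * (t / s) powr (\<epsilon> / (p + 1) - \<delta>) * w t) powr p"
      using c(3)[OF st] pos assms by (intro powr_mono2) auto
    also have "\<dots> = c powr p * (t / s) powr ((\<epsilon> / (p + 1) - \<delta>) * p) * w t powr p"
      using c pos by (simp add: powr_mult powr_powr)
    also have "\<dots> \<le> c powr p * (t / s) powr (\<epsilon> - p * \<delta>) * w t powr p"
      using st pe by (intro mult_right_mono mult_left_mono powr_mono) (auto simp: algebra_simps)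
    finally show "w s powr p \<le> c powr p * (t / s) powr (\<epsilon> - p * \<delta>) * w t powr p" .
  qed
qed

lemma regvar_powr:
  assumes "regvar \<delta> w"
  shows "regvar (p * \<delta>) (\<lambda>t. w t powr p)"
proof (cases "0 \<le> p")
  case True
  with assms show ?thesis by (rule regvar_powr_nonneg)
next
  case False
  then have "regvar (- (- p * \<delta>)) (\<lambda>t. 1 / w t powr (- p))"
    using assms by (intro regvar_inverse regvar_powr_nonneg) auto
  then show ?thesis by (simp add: powr_minus inverse_eq_divide)
qed

text \<open>Slow variation of the outer function turns the polynomial bounds on the ratio of two values of
  \<open>\<rho>\<close> into an arbitrarily small power.\<close>
lemma regvar_comp:
  assumes "regvar 0 a" "regvar \<delta> \<rho>"
  shows "regvar 0 (\<lambda>t. a (\<rho> t))"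
proof (rule regvarI)
  show "0 < a (\<rho> t)" if "0 < t" for t using assms that by (simp add: regvar_pos)
  fix \<epsilon> :: real assume "0 < \<epsilon>"
  (* Ratios of values of \<rho> are at most (t/s)^(|\<delta>|+1), so this exponent for a yields \<epsilon>. *)
  define e where "e = \<epsilon> / (\<bar>\<delta>\<bar> + 1)"
  have e: "0 < e" "(\<bar>\<delta>\<bar> + 1) * e = \<epsilon>" using \<open>0 < \<epsilon>\<close> by (auto simp: e_def)
  obtain c where c: "0 < c" "\<And>s t. 0 < s \<Longrightarrow> s \<le> t \<Longrightarrow> \<rho> t \<le> c * (t / s) powr (\<delta> + 1) * \<rho> s"
    "\<And>s t. 0 < s \<Longrightarrow> s \<le> t \<Longrightarrow> \<rho> s \<le> c * (t / s) powr (1 - \<delta>) * \<rho> t"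
    using regvarE[OF assms(2), of 1] by auto
  obtain d where d: "0 < d" "\<And>s t. 0 < s \<Longrightarrow> s \<le> t \<Longrightarrow> a t \<le> d * (t / s) powr e * a s"
    "\<And>s t. 0 < s \<Longrightarrow> s \<le> t \<Longrightarrow> a s \<le> d * (t / s) powr e * a t"
    using regvarE[OF assms(1) e(1)] by auto
  have key: "a x \<le> d * c powr e * r powr \<epsilon> * a y"
    if "0 < x" "0 < y" "1 \<le> r" "x \<le> c * r powr (\<bar>\<delta>\<bar> + 1) * y" "y \<le> c * r powr (\<bar>\<delta>\<bar> + 1) * x" for x y r
  proof -
    have pos: "0 \<le> a y" using that regvar_pos[OF assms(1)] by (simp add: less_imp_le)
    define m where "m = (if x \<le> y then y / x else x / y)"
    have m: "0 \<le> m" "m \<le> c * r powr (\<bar>\<delta>\<bar> + 1)"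
      using that by (auto simp: m_def field_simps)
    have "a x \<le> d * m powr e * a y"
      using d(3)[OF that(1)] d(2)[OF that(2)] by (auto simp: m_def)
    also have "\<dots> \<le> d * (c * r powr (\<bar>\<delta>\<bar> + 1)) powr e * a y"
      using e d pos m by (intro mult_right_mono mult_left_mono powr_mono2) auto
    also have "\<dots> = d * c powr e * r powr \<epsilon> * a y"
      using c that by (simp add: powr_mult powr_powr e(2))
    finally show ?thesis .
  qed
  show "\<exists>C>0. \<forall>s t. 0 < s \<and> s \<le> t \<longrightarrow> a (\<rho> t) \<le> C * (t / s) powr (0 + \<epsilon>) * a (\<rho> s) \<and>
       a (\<rho> s) \<le> C * (t / s) powr (\<epsilon> - 0) * a (\<rho> t)"
  proof (intro exI[of _ "d * c powr e"] conjI allI impI; (elim conjE)?)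
    show "0 < d * c powr e" using c d by simp
    fix s t :: real assume st: "0 < s" "s \<le> t"
    have p: "0 < \<rho> s" "0 < \<rho> t" using assms st by (auto simp: regvar_pos)
    have "\<rho> t \<le> c * (t / s) powr (\<delta> + 1) * \<rho> s" using c st by auto
    also have "\<dots> \<le> c * (t / s) powr (\<bar>\<delta>\<bar> + 1) * \<rho> s"
      using c p st by (intro mult_right_mono mult_left_mono powr_mono) auto
    finally have 1: "\<rho> t \<le> c * (t / s) powr (\<bar>\<delta>\<bar> + 1) * \<rho> s" .
    have "\<rho> s \<le> c * (t / s) powr (1 - \<delta>) * \<rho> t" using c st by auto
    also have "\<dots> \<le> c * (t / s) powr (\<bar>\<delta>\<bar> + 1) * \<rho> t"
      using c p st by (intro mult_right_mono mult_left_mono powr_mono) auto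
    finally have 2: "\<rho> s \<le> c * (t / s) powr (\<bar>\<delta>\<bar> + 1) * \<rho> t" .
    show "a (\<rho> t) \<le> d * c powr e * (t / s) powr (0 + \<epsilon>) * a (\<rho> s)"
      using key[OF p(2,1) _ 1 2] st by simp
    show "a (\<rho> s) \<le> d * c powr e * (t / s) powr (\<epsilon> - 0) * a (\<rho> t)"
      using key[OF p(1,2) _ 2 1] st by simp
  qed
qed

section \<open>Dyadic sampling\<close>

definition dyad :: "int \<Rightarrow> real" where "dyad k = 2 powr real_of_int k"

lemma dyad_pos [simp]: "0 < dyad k" and dyad_nonneg [simp]: "0 \<le> dyad k"
  by (simp_all add: dyad_def)

lemma dyad_neq_0 [simp]: "dyad k \<noteq> 0"
  using dyad_pos[of k] by linarith

lemma dyad_add: "dyad (k + m) = dyad k * dyad m"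
  by (simp add: dyad_def powr_add)

lemma dyad_1 [simp]: "dyad 1 = 2"
  by (simp add: dyad_def)

lemma dyad_mono: "k \<le> m \<Longrightarrow> dyad k \<le> dyad m"
  by (simp add: dyad_def)

lemma dyad_divide: "dyad k / dyad m = 2 powr (real_of_int k - real_of_int m)"
  by (simp add: dyad_def powr_diff)

lemma ex_dyad_block:
  assumes "0 < t" obtains k where "dyad k \<le> t" "t < dyad (k + 1)"
proof (rule that[of "\<lfloor>log 2 t\<rfloor>"])
  show "dyad \<lfloor>log 2 t\<rfloor> \<le> t" using assms
    by (simp add: dyad_def powr_le_iff)
  have "log 2 t < real_of_int \<lfloor>log 2 t\<rfloor> + 1" by linarith
  then show "t < dyad (\<lfloor>log 2 t\<rfloor> + 1)" using assms
    by (simp add: dyad_def less_powr_iff)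
qed

lemma dyad_block_le:
  assumes "dyad k \<le> u" "u < dyad (k + 1)" "dyad j \<le> v" "v < dyad (j + 1)" "u \<le> v"
  shows "k \<le> j"
proof (rule ccontr)
  assume "\<not> k \<le> j"
  then have "dyad (j + 1) \<le> dyad k" by (intro dyad_mono) auto
  with assms show False by linarith
qed

lemma regvar_comparable:
  assumes "regvar \<delta> w" "1 \<le> L"
  obtains C where "0 < C" "\<And>s t. 0 < s \<Longrightarrow> 0 < t \<Longrightarrow> s \<le> L * t \<Longrightarrow> t \<le> L * s \<Longrightarrow> w s \<le> C * w t"
proof -
  obtain c where c: "0 < c" "\<And>s t. 0 < s \<Longrightarrow> s \<le> t \<Longrightarrow> w t \<le> c * (t / s) powr (\<delta> + 1) * w s"
    "\<And>s t. 0 < s \<Longrightarrow> s \<le> t \<Longrightarrow> w s \<le> c * (t / s) powr (1 - \<delta>) * w t"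
    using regvarE[OF assms(1), of 1] by auto
  have pw: "x powr e \<le> L powr (\<bar>\<delta>\<bar> + 1)" if "1 \<le> x" "x \<le> L" "e \<le> \<bar>\<delta>\<bar> + 1" for x e
  proof -
    have "x powr e \<le> x powr (\<bar>\<delta>\<bar> + 1)" using that by (intro powr_mono) auto
    also have "\<dots> \<le> L powr (\<bar>\<delta>\<bar> + 1)" using that by (intro powr_mono2) auto
    finally show ?thesis .
  qed
  show thesis
  proof (rule that)
    show "0 < c * L powr (\<bar>\<delta>\<bar> + 1)" using c assms by simp
    fix s t :: real assume st: "0 < s" "0 < t" "s \<le> L * t" "t \<le> L * s"
    have p: "0 < w s" "0 < w t" using assms st by (auto simp: regvar_pos)
    show "w s \<le> c * L powr (\<bar>\<delta>\<bar> + 1) * w t"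
    proof (cases "s \<le> t")
      case True
      have "w s \<le> c * (t / s) powr (1 - \<delta>) * w t" using c st True by auto
      also have "\<dots> \<le> c * L powr (\<bar>\<delta>\<bar> + 1) * w t"
        using c p st True by (intro mult_right_mono mult_left_mono pw) (auto simp: field_simps)
      finally show ?thesis .
    next
      case False
      have "w s \<le> c * (s / t) powr (\<delta> + 1) * w t" using c st False by auto
      also have "\<dots> \<le> c * L powr (\<bar>\<delta>\<bar> + 1) * w t"
        using c p st False by (intro mult_right_mono mult_left_mono pw) (auto simp: field_simps)
      finally show ?thesis .
    qed
  qed
qed

lemma regvar_block:
  assumes "regvar \<delta> w"
  obtains C where "0 < C"
    "\<And>k u. dyad k \<le> u \<Longrightarrow> u \<le> dyad (k + 1) \<Longrightarrow> w u \<le> C * w (dyad k) \<and> w (dyad k) \<le> C * w u"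
proof -
  obtain C where C: "0 < C"
    "\<And>s t. 0 < s \<Longrightarrow> 0 < t \<Longrightarrow> s \<le> 2 * t \<Longrightarrow> t \<le> 2 * s \<Longrightarrow> w s \<le> C * w t"
    using regvar_comparable[OF assms, of 2] by auto
  show thesis
  proof (rule that[OF C(1)])
    fix k u assume u: "dyad k \<le> u" "u \<le> dyad (k + 1)"
    then have "0 < u" using dyad_pos[of k] by linarith
    moreover have "u \<le> 2 * dyad k" using u by (simp add: dyad_add mult.commute)
    ultimately show "w u \<le> C * w (dyad k) \<and> w (dyad k) \<le> C * w u"
      using u by (intro conjI C(2)) auto
  qed
qed

lemma regvar_dyad_head_decay:
  assumes "regvar \<delta> w" "\<delta> < 0"
  obtains C \<gamma> where "0 < C" "0 < \<gamma>"
    "\<And>i k. i \<le> k \<Longrightarrow> w (dyad k) \<le> C * 2 powr (- \<gamma> * \<bar>real_of_int (k - i)\<bar>) * w (dyad i)"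
proof -
  define e where "e = - \<delta> / 2"
  have e: "0 < e" "\<delta> + e = - e" using assms(2) by (auto simp: e_def)
  obtain C where C: "0 < C" "\<And>s t. 0 < s \<Longrightarrow> s \<le> t \<Longrightarrow> w t \<le> C * (t / s) powr (\<delta> + e) * w s"
    "\<And>s t. 0 < s \<Longrightarrow> s \<le> t \<Longrightarrow> w s \<le> C * (t / s) powr (e - \<delta>) * w t"
    using regvarE[OF assms(1) e(1)] by blast
  show thesis
  proof (rule that[OF C(1) e(1)])
    fix i k :: int assume "i \<le> k"
    then have "w (dyad k) \<le> C * (dyad k / dyad i) powr (- e) * w (dyad i)"
      using C(2)[of "dyad i" "dyad k"] dyad_mono e(2) by simp
    also have "(dyad k / dyad i) powr (- e) = 2 powr (- e * \<bar>real_of_int (k - i)\<bar>)"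
      using \<open>i \<le> k\<close> by (simp add: dyad_divide powr_powr mult.commute)
    finally show "w (dyad k) \<le> C * 2 powr (- e * \<bar>real_of_int (k - i)\<bar>) * w (dyad i)" .
  qed
qed

lemma regvar_dyad_tail_decay:
  assumes "regvar \<delta> w" "0 < \<delta>"
  obtains C \<gamma> where "0 < C" "0 < \<gamma>"
    "\<And>i k. k \<le> i \<Longrightarrow> w (dyad k) \<le> C * 2 powr (- \<gamma> * \<bar>real_of_int (k - i)\<bar>) * w (dyad i)"
proof -
  define e where "e = \<delta> / 2"
  have e: "0 < e" "e - \<delta> = - e" using assms(2) by (auto simp: e_def)
  obtain C where C: "0 < C" "\<And>s t. 0 < s \<Longrightarrow> s \<le> t \<Longrightarrow> w t \<le> C * (t / s) powr (\<delta> + e) * w s"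
    "\<And>s t. 0 < s \<Longrightarrow> s \<le> t \<Longrightarrow> w s \<le> C * (t / s) powr (e - \<delta>) * w t"
    using regvarE[OF assms(1) e(1)] by blast
  show thesis
  proof (rule that[OF C(1) e(1)])
    fix i k :: int assume "k \<le> i"
    then have "w (dyad k) \<le> C * (dyad i / dyad k) powr (- e) * w (dyad i)"
      using C(3)[of "dyad k" "dyad i"] dyad_mono e(2) by simp
    also have "(dyad i / dyad k) powr (- e) = 2 powr (- e * \<bar>real_of_int (k - i)\<bar>)"
      using \<open>k \<le> i\<close> by (simp add: dyad_divide powr_powr mult.commute)
    finally show "w (dyad k) \<le> C * 2 powr (- e * \<bar>real_of_int (k - i)\<bar>) * w (dyad i)" .
  qed
qed

text \<open>Slow variation can be tested on the powers of 2, provided that the function is comparable with its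
  sample on each dyadic interval.\<close>
lemma regvar_from_dyadic:
  assumes X: "\<And>k. 0 < X k" "\<And>\<epsilon>. 0 < \<epsilon> \<Longrightarrow> \<exists>C. \<forall>j k. X j \<le> C * 2 powr (\<epsilon> * \<bar>real_of_int (j - k)\<bar>) * X k"
    and c: "0 < c" "\<And>k t. dyad k \<le> t \<Longrightarrow> t < dyad (k + 1) \<Longrightarrow> X k \<le> c * w t \<and> w t \<le> c * X k"
  shows "regvar 0 w"
proof (rule regvarI)
  show "0 < w t" if t: "0 < t" for t
  proof -
    obtain k where "dyad k \<le> t" "t < dyad (k + 1)" using ex_dyad_block[OF t] .
    then have "0 < c * w t" using X(1)[of k] c(2) by (meson order_less_le_trans)
    then show ?thesis using c(1) by (simp add: zero_less_mult_iff)
  qed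
  fix \<epsilon> :: real assume e: "0 < \<epsilon>"
  obtain C' where C': "\<And>j k. X j \<le> C' * 2 powr (\<epsilon> * \<bar>real_of_int (j - k)\<bar>) * X k"
    using X(2)[OF e] by auto
  define C where "C = max C' 1"
  have C: "X j \<le> C * 2 powr (\<epsilon> * \<bar>real_of_int (j - k)\<bar>) * X k" for j k
    using order_trans[OF C' mult_right_mono[OF mult_right_mono[of C' C]]] X(1)[of k] by (simp add: C_def less_imp_le)
  have Cpos: "0 < C" by (simp add: C_def)
  have key: "w u \<le> c * c * C * 2 powr \<epsilon> * (t / s) powr \<epsilon> * w v"
    if st: "0 < s" "s \<le> t" and uv: "{u, v} = {s, t}" for s t u v
  proof -
    have pos: "0 < u" "0 < v" using st uv by (auto simp: doubleton_eq_iff)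
    obtain k where k: "dyad k \<le> s" "s < dyad (k + 1)" using ex_dyad_block[OF st(1)] .
    obtain j where j: "dyad j \<le> t" "t < dyad (j + 1)" using ex_dyad_block[of t] st by auto
    have kj: "k \<le> j" using dyad_block_le[OF k j st(2)] .
    have "dyad j / dyad (k + 1) \<le> t / s" using k j st by (intro frac_le) auto
    then have "2 powr (real_of_int (j - k) - 1) \<le> t / s" by (simp add: dyad_divide algebra_simps)
    then have "2 powr (real_of_int (j - k)) \<le> 2 * (t / s)" by (simp add: powr_diff)
    then have "(2 powr (real_of_int (j - k))) powr \<epsilon> \<le> (2 * (t / s)) powr \<epsilon>"
      using e by (intro powr_mono2) auto
    also have "(2 * (t / s)) powr \<epsilon> = 2 powr \<epsilon> * (t / s) powr \<epsilon>"
      by (rule powr_mult)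
    finally have pw: "2 powr (\<epsilon> * \<bar>real_of_int (j - k)\<bar>) \<le> 2 powr \<epsilon> * (t / s) powr \<epsilon>"
      using kj by (simp add: powr_powr mult.commute)
    obtain ku kv where kuv: "dyad ku \<le> u" "u < dyad (ku + 1)" "dyad kv \<le> v" "v < dyad (kv + 1)" "\<bar>ku - kv\<bar> = \<bar>j - k\<bar>"
    proof (cases "u = s \<and> v = t")
      case True
      then show ?thesis using k j abs_minus_commute by (intro that[of k j]) auto
    next
      case False
      then have "u = t" "v = s" using uv by (auto simp: doubleton_eq_iff)
      then show ?thesis using k j by (intro that[of j k]) auto
    qed
    have "w u \<le> c * X ku" using c kuv by auto
    also have "\<dots> \<le> c * (C * 2 powr (\<epsilon> * \<bar>real_of_int (ku - kv)\<bar>) * X kv)"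
      using c C by (intro mult_left_mono) auto
    also have "\<dots> \<le> c * (C * (2 powr \<epsilon> * (t / s) powr \<epsilon>) * (c * w v))"
    proof -
      have "\<bar>real_of_int (ku - kv)\<bar> = \<bar>real_of_int (j - k)\<bar>" using kuv(5) by linarith
      then show ?thesis
        using pw c(1) Cpos c(2)[OF kuv(3,4)] X(1)[of kv]
        by (intro mult_left_mono mult_mono) auto
    qed
    finally show ?thesis by (simp add: mult_ac)
  qed
  show "\<exists>C>0. \<forall>s t. 0 < s \<and> s \<le> t \<longrightarrow> w t \<le> C * (t / s) powr (0 + \<epsilon>) * w s \<and>
       w s \<le> C * (t / s) powr (\<epsilon> - 0) * w t"
    using key c(1) Cpos by (intro exI[of _ "c * c * C * 2 powr \<epsilon>"]) (auto simp: insert_commute)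
qed

section \<open>Hardy inequalities\<close>

lemma snorm_geometric:
  assumes "0 < q" "0 < \<gamma>"
  obtains G :: real where "0 < G"
    "\<And>k. snorm q (\<lambda>i. ennreal (2 powr (- \<gamma> * \<bar>real_of_int (k - i)\<bar>))) \<le> ennreal G"
proof -
  let ?g = "\<lambda>i. ennreal (2 powr (- \<gamma> * \<bar>real_of_int i\<bar>))"
  obtain G where G: "snorm q ?g = ennreal G" "0 \<le> G"
    using snorm_geometric_finite[OF assms] by (cases "snorm q ?g") auto
  show thesis
  proof (rule that[of "G + 1"])
    show "0 < G + 1" using G by simp
    fix k
    have "snorm q (\<lambda>i. ?g (k - i)) = snorm q (\<lambda>i. ?g (i + (- k)))"
      by (intro arg_cong[of _ _ "snorm q"] ext) (simp add: abs_minus_commute)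
    also have "\<dots> = ennreal G" using G snorm_shift[OF assms(1), of ?g "- k"] by simp
    finally show "snorm q (\<lambda>i. ennreal (2 powr (- \<gamma> * \<bar>real_of_int (k - i)\<bar>))) \<le> ennreal (G + 1)"
      by (simp add: ennreal_leI)
  qed
qed

text \<open>A weight with geometric decay away from \<open>k\<close> has a norm comparable with its value at \<open>k\<close>.\<close>
lemma dominated_geometric:
  assumes "0 < q" "0 < \<gamma>" "0 \<le> C" "\<And>i. 0 \<le> w i"
    and dec: "\<And>k i. i \<in> S k \<Longrightarrow> w i \<le> C * 2 powr (- \<gamma> * \<bar>real_of_int (k - i)\<bar>) * w k"
  shows "dominated UNIV (\<lambda>k. snorm_on q (S k) (\<lambda>i. ennreal (w i))) (\<lambda>k. ennreal (w k))"
proof -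
  obtain G where G: "0 < G"
    "\<And>k. snorm q (\<lambda>i. ennreal (2 powr (- \<gamma> * \<bar>real_of_int (k - i)\<bar>))) \<le> ennreal G"
    using snorm_geometric[OF assms(1,2)] by blast
  show ?thesis
  proof (rule dominatedI)
    fix k
    have "snorm_on q (S k) (\<lambda>i. ennreal (w i))
        \<le> snorm q (\<lambda>i. ennreal (C * w k) * ennreal (2 powr (- \<gamma> * \<bar>real_of_int (k - i)\<bar>)))"
      unfolding snorm_on_def
    proof (rule snorm_mono[OF assms(1)])
      fix i
      show "(if i \<in> S k then ennreal (w i) else 0)
        \<le> ennreal (C * w k) * ennreal (2 powr (- \<gamma> * \<bar>real_of_int (k - i)\<bar>))"
        using dec[of i k] assms(3,4) by (auto simp: mult_ac ennreal_leI simp flip: ennreal_mult)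
    qed
    also have "\<dots> \<le> ennreal (C * w k) * ennreal G"
      unfolding snorm_cmult[OF assms(1)] by (intro mult_left_mono G) auto
    also have "\<dots> = ennreal (C * G) * ennreal (w k)"
      using G assms by (simp add: ennreal_mult mult_ac)
    finally show "snorm_on q (S k) (\<lambda>i. ennreal (w i)) \<le> ennreal (C * G) * ennreal (w k)" .
  qed
qed

text \<open>Half of the decay \<open>2\<^bsup>-\<gamma>|k-i|\<^esup>\<close> bounds the inner \<open>\<ell>\<^sub>q\<close> norm by a constant times a supremum, which is at most
  an \<open>\<ell>\<^sub>r\<close> norm. The other half remains as a summable kernel for that norm, and the two
  \<open>\<ell>\<^sub>r\<close> norms can then be interchanged.  The two exponents therefore enter independently.\<close>
lemma dominated_hardy:
  assumes "0 < q" "0 < r" "0 < \<gamma>" "0 \<le> C" "\<And>i. 0 \<le> w i"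
    and dec: "\<And>k i. i \<in> S k \<Longrightarrow> w k \<le> C * 2 powr (- \<gamma> * \<bar>real_of_int (k - i)\<bar>) * w i"
  shows "dominated UNIV (\<lambda>x. snorm r (\<lambda>k. ennreal (w k) * snorm_on q (S k) x)) (\<lambda>x. snorm r (\<lambda>k. ennreal (w k) * x k))"
proof -
  have g2: "0 < \<gamma> / 2" using assms by simp
  obtain G where G: "0 < G"
    "\<And>k. snorm q (\<lambda>i. ennreal (2 powr (- (\<gamma> / 2) * \<bar>real_of_int (k - i)\<bar>))) \<le> ennreal G"
    using snorm_geometric[OF assms(1) g2] by blast
  obtain H where H: "0 < H"
    "\<And>k. snorm r (\<lambda>i. ennreal (2 powr (- (\<gamma> / 2) * \<bar>real_of_int (k - i)\<bar>))) \<le> ennreal H"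
    using snorm_geometric[OF assms(2) g2] by blast
  show ?thesis
  proof (rule dominatedI)
    fix x :: "int \<Rightarrow> ennreal"
    (* The kernel with half of the decay. *)
    define e where "e k i = ennreal (2 powr (- (\<gamma> / 2) * \<bar>real_of_int (k - i)\<bar>))" for k i
    have ee: "e k i * e k i = ennreal (2 powr (- \<gamma> * \<bar>real_of_int (k - i)\<bar>))" for k i
      by (simp add: e_def powr_add[symmetric] flip: ennreal_mult)
    define y where "y i = ennreal (w i) * x i" for i
    have "ennreal (w k) * snorm_on q (S k) x \<le> ennreal (C * G) * snorm r (\<lambda>i. e k i * y i)" for k
    proof -
      have "ennreal (w k) * snorm_on q (S k) x = snorm_on q (S k) (\<lambda>i. ennreal (w k) * x i)"
        by (simp add: snorm_on_cmult assms)
      also have "\<dots> \<le> snorm q (\<lambda>i. (ennreal C * snorm r (\<lambda>i. e k i * y i)) * e k i)"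
        unfolding snorm_on_def
      proof (rule snorm_mono[OF assms(1)])
        fix i
        have "ennreal (w k) * x i \<le> ennreal C * (e k i * e k i) * (ennreal (w i) * x i)" if "i \<in> S k"
        proof -
          have "ennreal (w k) \<le> ennreal C * (e k i * e k i) * ennreal (w i)"
            using dec[OF that] assms(4,5) unfolding ee
            by (simp add: ennreal_leI flip: ennreal_mult)
          from mult_right_mono[OF this, of "x i"] show ?thesis by (simp add: mult_ac)
        qed
        also have "ennreal C * (e k i * e k i) * (ennreal (w i) * x i) = ennreal C * (e k i * y i) * e k i"
          by (simp add: y_def mult_ac)
        also have "\<dots> \<le> (ennreal C * snorm r (\<lambda>i. e k i * y i)) * e k i"
          using snorm_point[OF assms(2), of "\<lambda>i. e k i * y i" i]
          by (intro mult_right_mono mult_left_mono) auto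
        finally show "(if i \<in> S k then ennreal (w k) * x i else 0)
          \<le> (ennreal C * snorm r (\<lambda>i. e k i * y i)) * e k i" by auto
      qed
      also have "\<dots> \<le> (ennreal C * snorm r (\<lambda>i. e k i * y i)) * ennreal G"
        unfolding snorm_cmult[OF assms(1)] using G(2) by (intro mult_left_mono) (auto simp: e_def)
      also have "\<dots> = ennreal (C * G) * snorm r (\<lambda>i. e k i * y i)"
        using assms G by (simp add: ennreal_mult mult_ac)
      finally show ?thesis .
    qed
    then have "snorm r (\<lambda>k. ennreal (w k) * snorm_on q (S k) x)
        \<le> ennreal (C * G) * snorm r (\<lambda>k. snorm r (\<lambda>i. e k i * y i))"
      unfolding snorm_cmult[OF assms(2), symmetric] by (intro snorm_mono assms)
    also have "snorm r (\<lambda>k. snorm r (\<lambda>i. e k i * y i)) = snorm r (\<lambda>i. snorm r (\<lambda>k. y i * e i k))"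
      by (subst snorm_swap[OF assms(2)]) (simp add: mult.commute e_def abs_minus_commute)
    also have "\<dots> \<le> snorm r (\<lambda>i. ennreal H * y i)"
    proof (rule snorm_mono[OF assms(2)])
      fix i
      have "snorm r (\<lambda>k. y i * e i k) = y i * snorm r (e i)" by (rule snorm_cmult[OF assms(2)])
      also have "\<dots> \<le> y i * ennreal H"
        using H(2)[of i] by (intro mult_left_mono) (simp_all add: e_def[abs_def])
      finally show "snorm r (\<lambda>k. y i * e i k) \<le> ennreal H * y i" by (simp add: mult.commute)
    qed
    finally have "snorm r (\<lambda>k. ennreal (w k) * snorm_on q (S k) x) \<le> ennreal (C * G) * snorm r (\<lambda>i. ennreal H * y i)"
      by (meson mult_left_mono order_trans zero_le)
    also have "\<dots> = ennreal (C * G * H) * snorm r y"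
      using assms G H by (simp add: snorm_cmult ennreal_mult mult_ac)
    finally show "snorm r (\<lambda>k. ennreal (w k) * snorm_on q (S k) x)
      \<le> ennreal (C * G * H) * snorm r (\<lambda>k. ennreal (w k) * x k)" by (simp add: y_def[abs_def])
  qed
qed

lemma dominated_hardy_head:
  assumes "0 < q" "0 < r" "regvar \<delta> w" "\<delta> < 0"
  shows "dominated P (\<lambda>p. snorm r (\<lambda>k. ennreal (w (dyad k)) * snorm_on q {..k} (x p))) (\<lambda>p. snorm r (\<lambda>k. ennreal (w (dyad k)) * x p k))"
proof -
  obtain C \<gamma> where C: "0 < C" "0 < \<gamma>"
    "\<And>i k. i \<le> k \<Longrightarrow> w (dyad k) \<le> C * 2 powr (- \<gamma> * \<bar>real_of_int (k - i)\<bar>) * w (dyad i)"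
    using regvar_dyad_head_decay[OF assms(3,4)] by blast
  show ?thesis
    by (rule dominated_comp[OF dominated_hardy[OF assms(1,2) C(2), of C "\<lambda>k. w (dyad k)" "\<lambda>k. {..k}"]])
       (use C regvar_pos[OF assms(3)] in \<open>auto simp: less_imp_le\<close>)
qed

lemma dominated_hardy_tail:
  assumes "0 < q" "0 < r" "regvar \<delta> w" "0 < \<delta>"
  shows "dominated P (\<lambda>p. snorm r (\<lambda>k. ennreal (w (dyad k)) * snorm_on q {k..} (x p))) (\<lambda>p. snorm r (\<lambda>k. ennreal (w (dyad k)) * x p k))"
proof -
  obtain C \<gamma> where C: "0 < C" "0 < \<gamma>"
    "\<And>i k. k \<le> i \<Longrightarrow> w (dyad k) \<le> C * 2 powr (- \<gamma> * \<bar>real_of_int (k - i)\<bar>) * w (dyad i)"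
    using regvar_dyad_tail_decay[OF assms(3,4)] by blast
  show ?thesis
    by (rule dominated_comp[OF dominated_hardy[OF assms(1,2) C(2), of C "\<lambda>k. w (dyad k)" "\<lambda>k. {k..}"]])
       (use C regvar_pos[OF assms(3)] in \<open>auto simp: less_imp_le\<close>)
qed

lemma dominated_geometric_head:
  assumes "0 < q" "regvar \<delta> w" "0 < \<delta>"
  shows "dominated UNIV (\<lambda>k. snorm_on q {..k} (\<lambda>i. ennreal (w (dyad i)))) (\<lambda>k. ennreal (w (dyad k)))"
proof -
  obtain C \<gamma> where C: "0 < C" "0 < \<gamma>"
    "\<And>i k. k \<le> i \<Longrightarrow> w (dyad k) \<le> C * 2 powr (- \<gamma> * \<bar>real_of_int (k - i)\<bar>) * w (dyad i)"
    using regvar_dyad_tail_decay[OF assms(2,3)] by blast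
  show ?thesis
    by (rule dominated_geometric[OF assms(1) C(2), of C])
       (use C regvar_pos[OF assms(2)] in \<open>auto simp: less_imp_le abs_minus_commute\<close>)
qed

lemma dominated_geometric_tail:
  assumes "0 < q" "regvar \<delta> w" "\<delta> < 0"
  shows "dominated UNIV (\<lambda>k. snorm_on q {k..} (\<lambda>i. ennreal (w (dyad i)))) (\<lambda>k. ennreal (w (dyad k)))"
proof -
  obtain C \<gamma> where C: "0 < C" "0 < \<gamma>"
    "\<And>i k. i \<le> k \<Longrightarrow> w (dyad k) \<le> C * 2 powr (- \<gamma> * \<bar>real_of_int (k - i)\<bar>) * w (dyad i)"
    using regvar_dyad_head_decay[OF assms(2,3)] by blast
  show ?thesis
    by (rule dominated_geometric[OF assms(1) C(2), of C])
       (use C regvar_pos[OF assms(2)] in \<open>auto simp: less_imp_le abs_minus_commute\<close>)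
qed

section \<open>Discretization of weighted norms\<close>

abbreviation block :: "int \<Rightarrow> real set" where
  "block k \<equiv> {dyad k..<dyad (k + 1)}"

lemma mem_block_unique: "u \<in> block k \<Longrightarrow> u \<in> block j \<Longrightarrow> j = k"
  using dyad_block_le[of k u j u] dyad_block_le[of j u k u] by simp

lemma emeasure_block: "emeasure lebesgue (block k) = ennreal (dyad k)"
  by (simp add: dyad_add)

lemma nn_integral_blocks:
  "(\<integral>\<^sup>+ u. (\<integral>\<^sup>+ k. c k * indicator (block k) u \<partial>count_space UNIV) \<partial>lebesgue)
    = (\<integral>\<^sup>+ k. c k * ennreal (dyad k) \<partial>count_space UNIV)"
proof -
  have "(\<integral>\<^sup>+ u. (\<integral>\<^sup>+ k. c k * indicator (block k) u \<partial>count_space UNIV) \<partial>lebesgue)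
    = (\<integral>\<^sup>+ k. (\<integral>\<^sup>+ u. c k * indicator (block k) u \<partial>lebesgue) \<partial>count_space UNIV)"
    by (rule nn_integral_count_space_nn_integral)
       (auto intro!: borel_measurable_times_ennreal borel_measurable_indicator sets_completionI_sets)
  also have "\<dots> = (\<integral>\<^sup>+ k. c k * ennreal (dyad k) \<partial>count_space UNIV)"
    by (intro nn_integral_cong) (simp add: nn_integral_cmult_indicator emeasure_block)
  finally show ?thesis .
qed

lemma sum_blocks_at:
  assumes "u \<in> block k"
  shows "(\<integral>\<^sup>+ j. c j * indicator (block j) u \<partial>count_space UNIV) = c k"
proof -
  have "(\<integral>\<^sup>+ j. c j * indicator (block j) u \<partial>count_space UNIV) = (\<Sum>j\<in>{k}. c j * indicator (block j) u)"
    using mem_block_unique[OF assms] by (intro nn_integral_count_space') (auto simp: indicator_def)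
  also have "\<dots> = c k * indicator (block k) u"
    by (simp only: sum.insert sum.empty finite.emptyI empty_iff not_False_eq_True add_0_right)
  also have "\<dots> = c k" using assms by (simp only: indicator_simps mult_1_right)
  finally show ?thesis .
qed

lemma sum_blocks_nonpos:
  assumes "u \<le> 0"
  shows "(\<integral>\<^sup>+ j. c j * indicator (block j) u \<partial>count_space UNIV) = 0"
proof -
  have "u < dyad j" for j using assms dyad_pos[of j] by linarith
  then have "u \<notin> block j" for j by (simp add: not_le)
  then have "indicator (block j) u = (0 :: ennreal)" for j by (rule indicator_simps(2))
  then show ?thesis by (simp only: mult_zero_right) simp
qed

lemma wnorm_integrand:
  "ennreal (u powr (- \<theta> - recip q) * w u) * F u
    = ennreal (u powr (- recip q)) * (ennreal (u powr (- \<theta>) * w u) * F u)"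
proof -
  have "- \<theta> - recip q = - recip q + - \<theta>" by simp
  then have "u powr (- \<theta> - recip q) * w u = u powr (- recip q) * (u powr (- \<theta>) * w u)"
    by (simp only: powr_add mult.assoc)
  also have "ennreal \<dots> = ennreal (u powr (- recip q)) * ennreal (u powr (- \<theta>) * w u)"
    by (rule ennreal_mult') simp
  finally show ?thesis by (simp only: mult.assoc)
qed

lemma wnorm_integrand_epow:
  assumes "0 < p" "recip q = 1 / p" "0 < u"
  shows "epow (ennreal (u powr (- \<theta> - recip q) * w u) * F u) p
    = ennreal (1 / u) * epow (ennreal (u powr (- \<theta>) * w u) * F u) p"
proof -
  have "(u powr (- recip q)) powr p = 1 / u"
    using assms by (simp only: powr_powr) (simp add: powr_minus_divide)
  then have "epow (ennreal (u powr (- recip q))) p = ennreal (1 / u)"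
    by (simp only: epow_ennreal powr_ge_zero)
  then show ?thesis
    by (simp only: wnorm_integrand epow_mult[OF assms(1), of "ennreal (u powr (- recip q))"])
qed

text \<open>The largest value of \<open>1/u\<close> on a dyadic interval, times its length, is 1. Hence a bound by \<open>x k\<close> on
  each interval passes to the norms with constant 1. The integrand lies below a measurable step
  function, so it may itself be arbitrary.\<close>
lemma wnorm_le:
  assumes "0 < q" "I \<subseteq> {0<..}"
    and le: "\<And>k u. u \<in> I \<Longrightarrow> u \<in> block k \<Longrightarrow> ennreal (u powr (- \<theta>) * w u) * F u \<le> x k"
  shows "wnorm q \<theta> w I F \<le> snorm q x"
  using assms(1)
proof (cases rule: exponent_cases)
  case 1
  have "AE u in lebesgue. u \<in> I \<longrightarrow> ennreal (u powr (- \<theta> - recip q) * w u) * F u \<le> (SUP i. x i)"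
  proof (intro AE_I2 impI)
    fix u assume u: "u \<in> I"
    then have "0 < u" using assms(2) by auto
    then obtain k where k: "dyad k \<le> u" "u < dyad (k + 1)" using ex_dyad_block by blast
    then have "ennreal (u powr (- \<theta>) * w u) * F u \<le> x k" using le[OF u] by auto
    also have "\<dots> \<le> (SUP i. x i)" by (rule SUP_upper) simp
    finally show "ennreal (u powr (- \<theta> - recip q) * w u) * F u \<le> (SUP i. x i)" using 1 by simp
  qed
  then show ?thesis using 1 by (auto simp: wnorm_def Lnorm_def snorm_def intro: Inf_lower)
next
  case (2 p)
  let ?c = "\<lambda>k. ennreal (1 / dyad k) * epow (x k) p"
  have "(\<integral>\<^sup>+ u\<in>I. epow (ennreal (u powr (- \<theta> - recip q) * w u) * F u) p \<partial>lebesgue)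
      \<le> (\<integral>\<^sup>+ u. (\<integral>\<^sup>+ k. ?c k * indicator (block k) u \<partial>count_space UNIV) \<partial>lebesgue)"
  proof (intro nn_integral_mono)
    fix u :: real
    show "epow (ennreal (u powr (- \<theta> - recip q) * w u) * F u) p * indicator I u
        \<le> (\<integral>\<^sup>+ k. ?c k * indicator (block k) u \<partial>count_space UNIV)"
    proof (cases "u \<in> I")
      case True
      then have "0 < u" using assms(2) by auto
      then obtain k where "dyad k \<le> u" "u < dyad (k + 1)" using ex_dyad_block by blast
      then have k: "u \<in> block k" by simp
      have "epow (ennreal (u powr (- \<theta> - recip q) * w u) * F u) p
          = ennreal (1 / u) * epow (ennreal (u powr (- \<theta>) * w u) * F u) p"
        using 2 \<open>0 < u\<close> by (intro wnorm_integrand_epow)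
      also have "\<dots> \<le> ?c k"
        using le[OF True k] k 2 by (intro mult_mono epow_mono ennreal_leI) (auto simp: frac_le)
      finally show ?thesis using True sum_blocks_at[OF k] by simp
    qed simp
  qed
  also have "\<dots> = (\<integral>\<^sup>+ k. ?c k * ennreal (dyad k) \<partial>count_space UNIV)"
    by (rule nn_integral_blocks)
  also have "\<dots> = (\<integral>\<^sup>+ k. epow (x k) p \<partial>count_space UNIV)"
  proof (intro nn_integral_cong)
    fix k
    have "?c k * ennreal (dyad k) = (ennreal (1 / dyad k) * ennreal (dyad k)) * epow (x k) p"
      by (simp only: mult_ac)
    also have "ennreal (1 / dyad k) * ennreal (dyad k) = 1"
      by (simp flip: ennreal_mult)
    finally show "?c k * ennreal (dyad k) = epow (x k) p" by simp
  qed
  finally show ?thesis using 2 by (auto simp: wnorm_def Lnorm_def snorm_def intro!: epow_mono)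
qed

text \<open>The smallest value of \<open>1/u\<close> on a dyadic interval is half of the largest one, which is the origin of
  the factor 2. For \<open>q = \<infinity>\<close> the bound holds because a dyadic interval is not a null set.\<close>
lemma wnorm_ge:
  assumes "0 < q"
    and ge: "\<And>k u. k \<in> S \<Longrightarrow> u \<in> block k \<Longrightarrow> u \<in> I \<and> x k \<le> ennreal (u powr (- \<theta>) * w u) * F u"
  shows "snorm_on q S x \<le> ennreal (2 powr recip q) * wnorm q \<theta> w I F"
  using assms(1)
proof (cases rule: exponent_cases)
  case 1
  have le_C: "(if k \<in> S then x k else 0) \<le> C"
    if C: "AE u in lebesgue. u \<in> I \<longrightarrow> ennreal (u powr (- \<theta> - recip q) * w u) * F u \<le> C" for C k
  proof (rule ccontr)
    assume *: "\<not> (if k \<in> S then x k else 0) \<le> C"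
    then have kS: "k \<in> S" by (auto split: if_splits)
    have "AE u in lebesgue. u \<notin> block k"
      using C
    proof eventually_elim
      case (elim u)
      show ?case
      proof
        assume u: "u \<in> block k"
        with ge[OF kS u] 1 elim have "x k \<le> C" by auto
        with * kS show False by simp
      qed
    qed
    then have "block k \<in> null_sets lebesgue" by (subst AE_iff_null_sets) auto
    then have "ennreal (dyad k) = 0"
      unfolding emeasure_block[symmetric] by (rule null_setsD1)
    then have "dyad k \<le> 0" by (simp only: ennreal_eq_0_iff)
    then show False using dyad_pos[of k] by linarith
  qed
  have "(SUP i. if i \<in> S then x i else 0)
      \<le> Inf {C. AE u in lebesgue. u \<in> I \<longrightarrow> ennreal (u powr (- \<theta> - recip q) * w u) * F u \<le> C}"
  proof (rule SUP_least, rule Inf_greatest)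
    fix k C assume "C \<in> {C. AE u in lebesgue. u \<in> I \<longrightarrow> ennreal (u powr (- \<theta> - recip q) * w u) * F u \<le> C}"
    then show "(if k \<in> S then x k else 0) \<le> C" unfolding mem_Collect_eq by (rule le_C)
  qed
  then show ?thesis using 1
    by (simp only: wnorm_def Lnorm_def snorm_def snorm_on_def if_True) simp
next
  case (2 p)
  let ?y = "\<lambda>k. if k \<in> S then x k else 0"
  let ?c = "\<lambda>k. ennreal (1 / dyad (k + 1)) * epow (?y k) p"
  let ?N = "\<integral>\<^sup>+ u\<in>I. epow (ennreal (u powr (- \<theta> - recip q) * w u) * F u) p \<partial>lebesgue"
  have "(\<integral>\<^sup>+ u. (\<integral>\<^sup>+ k. ?c k * indicator (block k) u \<partial>count_space UNIV) \<partial>lebesgue) \<le> ?N"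
  proof (intro nn_integral_mono)
    fix u :: real
    show "(\<integral>\<^sup>+ k. ?c k * indicator (block k) u \<partial>count_space UNIV)
      \<le> epow (ennreal (u powr (- \<theta> - recip q) * w u) * F u) p * indicator I u"
    proof (cases "0 < u")
      case True
      then obtain k where "dyad k \<le> u" "u < dyad (k + 1)" using ex_dyad_block by blast
      then have k: "u \<in> block k" by simp
      have eq: "epow (ennreal (u powr (- \<theta> - recip q) * w u) * F u) p
          = ennreal (1 / u) * epow (ennreal (u powr (- \<theta>) * w u) * F u) p"
        using 2 \<open>0 < u\<close> by (intro wnorm_integrand_epow)
      show ?thesis
      proof (cases "k \<in> S")
        case kS: True
        have "?c k \<le> ennreal (1 / u) * epow (ennreal (u powr (- \<theta>) * w u) * F u) p"
          using ge[OF kS k] k kS 2 \<open>0 < u\<close>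
          by (intro mult_mono epow_mono ennreal_leI) (auto simp: frac_le)
        then show ?thesis using ge[OF kS k] unfolding sum_blocks_at[OF k] eq by simp
      next
        case False
        then show ?thesis unfolding sum_blocks_at[OF k] by simp
      qed
    next
      case False
      then show ?thesis by (subst sum_blocks_nonpos) auto
    qed
  qed
  also have "(\<integral>\<^sup>+ u. (\<integral>\<^sup>+ k. ?c k * indicator (block k) u \<partial>count_space UNIV) \<partial>lebesgue)
      = (\<integral>\<^sup>+ k. ?c k * ennreal (dyad k) \<partial>count_space UNIV)"
    by (rule nn_integral_blocks)
  also have "\<dots> = (\<integral>\<^sup>+ k. ennreal (1 / 2) * epow (?y k) p \<partial>count_space UNIV)"
  proof (intro nn_integral_cong)
    fix k
    have "?c k * ennreal (dyad k) = (ennreal (1 / dyad (k + 1)) * ennreal (dyad k)) * epow (?y k) p"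
      by (simp only: mult_ac)
    also have "ennreal (1 / dyad (k + 1)) * ennreal (dyad k) = ennreal (1 / 2)"
      by (simp add: dyad_add flip: ennreal_mult)
    finally show "?c k * ennreal (dyad k) = ennreal (1 / 2) * epow (?y k) p" .
  qed
  also have "\<dots> = ennreal (1 / 2) * (\<integral>\<^sup>+ k. epow (?y k) p \<partial>count_space UNIV)"
    by (simp add: nn_integral_cmult)
  finally have "ennreal 2 * (ennreal (1 / 2) * (\<integral>\<^sup>+ k. epow (?y k) p \<partial>count_space UNIV)) \<le> ennreal 2 * ?N"
    by (rule mult_left_mono) simp
  also have "ennreal 2 * (ennreal (1 / 2) * (\<integral>\<^sup>+ k. epow (?y k) p \<partial>count_space UNIV)) = (\<integral>\<^sup>+ k. epow (?y k) p \<partial>count_space UNIV)"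
  proof -
    have "ennreal 2 * ennreal (1 / 2) = 1" by (simp only: ennreal_mult[symmetric]) simp
    then show ?thesis by (simp only: mult.assoc[symmetric] mult_1)
  qed
  finally have "epow (\<integral>\<^sup>+ k. epow (?y k) p \<partial>count_space UNIV) (1 / p) \<le> epow (ennreal 2 * ?N) (1 / p)"
    using 2 by (intro epow_mono) auto
  also have "\<dots> = ennreal (2 powr (1 / p)) * epow ?N (1 / p)"
    using 2 by (subst epow_mult) (simp_all only: epow_ennreal, auto)
  finally show ?thesis using 2
    by (simp add: wnorm_def Lnorm_def snorm_def snorm_on_def)
qed

text \<open>A family of functions is represented by a family of sequences if each function is comparable,
  uniformly, with the value of its sequence on every dyadic interval.\<close>
definition sampled :: "'p set \<Rightarrow> ('p \<Rightarrow> real \<Rightarrow> ennreal) \<Rightarrow> ('p \<Rightarrow> int \<Rightarrow> ennreal) \<Rightarrow> bool" where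
  "sampled P F x \<longleftrightarrow> (\<exists>C::real. \<forall>p\<in>P. \<forall>k. \<forall>u\<in>block k. F p u \<le> ennreal C * x p k \<and> x p k \<le> ennreal C * F p u)"

text \<open>Neighbouring terms are uniformly comparable. This allows the replacement of a truncation point by the
  next dyadic one.\<close>
definition steady :: "'p set \<Rightarrow> ('p \<Rightarrow> int \<Rightarrow> ennreal) \<Rightarrow> bool" where
  "steady P x \<longleftrightarrow> (\<exists>C::real. \<forall>p\<in>P. \<forall>k. x p k \<le> ennreal C * x p (k + 1) \<and> x p (k + 1) \<le> ennreal C * x p k)"

lemma le_mult_ennreal_mono: "a \<le> ennreal c * b \<Longrightarrow> c \<le> d \<Longrightarrow> a \<le> ennreal d * b"
  by (rule order_trans, assumption, rule mult_right_mono, rule ennreal_leI, assumption, rule zero_le)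

lemma sampledE:
  assumes "sampled P F x"
  obtains C :: real where "0 < C" "\<And>p k u. p \<in> P \<Longrightarrow> u \<in> block k \<Longrightarrow> F p u \<le> ennreal C * x p k"
    "\<And>p k u. p \<in> P \<Longrightarrow> u \<in> block k \<Longrightarrow> x p k \<le> ennreal C * F p u"
proof -
  obtain C :: real where C: "\<forall>p\<in>P. \<forall>k. \<forall>u\<in>block k. F p u \<le> ennreal C * x p k \<and> x p k \<le> ennreal C * F p u"
    using assms unfolding sampled_def ..
  show thesis
  proof (rule that[of "max C 1"])
    fix p u k assume "p \<in> P" "u \<in> block k"
    then have le: "F p u \<le> ennreal C * x p k" "x p k \<le> ennreal C * F p u" using C by auto
    show "F p u \<le> ennreal (max C 1) * x p k" "x p k \<le> ennreal (max C 1) * F p u"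
      using le[THEN le_mult_ennreal_mono, of "max C 1"] by simp_all
  qed simp
qed

lemma steadyE:
  assumes "steady P x"
  obtains C :: real where "0 < C" "\<And>p k. p \<in> P \<Longrightarrow> x p k \<le> ennreal C * x p (k + 1)"
    "\<And>p k. p \<in> P \<Longrightarrow> x p (k + 1) \<le> ennreal C * x p k"
proof -
  obtain C :: real where C: "\<forall>p\<in>P. \<forall>k. x p k \<le> ennreal C * x p (k + 1) \<and> x p (k + 1) \<le> ennreal C * x p k"
    using assms unfolding steady_def ..
  show thesis
  proof (rule that[of "max C 1"])
    fix p k assume "p \<in> P"
    then have le: "x p k \<le> ennreal C * x p (k + 1)" "x p (k + 1) \<le> ennreal C * x p k" using C by auto
    show "x p k \<le> ennreal (max C 1) * x p (k + 1)" "x p (k + 1) \<le> ennreal (max C 1) * x p k"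
      using le[THEN le_mult_ennreal_mono, of "max C 1"] by simp_all
  qed simp
qed

lemma ennreal_mult_le_mult:
  assumes "a \<le> c * b" "x \<le> ennreal d * y" "0 \<le> c" "0 \<le> b" "0 \<le> d"
  shows "ennreal a * x \<le> ennreal (c * d) * (ennreal b * y)"
proof -
  have "ennreal a * x \<le> ennreal (c * b) * (ennreal d * y)"
    using assms by (intro mult_mono ennreal_leI) auto
  also have "\<dots> = ennreal (c * d) * (ennreal b * y)"
    using assms by (simp add: ennreal_mult mult_ac)
  finally show ?thesis .
qed

lemma regvar_dyad_step:
  assumes "regvar \<delta> w"
  obtains C where "0 < C" "\<And>k. w (dyad k) \<le> C * w (dyad (k + 1))" "\<And>k. w (dyad (k + 1)) \<le> C * w (dyad k)"
proof -
  obtain c where c: "0 < c"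
    "\<And>k u. dyad k \<le> u \<Longrightarrow> u \<le> dyad (k + 1) \<Longrightarrow> w u \<le> c * w (dyad k) \<and> w (dyad k) \<le> c * w u"
    using regvar_block[OF assms(1)] by blast
  show thesis using c(1) c(2)[OF dyad_mono order_refl] by (intro that[of c]) auto
qed

lemma steady_weight:
  assumes "regvar \<delta> w" "steady P x"
  shows "steady P (\<lambda>p k. ennreal (w (dyad k)) * x p k)"
proof -
  obtain c where c: "0 < c" "\<And>k. w (dyad k) \<le> c * w (dyad (k + 1))" "\<And>k. w (dyad (k + 1)) \<le> c * w (dyad k)"
    using regvar_dyad_step[OF assms(1)] by blast
  obtain C :: real where C: "0 < C" "\<And>p k. p \<in> P \<Longrightarrow> x p k \<le> ennreal C * x p (k + 1)"
    "\<And>p k. p \<in> P \<Longrightarrow> x p (k + 1) \<le> ennreal C * x p k"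
    using steadyE[OF assms(2)] by blast
  show ?thesis unfolding steady_def
    using c C regvar_pos[OF assms(1) dyad_pos]
    by (intro exI[of _ "c * C"] ballI allI conjI ennreal_mult_le_mult) (auto simp: less_imp_le)
qed

lemma steady_snorm_on_shift:
  assumes "0 < q" "steady P x"
  shows "dominated P (\<lambda>p. snorm_on q (S p) (x p)) (\<lambda>p. snorm_on q ((\<lambda>i. i + 1) ` S p) (x p))"
    and "dominated P (\<lambda>p. snorm_on q (S p) (x p)) (\<lambda>p. snorm_on q ((\<lambda>i. i - 1) ` S p) (x p))"
proof -
  obtain C :: real where C: "0 < C" "\<And>p k. p \<in> P \<Longrightarrow> x p k \<le> ennreal C * x p (k + 1)"
    "\<And>p k. p \<in> P \<Longrightarrow> x p (k + 1) \<le> ennreal C * x p k"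
    using steadyE[OF assms(2)] by blast
  show "dominated P (\<lambda>p. snorm_on q (S p) (x p)) (\<lambda>p. snorm_on q ((\<lambda>i. i + 1) ` S p) (x p))"
    by (rule dominated_snorm_on_shift[OF assms(1), where m = 1]) (auto intro!: dominatedI[where C = C] C)
  have C3: "x p k \<le> ennreal C * x p (k - 1)" if "p \<in> P" for p k
    using C(3)[OF that, of "k - 1"] by simp
  show "dominated P (\<lambda>p. snorm_on q (S p) (x p)) (\<lambda>p. snorm_on q ((\<lambda>i. i - 1) ` S p) (x p))"
    by (rule dominated_snorm_on_shift[OF assms(1), where m = "-1"]) (auto intro!: dominatedI[where C = C] C3)
qed

lemma image_shift_int:
  "(\<lambda>i::int. i + 1) ` {k..} = {k + 1..}" "(\<lambda>i::int. i - 1) ` {..k} = {..k - 1}"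
  "(\<lambda>i::int. i + 1) ` {..k} = {..k + 1}" "(\<lambda>i::int. i - 1) ` {k..} = {k - 1..}"
  by (auto simp: image_iff Bex_def; presburger)+

lemma sampledI:
  assumes "dominated {(p, k, u). p \<in> P \<and> u \<in> block k} (\<lambda>(p, k, u). F p u) (\<lambda>(p, k, u). x p k)"
    and "dominated {(p, k, u). p \<in> P \<and> u \<in> block k} (\<lambda>(p, k, u). x p k) (\<lambda>(p, k, u). F p u)"
  shows "sampled P F x"
proof -
  obtain C :: real where C: "0 < C" "\<And>z. z \<in> {(p, k, u). p \<in> P \<and> u \<in> block k} \<Longrightarrow>
      (\<lambda>(p, k, u). F p u) z \<le> ennreal C * (\<lambda>(p, k, u). x p k) z" using dominatedE[OF assms(1)] by blast
  obtain D :: real where D: "0 < D" "\<And>z. z \<in> {(p, k, u). p \<in> P \<and> u \<in> block k} \<Longrightarrow>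
      (\<lambda>(p, k, u). x p k) z \<le> ennreal D * (\<lambda>(p, k, u). F p u) z" using dominatedE[OF assms(2)] by blast
  show ?thesis unfolding sampled_def
  proof (intro exI[of _ "max C D"] ballI allI conjI)
    fix p k u assume "p \<in> P" "u \<in> block k"
    then show "F p u \<le> ennreal (max C D) * x p k" "x p k \<le> ennreal (max C D) * F p u"
      using C(2)[of "(p, k, u)", THEN le_mult_ennreal_mono, of "max C D"]
        D(2)[of "(p, k, u)", THEN le_mult_ennreal_mono, of "max C D"] by simp_all
  qed
qed

lemma steadyI:
  assumes "dominated (P \<times> UNIV) (\<lambda>(p, k). x p k) (\<lambda>(p, k). x p (k + 1))"
    and "dominated (P \<times> UNIV) (\<lambda>(p, k). x p (k + 1)) (\<lambda>(p, k). x p k)"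
  shows "steady P x"
proof -
  obtain C :: real where C: "0 < C" "\<And>z. z \<in> P \<times> UNIV \<Longrightarrow>
      (\<lambda>(p, k). x p k) z \<le> ennreal C * (\<lambda>(p, k). x p (k + 1)) z" using dominatedE[OF assms(1)] by blast
  obtain D :: real where D: "0 < D" "\<And>z. z \<in> P \<times> UNIV \<Longrightarrow>
      (\<lambda>(p, k). x p (k + 1)) z \<le> ennreal D * (\<lambda>(p, k). x p k) z" using dominatedE[OF assms(2)] by blast
  show ?thesis unfolding steady_def
  proof (intro exI[of _ "max C D"] ballI allI conjI)
    fix p k assume "p \<in> P"
    then show "x p k \<le> ennreal (max C D) * x p (k + 1)" "x p (k + 1) \<le> ennreal (max C D) * x p k"
      using C(2)[of "(p, k)", THEN le_mult_ennreal_mono, of "max C D"]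
        D(2)[of "(p, k)", THEN le_mult_ennreal_mono, of "max C D"] by simp_all
  qed
qed

text \<open>A discretization in which the domain of integration, the function and the set of indices may all depend on the
  parameter, as the iterated norms require.\<close>
lemma dominated_wnorm_upper:
  assumes "0 < q" "regvar \<delta> w" "\<And>z. z \<in> Z \<Longrightarrow> I z \<subseteq> {0<..}"
    and F: "dominated {(z, k, u). z \<in> Z \<and> u \<in> I z \<and> u \<in> block k} (\<lambda>(z, k, u). F z u) (\<lambda>(z, k, u). x z k)"
    and S: "\<And>z k u. z \<in> Z \<Longrightarrow> u \<in> I z \<Longrightarrow> u \<in> block k \<Longrightarrow> k \<in> S z"
  shows "dominated Z (\<lambda>z. wnorm q \<theta> w (I z) (F z))
    (\<lambda>z. snorm_on q (S z) (\<lambda>k. ennreal (dyad k powr (- \<theta>) * w (dyad k)) * x z k))"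
proof -
  have v: "regvar (- \<theta> + \<delta>) (\<lambda>u. u powr (- \<theta>) * w u)"
    by (intro regvar_mult regvar_powr_id assms)
  obtain c where c: "0 < c"
    "\<And>k u. dyad k \<le> u \<Longrightarrow> u \<le> dyad (k + 1) \<Longrightarrow> u powr (- \<theta>) * w u \<le> c * (dyad k powr (- \<theta>) * w (dyad k)) \<and>
      dyad k powr (- \<theta>) * w (dyad k) \<le> c * (u powr (- \<theta>) * w u)"
    using regvar_block[OF v] by blast
  obtain C :: real where C: "0 < C" "\<And>y. y \<in> {(z, k, u). z \<in> Z \<and> u \<in> I z \<and> u \<in> block k} \<Longrightarrow>
      (\<lambda>(z, k, u). F z u) y \<le> ennreal C * (\<lambda>(z, k, u). x z k) y"
    using dominatedE[OF F] by blast
  show ?thesis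
  proof (rule dominatedI)
    fix z assume z: "z \<in> Z"
    show "wnorm q \<theta> w (I z) (F z) \<le> ennreal (c * C) *
      snorm_on q (S z) (\<lambda>k. ennreal (dyad k powr (- \<theta>) * w (dyad k)) * x z k)"
      unfolding snorm_on_cmult[OF assms(1), symmetric] unfolding snorm_on_def
    proof (rule wnorm_le[OF assms(1) assms(3)[OF z]])
      fix k u assume u: "u \<in> I z" "u \<in> block k"
      have "F z u \<le> ennreal C * x z k" using C(2)[of "(z, k, u)"] z u by simp
      then have "ennreal (u powr (- \<theta>) * w u) * F z u
          \<le> ennreal (c * C) * (ennreal (dyad k powr (- \<theta>) * w (dyad k)) * x z k)"
        using c(1) c(2)[of k u] u(2) C(1) regvar_pos[OF v dyad_pos, of k]
        by (intro ennreal_mult_le_mult) (simp_all add: less_imp_le)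
      then show "ennreal (u powr - \<theta> * w u) * F z u \<le>
        (if k \<in> S z then ennreal (c * C) * (ennreal (dyad k powr - \<theta> * w (dyad k)) * x z k) else 0)"
        using S[OF z u] by simp
    qed
  qed
qed

lemma dominated_wnorm_lower:
  assumes "0 < q" "regvar \<delta> w"
    and F: "dominated {(z, k, u). z \<in> Z \<and> k \<in> S z \<and> u \<in> block k} (\<lambda>(z, k, u). x z k) (\<lambda>(z, k, u). F z u)"
    and S: "\<And>z k u. z \<in> Z \<Longrightarrow> k \<in> S z \<Longrightarrow> u \<in> block k \<Longrightarrow> u \<in> I z"
  shows "dominated Z (\<lambda>z. snorm_on q (S z) (\<lambda>k. ennreal (dyad k powr (- \<theta>) * w (dyad k)) * x z k))
    (\<lambda>z. wnorm q \<theta> w (I z) (F z))"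
proof -
  have v: "regvar (- \<theta> + \<delta>) (\<lambda>u. u powr (- \<theta>) * w u)"
    by (intro regvar_mult regvar_powr_id assms)
  obtain c where c: "0 < c"
    "\<And>k u. dyad k \<le> u \<Longrightarrow> u \<le> dyad (k + 1) \<Longrightarrow> u powr (- \<theta>) * w u \<le> c * (dyad k powr (- \<theta>) * w (dyad k)) \<and>
      dyad k powr (- \<theta>) * w (dyad k) \<le> c * (u powr (- \<theta>) * w u)"
    using regvar_block[OF v] by blast
  obtain C' :: real where C': "0 < C'" "\<And>y. y \<in> {(z, k, u). z \<in> Z \<and> k \<in> S z \<and> u \<in> block k} \<Longrightarrow>
      (\<lambda>(z, k, u). x z k) y \<le> ennreal C' * (\<lambda>(z, k, u). F z u) y"
    using dominatedE[OF F] by blast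
  define C where "C = c * C'"
  have C: "0 < C" using c C' by (simp add: C_def)
  have inv: "ennreal (1 / C) * (ennreal C * y) = y" "ennreal C * (ennreal (1 / C) * y) = y" for y
    using C by (simp_all add: mult.assoc[symmetric] flip: ennreal_mult)
  show ?thesis
  proof (rule dominatedI)
    fix z assume z: "z \<in> Z"
    let ?x = "\<lambda>k. ennreal (dyad k powr (- \<theta>) * w (dyad k)) * x z k"
    have "ennreal (1 / C) * snorm_on q (S z) ?x \<le> ennreal (2 powr recip q) * wnorm q \<theta> w (I z) (F z)"
      unfolding snorm_on_cmult[OF assms(1), symmetric]
    proof (rule wnorm_ge[OF assms(1)])
      fix k u assume ku: "k \<in> S z" "u \<in> block k"
      then have "0 < u" using dyad_pos[of k] by (auto intro: less_le_trans simp del: dyad_pos)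
      have "x z k \<le> ennreal C' * F z u" using C'(2)[of "(z, k, u)"] z ku by simp
      then have "?x k \<le> ennreal C * (ennreal (u powr (- \<theta>) * w u) * F z u)"
        unfolding C_def using c(1) c(2)[of k u] ku(2) C'(1) regvar_pos[OF v \<open>0 < u\<close>]
        by (intro ennreal_mult_le_mult) (simp_all add: less_imp_le)
      then have "ennreal (1 / C) * ?x k \<le> ennreal (1 / C) * (ennreal C * (ennreal (u powr (- \<theta>) * w u) * F z u))"
        by (rule mult_left_mono) simp
      then show "u \<in> I z \<and> ennreal (1 / C) * ?x k \<le> ennreal (u powr - \<theta> * w u) * F z u"
        unfolding inv using S[OF z ku] by simp
    qed
    then have "ennreal C * (ennreal (1 / C) * snorm_on q (S z) ?x)
        \<le> ennreal C * (ennreal (2 powr recip q) * wnorm q \<theta> w (I z) (F z))"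
      by (rule mult_left_mono) simp
    then show "snorm_on q (S z) ?x \<le> ennreal (C * 2 powr recip q) * wnorm q \<theta> w (I z) (F z)"
      unfolding inv using C(1) by (simp add: ennreal_mult mult.assoc)
  qed
qed

abbreviation wt :: "real \<Rightarrow> (real \<Rightarrow> real) \<Rightarrow> int \<Rightarrow> ennreal" where
  "wt \<theta> w k \<equiv> ennreal (dyad k powr (- \<theta>) * w (dyad k))"

lemma sampled_dominated:
  assumes "sampled P F x" "\<And>z k u. (z, k, u) \<in> Q \<Longrightarrow> f z \<in> P \<and> u \<in> block k"
  shows "dominated Q (\<lambda>(z, k, u). F (f z) u) (\<lambda>(z, k, u). x (f z) k)"
    and "dominated Q (\<lambda>(z, k, u). x (f z) k) (\<lambda>(z, k, u). F (f z) u)"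
proof -
  obtain C :: real where C: "0 < C" "\<And>p k u. p \<in> P \<Longrightarrow> u \<in> block k \<Longrightarrow> F p u \<le> ennreal C * x p k"
    "\<And>p k u. p \<in> P \<Longrightarrow> u \<in> block k \<Longrightarrow> x p k \<le> ennreal C * F p u"
    using sampledE[OF assms(1)] by blast
  show "dominated Q (\<lambda>(z, k, u). F (f z) u) (\<lambda>(z, k, u). x (f z) k)"
  proof (rule dominatedI[where C = C])
    fix y assume y: "y \<in> Q"
    obtain z k u where "y = (z, k, u)" by (cases y)
    then show "(\<lambda>(z, k, u). F (f z) u) y \<le> ennreal C * (\<lambda>(z, k, u). x (f z) k) y"
      using C(2)[of "f z" u k] assms(2) y by simp
  qed
  show "dominated Q (\<lambda>(z, k, u). x (f z) k) (\<lambda>(z, k, u). F (f z) u)"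
  proof (rule dominatedI[where C = C])
    fix y assume y: "y \<in> Q"
    obtain z k u where "y = (z, k, u)" by (cases y)
    then show "(\<lambda>(z, k, u). x (f z) k) y \<le> ennreal C * (\<lambda>(z, k, u). F (f z) u) y"
      using C(3)[of "f z" u k] assms(2) y by simp
  qed
qed

lemma dyad_le_pos: "dyad k \<le> u \<Longrightarrow> 0 < u"
  using dyad_pos[of k] by linarith

lemma steady_reindex: "steady P x \<Longrightarrow> (\<And>z. z \<in> Z \<Longrightarrow> f z \<in> P) \<Longrightarrow> steady Z (\<lambda>z. x (f z))"
  unfolding steady_def by blast

lemma block_pos: "u \<in> block k \<Longrightarrow> 0 < u"
  by (auto dest: dyad_le_pos)

lemma wnorm_full:
  assumes "0 < q" "regvar \<delta> w" "sampled P F x"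
  shows "dominated P (\<lambda>p. wnorm q \<theta> w {0<..} (F p)) (\<lambda>p. snorm q (\<lambda>k. wt \<theta> w k * x p k))"
    and "dominated P (\<lambda>p. snorm q (\<lambda>k. wt \<theta> w k * x p k)) (\<lambda>p. wnorm q \<theta> w {0<..} (F p))"
proof -
  show "dominated P (\<lambda>p. wnorm q \<theta> w {0<..} (F p)) (\<lambda>p. snorm q (\<lambda>k. wt \<theta> w k * x p k))"
    by (rule dominated_wnorm_upper[OF assms(1,2), where S = "\<lambda>_. UNIV", unfolded snorm_on_UNIV])
       (auto intro!: sampled_dominated[OF assms(3), where f = "\<lambda>p. p"])
  show "dominated P (\<lambda>p. snorm q (\<lambda>k. wt \<theta> w k * x p k)) (\<lambda>p. wnorm q \<theta> w {0<..} (F p))"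
    by (rule dominated_wnorm_lower[OF assms(1,2), where S = "\<lambda>_. UNIV", unfolded snorm_on_UNIV])
       (auto intro!: sampled_dominated[OF assms(3), where f = "\<lambda>p. p"] dest: dyad_le_pos)
qed

text \<open>The interval \<open>(u, \<infinity>)\<close> contains all dyadic intervals that lie to the right of the one around \<open>u\<close>,
  but not that interval itself. Its term is recovered by shifting the sum by one index.\<close>
lemma sampled_tail:
  assumes "0 < q" "regvar \<delta> w" "sampled P F x" "steady P x"
  shows "sampled P (\<lambda>p t. wnorm q \<theta> w {t<..} (F p)) (\<lambda>p k. snorm_on q {k..} (\<lambda>i. wt \<theta> w i * x p i))"
proof (rule sampledI)
  let ?Z = "{(p, k, u). p \<in> P \<and> u \<in> block k}"
  have "dominated ?Z (\<lambda>z. wnorm q \<theta> w {snd (snd z)<..} (F (fst z)))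
    (\<lambda>z. snorm_on q {fst (snd z)..} (\<lambda>i. wt \<theta> w i * x (fst z) i))"
  proof (rule dominated_wnorm_upper[OF assms(1,2)])
    show "dominated {(z, k, u). z \<in> ?Z \<and> u \<in> {snd (snd z)<..} \<and> u \<in> block k}
      (\<lambda>(z, k, u). F (fst z) u) (\<lambda>(z, k, u). x (fst z) k)"
      by (rule sampled_dominated[OF assms(3), where f = fst]) auto
    show "{snd (snd z)<..} \<subseteq> {0<..}" if "z \<in> ?Z" for z
      using that by (auto dest!: dyad_le_pos)
    show "j \<in> {fst (snd z)..}" if "z \<in> ?Z" "u \<in> {snd (snd z)<..}" "u \<in> block j" for z j u
      using that dyad_block_le[of "fst (snd z)" "snd (snd z)" j u] by auto
  qed
  then show "dominated ?Z (\<lambda>(p, k, u). wnorm q \<theta> w {u<..} (F p))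
    (\<lambda>(p, k, u). snorm_on q {k..} (\<lambda>i. wt \<theta> w i * x p i))" by (simp add: case_prod_unfold)
  have v: "regvar (- \<theta> + \<delta>) (\<lambda>u. u powr (- \<theta>) * w u)"
    by (intro regvar_mult regvar_powr_id assms)
  have "dominated ?Z (\<lambda>z. snorm_on q {fst (snd z)..} (\<lambda>i. wt \<theta> w i * x (fst z) i))
    (\<lambda>z. snorm_on q ((\<lambda>i. i + 1) ` {fst (snd z)..}) (\<lambda>i. wt \<theta> w i * x (fst z) i))"
    by (rule steady_snorm_on_shift[OF assms(1)] , rule steady_reindex[OF steady_weight[OF v assms(4)]]) auto
  also have "dominated ?Z \<dots> (\<lambda>z. wnorm q \<theta> w {snd (snd z)<..} (F (fst z)))"
    unfolding image_shift_int
  proof (rule dominated_wnorm_lower[OF assms(1,2)])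
    show "dominated {(z, k, u). z \<in> ?Z \<and> k \<in> {fst (snd z) + 1..} \<and> u \<in> block k}
      (\<lambda>(z, k, u). x (fst z) k) (\<lambda>(z, k, u). F (fst z) u)"
      by (rule sampled_dominated[OF assms(3), where f = fst]) auto
    show "v \<in> {snd (snd z)<..}" if "z \<in> ?Z" "j \<in> {fst (snd z) + 1..}" "v \<in> block j" for z j v
      using that dyad_mono[of "fst (snd z) + 1" j] by auto
  qed
  finally show "dominated ?Z (\<lambda>(p, k, u). snorm_on q {k..} (\<lambda>i. wt \<theta> w i * x p i))
    (\<lambda>(p, k, u). wnorm q \<theta> w {u<..} (F p))" by (simp add: case_prod_unfold)
qed

lemma sampled_head:
  assumes "0 < q" "regvar \<delta> w" "sampled P F x" "steady P x"
  shows "sampled P (\<lambda>p t. wnorm q \<theta> w {0<..<t} (F p)) (\<lambda>p k. snorm_on q {..k} (\<lambda>i. wt \<theta> w i * x p i))"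
proof (rule sampledI)
  let ?Z = "{(p, k, u). p \<in> P \<and> u \<in> block k}"
  have "dominated ?Z (\<lambda>z. wnorm q \<theta> w {0<..<snd (snd z)} (F (fst z)))
    (\<lambda>z. snorm_on q {..fst (snd z)} (\<lambda>i. wt \<theta> w i * x (fst z) i))"
  proof (rule dominated_wnorm_upper[OF assms(1,2)])
    show "dominated {(z, k, u). z \<in> ?Z \<and> u \<in> {0<..<snd (snd z)} \<and> u \<in> block k}
      (\<lambda>(z, k, u). F (fst z) u) (\<lambda>(z, k, u). x (fst z) k)"
      by (rule sampled_dominated[OF assms(3), where f = fst]) auto
    show "j \<in> {..fst (snd z)}" if "z \<in> ?Z" "u \<in> {0<..<snd (snd z)}" "u \<in> block j" for z j u
      using that dyad_block_le[of j u "fst (snd z)" "snd (snd z)"] by auto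
  qed auto
  then show "dominated ?Z (\<lambda>(p, k, u). wnorm q \<theta> w {0<..<u} (F p))
    (\<lambda>(p, k, u). snorm_on q {..k} (\<lambda>i. wt \<theta> w i * x p i))" by (simp add: case_prod_unfold)
  have v: "regvar (- \<theta> + \<delta>) (\<lambda>u. u powr (- \<theta>) * w u)"
    by (intro regvar_mult regvar_powr_id assms)
  have "dominated ?Z (\<lambda>z. snorm_on q {..fst (snd z)} (\<lambda>i. wt \<theta> w i * x (fst z) i))
    (\<lambda>z. snorm_on q ((\<lambda>i. i - 1) ` {..fst (snd z)}) (\<lambda>i. wt \<theta> w i * x (fst z) i))"
    by (rule steady_snorm_on_shift[OF assms(1)] , rule steady_reindex[OF steady_weight[OF v assms(4)]]) auto
  also have "dominated ?Z \<dots> (\<lambda>z. wnorm q \<theta> w {0<..<snd (snd z)} (F (fst z)))"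
    unfolding image_shift_int
  proof (rule dominated_wnorm_lower[OF assms(1,2)])
    show "dominated {(z, k, u). z \<in> ?Z \<and> k \<in> {..fst (snd z) - 1} \<and> u \<in> block k}
      (\<lambda>(z, k, u). x (fst z) k) (\<lambda>(z, k, u). F (fst z) u)"
      by (rule sampled_dominated[OF assms(3), where f = fst]) auto
    show "v \<in> {0<..<snd (snd z)}" if "z \<in> ?Z" "j \<in> {..fst (snd z) - 1}" "v \<in> block j" for z j v
      using that dyad_mono[of "j + 1" "fst (snd z)"] block_pos[of v j] by auto
  qed
  finally show "dominated ?Z (\<lambda>(p, k, u). snorm_on q {..k} (\<lambda>i. wt \<theta> w i * x p i))
    (\<lambda>(p, k, u). wnorm q \<theta> w {0<..<u} (F p))" by (simp add: case_prod_unfold)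
qed

lemma steady_tail:
  assumes "0 < q" "steady P x"
  shows "steady P (\<lambda>p k. snorm_on q {k..} (x p))"
proof (rule steadyI)
  have "dominated (P \<times> UNIV) (\<lambda>z. snorm_on q {snd z..} (x (fst z)))
    (\<lambda>z. snorm_on q ((\<lambda>i. i + 1) ` {snd z..}) (x (fst z)))"
    by (rule steady_snorm_on_shift[OF assms(1)] , rule steady_reindex[OF assms(2)]) auto
  then show "dominated (P \<times> UNIV) (\<lambda>(p, k). snorm_on q {k..} (x p)) (\<lambda>(p, k). snorm_on q {k + 1..} (x p))"
    unfolding image_shift_int by (simp add: case_prod_unfold)
  show "dominated (P \<times> UNIV) (\<lambda>(p, k). snorm_on q {k + 1..} (x p)) (\<lambda>(p, k). snorm_on q {k..} (x p))"
    by (rule dominated_le) (auto intro!: snorm_on_mono assms)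
qed

text \<open>K-functionals satisfy this with no further constant, although the norms involved are only
  quasi-norms.\<close>
definition quasiconcave :: "(real \<Rightarrow> ennreal) \<Rightarrow> bool" where
  "quasiconcave \<phi> \<longleftrightarrow> (\<forall>s t. 0 < s \<and> s \<le> t \<longrightarrow> \<phi> s \<le> \<phi> t \<and> \<phi> t \<le> ennreal (t / s) * \<phi> s)"

lemma quasiconcaveD:
  assumes "quasiconcave \<phi>" "0 < s" "s \<le> t"
  shows "\<phi> s \<le> \<phi> t" "\<phi> t \<le> ennreal (t / s) * \<phi> s"
  using assms by (auto simp: quasiconcave_def)

lemma quasiconcave_block:
  assumes "quasiconcave \<phi>" "dyad k \<le> u" "u \<le> dyad (k + 1)"
  shows "\<phi> (dyad k) \<le> \<phi> u" "\<phi> u \<le> ennreal 2 * \<phi> (dyad k)"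
proof -
  show "\<phi> (dyad k) \<le> \<phi> u" using quasiconcaveD(1)[OF assms(1) dyad_pos assms(2)] .
  have "\<phi> u \<le> ennreal (u / dyad k) * \<phi> (dyad k)" using quasiconcaveD(2)[OF assms(1) dyad_pos assms(2)] .
  also have "\<dots> \<le> ennreal 2 * \<phi> (dyad k)"
    using assms(3) by (intro mult_right_mono ennreal_leI) (auto simp: divide_le_eq dyad_add mult.commute)
  finally show "\<phi> u \<le> ennreal 2 * \<phi> (dyad k)" .
qed

lemma quasiconcave_block':
  assumes "quasiconcave \<phi>" "dyad k \<le> u" "u \<le> dyad (k + 1)"
  shows "\<phi> (dyad k) \<le> ennreal 2 * \<phi> u"
  using le_mult_ennreal_mono[of "\<phi> (dyad k)" 1 "\<phi> u" 2] quasiconcave_block(1)[OF assms] by simp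

lemma sampled_quasiconcave:
  assumes "\<And>p. p \<in> P \<Longrightarrow> quasiconcave (F p)"
  shows "sampled P F (\<lambda>p k. F p (dyad k))"
  unfolding sampled_def
proof (intro exI[of _ 2] ballI allI)
  fix p k u assume "p \<in> P" "u \<in> block k"
  then show "F p u \<le> ennreal 2 * F p (dyad k) \<and> F p (dyad k) \<le> ennreal 2 * F p u"
    using quasiconcave_block(2)[of "F p" k u] quasiconcave_block'[of "F p" k u] assms by auto
qed

lemma steady_quasiconcave:
  assumes "\<And>p. p \<in> P \<Longrightarrow> quasiconcave (F p)"
  shows "steady P (\<lambda>p k. F p (dyad k))"
  unfolding steady_def
proof (intro exI[of _ 2] ballI allI)
  fix p and k :: int assume "p \<in> P"
  then show "F p (dyad k) \<le> ennreal 2 * F p (dyad (k + 1)) \<and> F p (dyad (k + 1)) \<le> ennreal 2 * F p (dyad k)"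
    using quasiconcave_block(2)[of "F p" k "dyad (k + 1)"] quasiconcave_block'[of "F p" k "dyad (k + 1)"]
      assms dyad_mono[of k "k + 1"] by auto
qed

lemma sampled_const: "sampled P (\<lambda>_ _. 1) (\<lambda>_ _. 1)" and steady_const: "steady P (\<lambda>_ _. 1)"
  unfolding sampled_def steady_def by (auto intro!: exI[of _ 1])

section \<open>Regular variation of \<open>\<chi>\<^sub>1\<close>\<close>

lemma snorm_on_shift_eq:
  assumes "0 < q" "\<And>i. i + m \<in> T \<longleftrightarrow> i \<in> S"
  shows "snorm_on q T x = snorm_on q S (\<lambda>i. x (i + m))"
  unfolding snorm_on_def using snorm_shift[OF assms(1), of "\<lambda>i. if i \<in> T then x i else 0" m]
  by (simp add: assms(2))

text \<open>The discrete form of slow variation, stated with a shift because the sequences in question are norms in which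
  a shift can be moved onto the weights.\<close>
definition slow :: "(int \<Rightarrow> ennreal) \<Rightarrow> bool" where
  "slow x \<longleftrightarrow> (\<forall>\<epsilon>>0. \<exists>C::real. 0 < C \<and> (\<forall>k m. x (k + m) \<le> ennreal (C * 2 powr (\<epsilon> * \<bar>real_of_int m\<bar>)) * x k))"

lemma slowE:
  assumes "slow x" "0 < \<epsilon>"
  obtains C :: real where "0 < C" "\<And>k m. x (k + m) \<le> ennreal (C * 2 powr (\<epsilon> * \<bar>real_of_int m\<bar>)) * x k"
  using assms unfolding slow_def by blast

lemma slow_regvar:
  assumes "regvar 0 w"
  shows "slow (\<lambda>k. ennreal (w (dyad k)))"
  unfolding slow_def
proof (intro allI impI)
  fix \<epsilon> :: real assume e: "0 < \<epsilon>"
  obtain C where C: "0 < C" "\<And>s t. 0 < s \<Longrightarrow> s \<le> t \<Longrightarrow> w t \<le> C * (t / s) powr (0 + \<epsilon>) * w s"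
    "\<And>s t. 0 < s \<Longrightarrow> s \<le> t \<Longrightarrow> w s \<le> C * (t / s) powr (\<epsilon> - 0) * w t"
    using regvarE[OF assms e] by blast
  have "w (dyad (k + m)) \<le> C * 2 powr (\<epsilon> * \<bar>real_of_int m\<bar>) * w (dyad k)" for k m
  proof (cases "0 \<le> m")
    case True
    then show ?thesis using C(2)[of "dyad k" "dyad (k + m)"] dyad_mono[of k "k + m"]
      by (simp add: dyad_divide powr_powr mult_ac)
  next
    case False
    then show ?thesis using C(3)[of "dyad (k + m)" "dyad k"] dyad_mono[of "k + m" k]
      by (simp add: dyad_divide powr_powr mult_ac)
  qed
  then show "\<exists>C::real. 0 < C \<and> (\<forall>k m. ennreal (w (dyad (k + m))) \<le>
      ennreal (C * 2 powr (\<epsilon> * \<bar>real_of_int m\<bar>)) * ennreal (w (dyad k)))"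
    using C(1) by (intro exI[of _ C]) (simp add: ennreal_leI flip: ennreal_mult')
qed

text \<open>Translating both indices of summation moves the shift from the bounds of summation onto the weights, which are slowly
  varying.\<close>
lemma slow_chi:
  assumes "0 < q" "0 < r" "slow a" "slow b"
  shows "slow (\<lambda>k. snorm_on r {..k} (\<lambda>j. b j * snorm_on q {j..k} a))"
  unfolding slow_def
proof (intro allI impI)
  fix \<epsilon> :: real assume "0 < \<epsilon>"
  then have e: "0 < \<epsilon> / 2" by simp
  obtain c :: real where c: "0 < c" "\<And>k m. a (k + m) \<le> ennreal (c * 2 powr (\<epsilon> / 2 * \<bar>real_of_int m\<bar>)) * a k"
    using slowE[OF assms(3) e] by blast
  obtain d :: real where d: "0 < d" "\<And>k m. b (k + m) \<le> ennreal (d * 2 powr (\<epsilon> / 2 * \<bar>real_of_int m\<bar>)) * b k"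
    using slowE[OF assms(4) e] by blast
  show "\<exists>C::real. 0 < C \<and> (\<forall>k m. snorm_on r {..k + m} (\<lambda>j. b j * snorm_on q {j..k + m} a) \<le>
      ennreal (C * 2 powr (\<epsilon> * \<bar>real_of_int m\<bar>)) * snorm_on r {..k} (\<lambda>j. b j * snorm_on q {j..k} a))"
  proof (intro exI[of _ "d * c"] conjI allI)
    show "0 < d * c" using c d by simp
    fix k m
    define E where "E = 2 powr (\<epsilon> / 2 * \<bar>real_of_int m\<bar>)"
    have E: "E * E = 2 powr (\<epsilon> * \<bar>real_of_int m\<bar>)" "0 < E"
      by (simp_all add: E_def powr_add[symmetric])
    have "snorm_on r {..k + m} (\<lambda>j. b j * snorm_on q {j..k + m} a)
        = snorm_on r {..k} (\<lambda>j. b (j + m) * snorm_on q {j + m..k + m} a)"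
      by (rule snorm_on_shift_eq[OF assms(2)]) auto
    also have "\<dots> = snorm_on r {..k} (\<lambda>j. b (j + m) * snorm_on q {j..k} (\<lambda>i. a (i + m)))"
      by (intro snorm_on_cong arg_cong2[of _ _ _ _ "(*)"] refl snorm_on_shift_eq[OF assms(1)]) auto
    also have "\<dots> \<le> snorm_on r {..k} (\<lambda>j. ennreal (d * c * (E * E)) * (b j * snorm_on q {j..k} a))"
    proof (intro snorm_on_mono assms(2) conjI)
      fix j
      have "snorm_on q {j..k} (\<lambda>i. a (i + m)) \<le> snorm_on q {j..k} (\<lambda>i. ennreal (c * E) * a i)"
        using c(2) by (intro snorm_on_mono assms(1) conjI) (auto simp: E_def)
      then have "b (j + m) * snorm_on q {j..k} (\<lambda>i. a (i + m))
          \<le> (ennreal (d * E) * b j) * (ennreal (c * E) * snorm_on q {j..k} a)"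
        using d(2)[of j m] unfolding snorm_on_cmult[OF assms(1)] by (intro mult_mono) (auto simp: E_def)
      also have "\<dots> = (ennreal (d * E) * ennreal (c * E)) * (b j * snorm_on q {j..k} a)"
        by (simp only: mult_ac)
      also have "ennreal (d * E) * ennreal (c * E) = ennreal (d * c * (E * E))"
        using c d E by (simp add: mult_ac flip: ennreal_mult)
      finally show "b (j + m) * snorm_on q {j..k} (\<lambda>i. a (i + m))
          \<le> ennreal (d * c * (E * E)) * (b j * snorm_on q {j..k} a)" .
    qed auto
    finally show "snorm_on r {..k + m} (\<lambda>j. b j * snorm_on q {j..k + m} a) \<le>
      ennreal (d * c * 2 powr (\<epsilon> * \<bar>real_of_int m\<bar>)) * snorm_on r {..k} (\<lambda>j. b j * snorm_on q {j..k} a)"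
      unfolding snorm_on_cmult[OF assms(2)] E(1) .
  qed
qed

lemma slow_head:
  assumes "0 < r" "slow b"
  shows "slow (\<lambda>k. snorm_on r {..k} b)"
  unfolding slow_def
proof (intro allI impI)
  fix \<epsilon> :: real assume e: "0 < \<epsilon>"
  obtain d :: real where d: "0 < d" "\<And>k m. b (k + m) \<le> ennreal (d * 2 powr (\<epsilon> * \<bar>real_of_int m\<bar>)) * b k"
    using slowE[OF assms(2) e] by blast
  have "snorm_on r {..k + m} b \<le> ennreal (d * 2 powr (\<epsilon> * \<bar>real_of_int m\<bar>)) * snorm_on r {..k} b" for k m
  proof -
    have "snorm_on r {..k + m} b = snorm_on r {..k} (\<lambda>j. b (j + m))"
      by (rule snorm_on_shift_eq[OF assms(1)]) auto
    also have "\<dots> \<le> snorm_on r {..k} (\<lambda>j. ennreal (d * 2 powr (\<epsilon> * \<bar>real_of_int m\<bar>)) * b j)"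
      using d(2) by (intro snorm_on_mono assms(1) conjI) auto
    finally show ?thesis unfolding snorm_on_cmult[OF assms(1)] .
  qed
  then show "\<exists>C::real. 0 < C \<and> (\<forall>k m. snorm_on r {..k + m} b
      \<le> ennreal (C * 2 powr (\<epsilon> * \<bar>real_of_int m\<bar>)) * snorm_on r {..k} b)" using d(1) by blast
qed

lemma regvar_enn2real:
  assumes "sampled (UNIV :: unit set) (\<lambda>_. N) (\<lambda>_. X)" "slow X" "X 0 < \<infinity>" "\<And>k. 0 < X k"
  shows "regvar 0 (\<lambda>t. enn2real (N t))" and "\<And>t. 0 < t \<Longrightarrow> N t < \<infinity>"
proof -
  obtain c :: real where c: "0 < c" "\<And>p k u. p \<in> (UNIV :: unit set) \<Longrightarrow> u \<in> block k \<Longrightarrow> N u \<le> ennreal c * X k"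
    "\<And>p k u. p \<in> (UNIV :: unit set) \<Longrightarrow> u \<in> block k \<Longrightarrow> X k \<le> ennreal c * N u"
    using sampledE[OF assms(1)] by blast
  have fin: "X k < top" for k
  proof -
    obtain C :: real where C: "0 < C" "\<And>k m. X (k + m) \<le> ennreal (C * 2 powr (1 * \<bar>real_of_int m\<bar>)) * X k"
      using slowE[OF assms(2) zero_less_one] by blast
    have "X (0 + k) \<le> ennreal (C * 2 powr (1 * \<bar>real_of_int k\<bar>)) * X 0" by (rule C)
    also have "\<dots> < top" using assms(3) by (simp add: ennreal_mult_less_top)
    finally show ?thesis by simp
  qed
  have Nfin: "N u < top" if "u \<in> block k" for u k
  proof -
    have "N u \<le> ennreal c * X k" using c(2) that by auto
    also have "\<dots> < top" using fin[of k] by (simp add: ennreal_mult_less_top)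
    finally show ?thesis .
  qed
  show "N t < \<infinity>" if t: "0 < t" for t
  proof -
    obtain k where "dyad k \<le> t" "t < dyad (k + 1)" using ex_dyad_block[OF t] .
    then show ?thesis using Nfin[of t k] by simp
  qed
  show "regvar 0 (\<lambda>t. enn2real (N t))"
  proof (rule regvar_from_dyadic[where X = "\<lambda>k. enn2real (X k)" and c = c])
    show "0 < enn2real (X k)" for k using assms(4) fin by (simp add: enn2real_positive_iff)
    show "0 < c" by fact
    fix \<epsilon> :: real assume e: "0 < \<epsilon>"
    obtain C :: real where C: "0 < C" "\<And>k m. X (k + m) \<le> ennreal (C * 2 powr (\<epsilon> * \<bar>real_of_int m\<bar>)) * X k"
      using slowE[OF assms(2) e] by blast
    have "enn2real (X j) \<le> C * 2 powr (\<epsilon> * \<bar>real_of_int (j - k)\<bar>) * enn2real (X k)" for j k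
    proof -
      have "enn2real (X j) \<le> enn2real (ennreal (C * 2 powr (\<epsilon> * \<bar>real_of_int (j - k)\<bar>)) * X k)"
        using C(2)[of k "j - k"] fin[of k] by (intro enn2real_mono) (simp_all add: ennreal_mult_less_top)
      then show ?thesis using C(1) by (simp add: enn2real_mult)
    qed
    then show "\<exists>C. \<forall>j k. enn2real (X j) \<le> C * 2 powr (\<epsilon> * \<bar>real_of_int (j - k)\<bar>) * enn2real (X k)" by blast
  next
    fix k t assume "dyad k \<le> t" "t < dyad (k + 1)"
    then have t: "t \<in> block k" by simp
    have "enn2real (X k) \<le> enn2real (ennreal c * N t)"
      using c(3)[OF _ t] Nfin[OF t] by (intro enn2real_mono) (simp_all add: ennreal_mult_less_top)
    moreover have "enn2real (N t) \<le> enn2real (ennreal c * X k)"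
      using c(2)[OF _ t] fin[of k] by (intro enn2real_mono) (simp_all add: ennreal_mult_less_top)
    ultimately show "enn2real (X k) \<le> c * enn2real (N t) \<and> enn2real (N t) \<le> c * enn2real (X k)"
      using c(1) by (simp add: enn2real_mult)
  qed
qed

lemma dominated_mult:
  assumes "dominated P A B" "dominated P A' B'"
  shows "dominated P (\<lambda>p. A p * A' p) (\<lambda>p. B p * B' p)"
proof -
  have "dominated P (\<lambda>p. A p * A' p) (\<lambda>p. A p * B' p)" by (rule dominated_mult_left[OF assms(2)])
  also have "dominated P (\<lambda>p. A p * B' p) (\<lambda>p. B p * B' p)"
    using dominated_mult_left[OF assms(1), of B'] by (simp add: mult.commute)
  finally show ?thesis .
qed

text \<open>The inner norm over \<open>(s, t)\<close> degenerates as \<open>s\<close> approaches \<open>t\<close>. The lower estimate therefore uses only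
  those \<open>s\<close> that lie at least two dyadic intervals below \<open>t\<close>, and index shifts by 2 and 1
  recover the full double norm.\<close>
lemma sampled_chi:
  assumes "0 < q" "0 < r" "regvar 0 a" "regvar 0 b"
  shows "sampled (UNIV :: unit set) (\<lambda>_ t. wnorm r 0 b {0<..<t} (\<lambda>s. wnorm q 0 a {s<..<t} (\<lambda>u. 1)))
    (\<lambda>_ k. snorm_on r {..k} (\<lambda>j. ennreal (b (dyad j)) * snorm_on q {j..k} (\<lambda>i. ennreal (a (dyad i)))))"
    (is "sampled _ (\<lambda>_. ?N) (\<lambda>_. ?X)")
proof -
  let ?Z = "{(k, t). t \<in> block k}"
  let ?a = "\<lambda>i. ennreal (a (dyad i))" and ?b = "\<lambda>i. ennreal (b (dyad i))"
  have "dominated ?Z (\<lambda>z. wnorm r 0 b {0<..<snd z} (\<lambda>s. wnorm q 0 a {s<..<snd z} (\<lambda>u. 1)))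
    (\<lambda>z. snorm_on r {..fst z} (\<lambda>j. wt 0 b j * snorm_on q {j..fst z} (\<lambda>i. wt 0 a i * 1)))"
  proof (rule dominated_wnorm_upper[OF assms(2,4)])
    let ?Y = "{(z, j, s). z \<in> ?Z \<and> s \<in> {0<..<snd z} \<and> s \<in> block j}"
    have "dominated ?Y (\<lambda>y. wnorm q 0 a {snd (snd y)<..<snd (fst y)} (\<lambda>u. 1))
      (\<lambda>y. snorm_on q {fst (snd y)..fst (fst y)} (\<lambda>i. wt 0 a i * 1))"
    proof (rule dominated_wnorm_upper[OF assms(1,3)])
      show "j \<in> {fst (snd y)..fst (fst y)}"
        if "y \<in> ?Y" "u \<in> {snd (snd y)<..<snd (fst y)}" "u \<in> block j" for y j u
        using that dyad_block_le[of "fst (snd y)" "snd (snd y)" j u]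
          dyad_block_le[of j u "fst (fst y)" "snd (fst y)"] by auto
    qed (auto simp: case_prod_unfold)
    then show "dominated ?Y (\<lambda>(z, j, s). wnorm q 0 a {s<..<snd z} (\<lambda>u. 1))
      (\<lambda>(z, j, s). snorm_on q {j..fst z} (\<lambda>i. wt 0 a i * 1))" by (simp add: case_prod_unfold)
    show "j \<in> {..fst z}" if "z \<in> ?Z" "u \<in> {0<..<snd z}" "u \<in> block j" for z j u
      using that dyad_block_le[of j u "fst z" "snd z"] by auto
  qed auto
  then have upper: "dominated ?Z (\<lambda>z. ?N (snd z)) (\<lambda>z. ?X (fst z))" by simp

  have shift_a: "dominated UNIV (\<lambda>i. ?a i) (\<lambda>i. ?a (i + -1))" and shift_b: "dominated UNIV (\<lambda>i. ?b i) (\<lambda>i. ?b (i + -2))"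
  proof -
    have "dominated UNIV (\<lambda>i. ennreal (w (dyad i))) (\<lambda>i. ennreal (w (dyad (i + m))))" if w: "regvar 0 w" for w and m :: int
    proof -
      obtain C :: real where C: "\<And>k m. ennreal (w (dyad (k + m))) \<le> ennreal (C * 2 powr (1 * \<bar>real_of_int m\<bar>)) * ennreal (w (dyad k))"
        using slowE[OF slow_regvar[OF w] zero_less_one] by blast
      show ?thesis using C[of "_ + m" "- m"] by (intro dominatedI[where C = "C * 2 powr (1 * \<bar>real_of_int (- m)\<bar>)"]) simp
    qed
    then show "dominated UNIV (\<lambda>i. ?a i) (\<lambda>i. ?a (i + -1))" "dominated UNIV (\<lambda>i. ?b i) (\<lambda>i. ?b (i + -2))"
      using assms by blast+
  qed
  have "dominated ?Z (\<lambda>z. ?X (fst z)) (\<lambda>z. snorm_on r {..fst z - 2} (\<lambda>j. ?b j * snorm_on q {j + 1..fst z - 1} ?a))"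
  proof (rule dominated_snorm_on_shift[OF assms(2), where m = "-2"])
    let ?Y = "{(z, j). z \<in> ?Z \<and> j \<in> {..fst z}}"
    have 1: "dominated ?Y (\<lambda>y. ?b (snd y)) (\<lambda>y. ?b (snd y + -2))" by (rule dominated_comp[OF shift_b]) simp
    have 2: "dominated ?Y (\<lambda>y. snorm_on q {snd y..fst (fst y)} ?a) (\<lambda>y. snorm_on q {snd y + -2 + 1..fst (fst y) - 1} ?a)"
      by (rule dominated_snorm_on_shift[OF assms(1), where m = "-1"])
         (use dominated_comp[OF shift_a, of _ snd] in \<open>auto simp: case_prod_unfold\<close>)
    show "dominated ?Y (\<lambda>(z, j). ?b j * snorm_on q {j..fst z} ?a)
      (\<lambda>(z, j). ?b (j + -2) * snorm_on q {j + -2 + 1..fst z - 1} ?a)"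
      using dominated_mult[OF 1 2] by (simp add: case_prod_unfold)
  qed auto
  also have "dominated ?Z (\<lambda>z. snorm_on r {..fst z - 2} (\<lambda>j. ?b j * snorm_on q {j + 1..fst z - 1} ?a))
    (\<lambda>z. wnorm r 0 b {0<..<snd z} (\<lambda>s. wnorm q 0 a {s<..<snd z} (\<lambda>u. 1)))"
  proof -
    have "dominated ?Z (\<lambda>z. snorm_on r {..fst z - 2} (\<lambda>j. wt 0 b j * snorm_on q {j + 1..fst z - 1} (\<lambda>i. wt 0 a i * 1)))
      (\<lambda>z. wnorm r 0 b {0<..<snd z} (\<lambda>s. wnorm q 0 a {s<..<snd z} (\<lambda>u. 1)))"
    proof (rule dominated_wnorm_lower[OF assms(2,4)])
      let ?Y = "{(z, j, s). z \<in> ?Z \<and> j \<in> {..fst z - 2} \<and> s \<in> block j}"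
      have "dominated ?Y (\<lambda>y. snorm_on q {fst (snd y) + 1..fst (fst y) - 1} (\<lambda>i. wt 0 a i * 1))
        (\<lambda>y. wnorm q 0 a {snd (snd y)<..<snd (fst y)} (\<lambda>u. 1))"
      proof (rule dominated_wnorm_lower[OF assms(1,3)])
        show "u \<in> {snd (snd y)<..<snd (fst y)}"
          if "y \<in> ?Y" "j \<in> {fst (snd y) + 1..fst (fst y) - 1}" "u \<in> block j" for y j u
          using that dyad_mono[of "fst (snd y) + 1" j] dyad_mono[of "j + 1" "fst (fst y)"] by auto
      qed (auto simp: case_prod_unfold)
      then show "dominated ?Y (\<lambda>(z, j, s). snorm_on q {j + 1..fst z - 1} (\<lambda>i. wt 0 a i * 1))
        (\<lambda>(z, j, s). wnorm q 0 a {s<..<snd z} (\<lambda>u. 1))" by (simp add: case_prod_unfold)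
      show "u \<in> {0<..<snd z}" if "z \<in> ?Z" "j \<in> {..fst z - 2}" "u \<in> block j" for z j u
        using that dyad_mono[of "j + 1" "fst z"] block_pos[of u j] by auto
    qed
    then show ?thesis by simp
  qed
  finally have lower: "dominated ?Z (\<lambda>z. ?X (fst z)) (\<lambda>z. ?N (snd z))" .
  have "dominated {(p :: unit, k, u). p \<in> UNIV \<and> u \<in> block k} (\<lambda>y. ?N (snd (snd y))) (\<lambda>y. ?X (fst (snd y)))"
    "dominated {(p :: unit, k, u). p \<in> UNIV \<and> u \<in> block k} (\<lambda>y. ?X (fst (snd y))) (\<lambda>y. ?N (snd (snd y)))"
    by (rule dominated_comp[OF upper] dominated_comp[OF lower], force)+
  then show ?thesis by (intro sampledI) (simp_all only: case_prod_unfold)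
qed

lemma dominated_snorm':
  assumes "0 < q" "dominated (P \<times> UNIV) (\<lambda>z. x (fst z) (snd z)) (\<lambda>z. y (fst z) (snd z))"
  shows "dominated P (\<lambda>p. snorm q (x p)) (\<lambda>p. snorm q (y p))"
  by (rule dominated_snorm[OF assms(1)]) (use assms(2) in \<open>simp add: case_prod_unfold\<close>)

lemma dominated_snorm_on':
  assumes "0 < q" "dominated {z. fst z \<in> P \<and> snd z \<in> S (fst z)} (\<lambda>z. x (fst z) (snd z)) (\<lambda>z. y (fst z) (snd z))"
  shows "dominated P (\<lambda>p. snorm_on q (S p) (x p)) (\<lambda>p. snorm_on q (S p) (y p))"
  by (rule dominated_snorm_on[OF assms(1)]) (use assms(2) in \<open>simp add: case_prod_unfold\<close>)

section \<open>Change of variables\<close>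

lemma fibre_card:
  assumes "\<And>k k' :: int. \<sigma> k = \<sigma> k' \<Longrightarrow> \<bar>k - k'\<bar> \<le> N"
  shows "finite {k. \<sigma> k = j} \<and> card {k. \<sigma> k = j} \<le> nat (2 * N + 1)"
proof (cases "{k. \<sigma> k = j} = {}")
  case True
  then show ?thesis by (simp only: finite.emptyI card.empty) simp
next
  case False
  then obtain k0 where "\<sigma> k0 = j" by auto
  then have sub: "{k. \<sigma> k = j} \<subseteq> {k0 - N..k0 + N}" using assms by fastforce
  then have "card {k. \<sigma> k = j} \<le> card {k0 - N..k0 + N}" by (intro card_mono) auto
  then show ?thesis using finite_subset[OF sub] by simp
qed

text \<open>Values at points with bounded ratio are comparable; this is what a change of variables
  needs when points are only located up to a factor.\<close>
definition comparable :: "'p set \<Rightarrow> ('p \<Rightarrow> real \<Rightarrow> ennreal) \<Rightarrow> bool" where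
  "comparable P G \<longleftrightarrow> (\<forall>L\<ge>1. \<exists>C::real. \<forall>p\<in>P. \<forall>s t. 0 < s \<and> 0 < t \<and> s \<le> L * t \<and> t \<le> L * s \<longrightarrow> G p s \<le> ennreal C * G p t)"

lemma comparable_weight:
  assumes "regvar \<delta> w" "\<And>p. p \<in> P \<Longrightarrow> quasiconcave (\<phi> p)"
  shows "comparable P (\<lambda>p t. ennreal (w t) * \<phi> p t)"
  unfolding comparable_def
proof (intro allI impI)
  fix L :: real assume L: "1 \<le> L"
  obtain C where C: "0 < C" "\<And>s t. 0 < s \<Longrightarrow> 0 < t \<Longrightarrow> s \<le> L * t \<Longrightarrow> t \<le> L * s \<Longrightarrow> w s \<le> C * w t"
    using regvar_comparable[OF assms(1) L] by blast
  have "ennreal (w s) * \<phi> p s \<le> ennreal (C * L) * (ennreal (w t) * \<phi> p t)"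
    if p: "p \<in> P" and st: "0 < s" "0 < t" "s \<le> L * t" "t \<le> L * s" for p s t
  proof (rule ennreal_mult_le_mult)
    show "w s \<le> C * w t" using C st by blast
    show "\<phi> p s \<le> ennreal L * \<phi> p t"
    proof (cases "s \<le> t")
      case True
      then have "\<phi> p s \<le> ennreal 1 * \<phi> p t"
        using quasiconcaveD(1)[OF assms(2)[OF p] st(1) True] by simp
      then show ?thesis using L by (rule le_mult_ennreal_mono)
    next
      case False
      then have "\<phi> p s \<le> ennreal (s / t) * \<phi> p t"
        using quasiconcaveD(2)[OF assms(2)[OF p] st(2), of s] by simp
      then show ?thesis by (rule le_mult_ennreal_mono) (use st in \<open>simp add: divide_le_eq\<close>)
    qed
    show "0 \<le> C" using C(1) by simp
    show "0 \<le> w t" using regvar_pos[OF assms(1) st(2)] by simp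
    show "0 \<le> L" using L by simp
  qed
  then show "\<exists>C::real. \<forall>p\<in>P. \<forall>s t. 0 < s \<and> 0 < t \<and> s \<le> L * t \<and> t \<le> L * s \<longrightarrow>
      ennreal (w s) * \<phi> p s \<le> ennreal C * (ennreal (w t) * \<phi> p t)" by blast
qed

lemma powr_two_gap:
  assumes "1 \<le> c * 2 powr (- \<gamma> * real_of_int m)" "0 < \<gamma>" "0 < c"
  shows "m \<le> \<lceil>log 2 c / \<gamma>\<rceil>"
proof -
  have "2 powr (\<gamma> * real_of_int m) \<le> c" using assms(1) by (simp add: powr_minus field_simps)
  then have "\<gamma> * real_of_int m \<le> log 2 c" using assms(3) by (simp add: le_log_iff)
  then have "real_of_int m \<le> log 2 c / \<gamma>" using assms(2) by (simp add: field_simps)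
  then show ?thesis by linarith
qed

lemma abs_le_sym_int:
  assumes "\<And>k k' :: int. k \<le> k' \<Longrightarrow> \<sigma> k = \<sigma> k' \<Longrightarrow> k' - k \<le> N" "\<sigma> k = \<sigma> k'"
  shows "\<bar>k - k'\<bar> \<le> N"
proof (cases "k \<le> k'")
  case True
  show ?thesis using assms(1)[OF True assms(2)] True by linarith
next
  case False
  then have "k' \<le> k" by simp
  from assms(1)[OF this assms(2)[symmetric]] this show ?thesis by linarith
qed

text \<open>A function of positive index tends to 0 at 0 and to infinity at infinity, so its samples cross every level.\<close>
lemma regvar_dyad_crossing:
  assumes "regvar \<delta> \<rho>" "0 < \<delta>" and D: "0 < D"
  shows "\<exists>k. \<rho> (dyad k) \<le> D \<and> D < \<rho> (dyad (k + 1))"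
proof (rule ccontr)
  assume no_crossing: "\<not> (\<exists>k. \<rho> (dyad k) \<le> D \<and> D < \<rho> (dyad (k + 1)))"
  note pos = regvar_pos[OF assms(1) dyad_pos]
  obtain c \<gamma> where c: "0 < c" "0 < \<gamma>"
    "\<And>i k. k \<le> i \<Longrightarrow> \<rho> (dyad k) \<le> c * 2 powr (- \<gamma> * \<bar>real_of_int (k - i)\<bar>) * \<rho> (dyad i)"
    using regvar_dyad_tail_decay[OF assms(1,2)] by blast
  have gap: "i - k \<le> \<lceil>log 2 (c * y / x) / \<gamma>\<rceil>"
    if "k \<le> i" "0 < x" "x \<le> \<rho> (dyad k)" "\<rho> (dyad i) \<le> y" for i k x y
  proof (rule powr_two_gap)
    have y: "0 < y" using pos[of i] that by linarith
    show "0 < c * y / x" using c(1) y that by simp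
    have "x \<le> c * 2 powr (- \<gamma> * real_of_int (i - k)) * \<rho> (dyad i)"
    proof -
      have "\<bar>real_of_int (k - i)\<bar> = real_of_int (i - k)" using that(1) by simp
      then show ?thesis using order_trans[OF that(3) c(3)[OF that(1)]] by (simp only:)
    qed
    also have "\<dots> \<le> c * 2 powr (- \<gamma> * real_of_int (i - k)) * y"
      using c(1) that(4) by (intro mult_left_mono) auto
    finally show "1 \<le> c * y / x * 2 powr (- \<gamma> * real_of_int (i - k))"
      using that(2) by (simp add: field_simps)
  qed (rule c(2))
  have "\<exists>m. \<rho> (dyad m) \<le> D"
  proof (rule ccontr)
    assume "\<not> (\<exists>m. \<rho> (dyad m) \<le> D)"
    then have "D \<le> \<rho> (dyad m)" for m by (simp add: not_le less_imp_le)
    then have "0 - m \<le> \<lceil>log 2 (c * \<rho> (dyad 0) / D) / \<gamma>\<rceil>" if "m \<le> 0" for m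
      using gap[OF that D] by simp
    from this[of "- max 0 (\<lceil>log 2 (c * \<rho> (dyad 0) / D) / \<gamma>\<rceil> + 1)"] show False by simp
  qed
  then obtain m where m: "\<rho> (dyad m) \<le> D" ..
  have le: "\<rho> (dyad n) \<le> D" if "m \<le> n" for n
    using that
  proof (induction n rule: int_ge_induct)
    case base
    show ?case by (rule m)
  next
    case (step n)
    then show ?case using no_crossing by (auto simp: not_less)
  qed
  have "n - m \<le> \<lceil>log 2 (c * D / \<rho> (dyad m)) / \<gamma>\<rceil>" if "m \<le> n" for n
    using gap[OF that pos order_refl le[OF that]] .
  from this[of "m + max 0 (\<lceil>log 2 (c * D / \<rho> (dyad m)) / \<gamma>\<rceil> + 1)"] show False by simp
qed

text \<open>The samples of \<open>\<rho>\<close> at powers of 2 grow at least geometrically, up to a constant, and have bounded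
  ratios. So they meet each dyadic interval boundedly often, and each power of 2 is within a bounded factor of one of
  them. Both index maps have bounded fibres.\<close>
lemma snorm_change_variable:
  assumes "0 < q" "regvar \<delta> \<rho>" "0 < \<delta>" "comparable P G"
  shows "dominated P (\<lambda>p. snorm q (\<lambda>k. G p (\<rho> (dyad k)))) (\<lambda>p. snorm q (\<lambda>j. G p (dyad j)))"
    and "dominated P (\<lambda>p. snorm q (\<lambda>j. G p (dyad j))) (\<lambda>p. snorm q (\<lambda>k. G p (\<rho> (dyad k))))"
proof -
  note pos = regvar_pos[OF assms(2) dyad_pos]
  obtain c \<gamma> where c: "0 < c" "0 < \<gamma>"
    "\<And>i k. k \<le> i \<Longrightarrow> \<rho> (dyad k) \<le> c * 2 powr (- \<gamma> * \<bar>real_of_int (k - i)\<bar>) * \<rho> (dyad i)"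
    using regvar_dyad_tail_decay[OF assms(2,3)] by blast
  obtain M where M: "0 < M" "\<And>k. \<rho> (dyad k) \<le> M * \<rho> (dyad (k + 1))" "\<And>k. \<rho> (dyad (k + 1)) \<le> M * \<rho> (dyad k)"
    using regvar_dyad_step[OF assms(2)] by blast
  have comp: "dominated (P \<times> UNIV) (\<lambda>(p, k). G p (f k)) (\<lambda>(p, k). G p (g k))"
    if "\<And>k. 0 < f k \<and> 0 < g k \<and> f k \<le> L * g k \<and> g k \<le> L * f k" "1 \<le> L" for f g :: "int \<Rightarrow> real" and L
  proof -
    obtain C :: real where C: "\<forall>p\<in>P. \<forall>s t. 0 < s \<and> 0 < t \<and> s \<le> L * t \<and> t \<le> L * s \<longrightarrow> G p s \<le> ennreal C * G p t"
      using assms(4) \<open>1 \<le> L\<close> unfolding comparable_def by blast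
    show ?thesis by (rule dominatedI[where C = C]) (use C that(1) in auto)
  qed

  have "\<exists>j. \<rho> (dyad k) \<in> block j" for k
  proof -
    obtain j where "dyad j \<le> \<rho> (dyad k)" "\<rho> (dyad k) < dyad (j + 1)" using ex_dyad_block[OF pos[of k]] .
    then show ?thesis by (intro exI[of _ j]) simp
  qed
  then have "\<exists>\<sigma>. \<forall>k. \<rho> (dyad k) \<in> block (\<sigma> k)" by (intro choice allI)
  then obtain \<sigma> where \<sigma>: "\<And>k. \<rho> (dyad k) \<in> block (\<sigma> k)" by blast
  have gap: "k' - k \<le> \<lceil>log 2 (2 * c) / \<gamma>\<rceil>" if "k \<le> k'" "\<sigma> k = \<sigma> k'" for k k'
  proof (rule powr_two_gap)
    have "\<rho> (dyad k') \<le> 2 * dyad (\<sigma> k)" using \<sigma>[of k'] that(2) by (simp add: dyad_add mult.commute)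
    also have "\<dots> \<le> 2 * \<rho> (dyad k)" using \<sigma>[of k] by simp
    also have "\<dots> \<le> 2 * (c * 2 powr (- \<gamma> * real_of_int (k' - k)) * \<rho> (dyad k'))"
    proof -
      have "\<bar>real_of_int (k - k')\<bar> = real_of_int (k' - k)" using that(1) by simp
      then show ?thesis using c(3)[OF that(1)] by (simp only: mult_le_cancel_left_pos zero_less_numeral)
    qed
    finally show "1 \<le> 2 * c * 2 powr (- \<gamma> * real_of_int (k' - k))"
      using pos[of k'] by (simp add: mult.assoc[symmetric])
  qed (use c in auto)
  have fin: "finite {k. \<sigma> k = j} \<and> card {k. \<sigma> k = j} \<le> nat (2 * \<lceil>log 2 (2 * c) / \<gamma>\<rceil> + 1)" for j
    by (rule fibre_card, rule abs_le_sym_int[of \<sigma>], rule gap)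
  show "dominated P (\<lambda>p. snorm q (\<lambda>k. G p (\<rho> (dyad k)))) (\<lambda>p. snorm q (\<lambda>j. G p (dyad j)))"
  proof (rule dominated_snorm_map[OF assms(1) fin])
    show "dominated (P \<times> UNIV) (\<lambda>(p, k). G p (\<rho> (dyad k))) (\<lambda>(p, k). G p (dyad (\<sigma> k)))"
    proof (rule comp[of _ _ 2])
      fix k
      show "0 < \<rho> (dyad k) \<and> 0 < dyad (\<sigma> k) \<and> \<rho> (dyad k) \<le> 2 * dyad (\<sigma> k) \<and> dyad (\<sigma> k) \<le> 2 * \<rho> (dyad k)"
        using \<sigma>[of k] pos[of k] by (auto simp: dyad_add mult.commute)
    qed simp
  qed

  have "\<exists>k. \<rho> (dyad k) \<le> dyad j \<and> dyad j < \<rho> (dyad (k + 1))" for j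
    using regvar_dyad_crossing[OF assms(2,3) dyad_pos] .
  then have "\<exists>\<tau>. \<forall>j. \<rho> (dyad (\<tau> j)) \<le> dyad j \<and> dyad j < \<rho> (dyad (\<tau> j + 1))" by (intro choice allI)
  then obtain \<tau> where \<tau>: "\<And>j. \<rho> (dyad (\<tau> j)) \<le> dyad j \<and> dyad j < \<rho> (dyad (\<tau> j + 1))" by blast
  have \<tau>M: "dyad j \<le> M * \<rho> (dyad (\<tau> j))" for j using \<tau>[of j] M(3)[of "\<tau> j"] by linarith
  have gap: "k' - k \<le> \<lceil>log 2 M / 1\<rceil>" if "k \<le> k'" "\<tau> k = \<tau> k'" for k k'
  proof (rule powr_two_gap)
    have "dyad k' \<le> M * \<rho> (dyad (\<tau> k))" using \<tau>M[of k'] that by simp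
    also have "\<dots> \<le> M * dyad k" using \<tau>[of k] M(1) by simp
    finally show "1 \<le> M * 2 powr (- 1 * real_of_int (k' - k))"
      by (simp add: dyad_def powr_diff powr_minus field_simps)
  qed (use M in auto)
  have fin: "finite {k. \<tau> k = j} \<and> card {k. \<tau> k = j} \<le> nat (2 * \<lceil>log 2 M / 1\<rceil> + 1)" for j
    by (rule fibre_card, rule abs_le_sym_int[of \<tau>], rule gap)
  show "dominated P (\<lambda>p. snorm q (\<lambda>j. G p (dyad j))) (\<lambda>p. snorm q (\<lambda>k. G p (\<rho> (dyad k))))"
  proof (rule dominated_snorm_map[OF assms(1) fin])
    show "dominated (P \<times> UNIV) (\<lambda>(p, j). G p (dyad j)) (\<lambda>(p, j). G p (\<rho> (dyad (\<tau> j))))"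
    proof (rule comp[of _ _ "max 1 M"])
      fix j
      have "M * \<rho> (dyad (\<tau> j)) \<le> max 1 M * \<rho> (dyad (\<tau> j))" "1 * dyad j \<le> max 1 M * dyad j"
        using pos[of "\<tau> j"] by (intro mult_right_mono; simp)+
      then show "0 < dyad j \<and> 0 < \<rho> (dyad (\<tau> j)) \<and> dyad j \<le> max 1 M * \<rho> (dyad (\<tau> j)) \<and> \<rho> (dyad (\<tau> j)) \<le> max 1 M * dyad j"
        using \<tau>[of j] \<tau>M[of j] pos[of "\<tau> j"] by (intro conjI) (simp, simp, linarith, linarith)
    qed simp
  qed
qed

section \<open>Holmstedt estimates for sequences\<close>

lemma dominated_mult_const_right: "dominated P (\<lambda>p. A p) (\<lambda>p. B p) \<Longrightarrow> dominated P (\<lambda>p. A p * D p) (\<lambda>p. B p * D p)"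
  by (rule dominated_mult) auto

text \<open>The weights that occur after discretization. Here \<open>\<xi>\<close> stands for \<open>\<chi>\<^sub>1\<close>, \<open>v\<close> for \<open>t\<^bsup>-\<theta>\<^sub>0\<^esup> b\<^sub>0(t)\<close>, and \<open>\<rho>\<close> is
  determined at the powers of 2 by \<open>\<rho> \<xi> = t v\<close>.\<close>
locale sequence_weights =
  fixes q r r0 :: ennreal and a b v \<xi> \<beta> \<rho> :: "real \<Rightarrow> real" and \<theta>0 :: real
  assumes q: "0 < q" and r: "0 < r" and r0: "0 < r0" and \<theta>0: "0 < \<theta>0" "\<theta>0 < 1"
    and a: "regvar 0 a" and b: "regvar 0 b" and \<xi>: "regvar 0 \<xi>" and \<beta>: "regvar 0 \<beta>"
    and v: "regvar (- \<theta>0) v" and \<rho>: "regvar (1 - \<theta>0) \<rho>"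
    and \<rho>_\<xi>: "\<And>k. \<rho> (dyad k) * \<xi> (dyad k) = dyad k * v (dyad k)"
    and X_le_\<xi>: "dominated UNIV (\<lambda>k. snorm_on r {..k} (\<lambda>j. ennreal (b (dyad j)) * snorm_on q {j..k} (\<lambda>i. ennreal (a (dyad i)))))
      (\<lambda>k. ennreal (\<xi> (dyad k)))"
    and \<xi>_le_X: "dominated UNIV (\<lambda>k. ennreal (\<xi> (dyad k)))
      (\<lambda>k. snorm_on r {..k} (\<lambda>j. ennreal (b (dyad j)) * snorm_on q {j..k} (\<lambda>i. ennreal (a (dyad i)))))"
    and B_le_\<beta>: "dominated UNIV (\<lambda>k. snorm_on r {..k} (\<lambda>j. ennreal (b (dyad j)))) (\<lambda>k. ennreal (\<beta> (dyad k)))"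
    and \<beta>_le_B: "dominated UNIV (\<lambda>k. ennreal (\<beta> (dyad k))) (\<lambda>k. snorm_on r {..k} (\<lambda>j. ennreal (b (dyad j))))"
begin

abbreviation "ak k \<equiv> ennreal (a (dyad k))"
abbreviation "bk k \<equiv> ennreal (b (dyad k))"
abbreviation "vk k \<equiv> ennreal (v (dyad k))"
abbreviation "\<xi>k k \<equiv> ennreal (\<xi> (dyad k))"
abbreviation "\<beta>k k \<equiv> ennreal (\<beta> (dyad k))"
abbreviation "\<rho>k k \<equiv> ennreal (\<rho> (dyad k))"

definition head_norm :: "(int \<Rightarrow> ennreal) \<Rightarrow> int \<Rightarrow> ennreal" where
  "head_norm \<kappa> k = snorm_on r0 {..k} (\<lambda>i. vk i * \<kappa> i)"
definition tail_norm :: "(int \<Rightarrow> ennreal) \<Rightarrow> int \<Rightarrow> ennreal" where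
  "tail_norm \<kappa> k = snorm_on q {k..} (\<lambda>i. wt 1 a i * \<kappa> i)"
definition tail_tail_norm :: "(int \<Rightarrow> ennreal) \<Rightarrow> int \<Rightarrow> ennreal" where
  "tail_tail_norm \<kappa> k = snorm_on r {k..} (\<lambda>i. bk i * tail_norm \<kappa> i)"
definition norm0 :: "(int \<Rightarrow> ennreal) \<Rightarrow> ennreal" where
  "norm0 \<kappa> = snorm r0 (\<lambda>i. vk i * \<kappa> i)"
definition norm1 :: "(int \<Rightarrow> ennreal) \<Rightarrow> ennreal" where
  "norm1 \<kappa> = snorm r (\<lambda>i. bk i * tail_norm \<kappa> i)"
definition holmstedt :: "(int \<Rightarrow> ennreal) \<Rightarrow> int \<Rightarrow> ennreal" where
  "holmstedt \<kappa> k = head_norm \<kappa> k + \<rho>k k * (\<beta>k k * tail_norm \<kappa> k + tail_tail_norm \<kappa> k)"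

lemmas pos = regvar_pos[OF a dyad_pos] regvar_pos[OF b dyad_pos] regvar_pos[OF \<xi> dyad_pos]
  regvar_pos[OF \<beta> dyad_pos] regvar_pos[OF v dyad_pos] regvar_pos[OF \<rho> dyad_pos]

lemmas nonneg = pos[THEN less_imp_le]

lemma tail_norm_decreasing: "j \<le> k \<Longrightarrow> tail_norm \<kappa> k \<le> tail_norm \<kappa> j"
  unfolding tail_norm_def by (intro snorm_on_mono q) auto

lemma b_le_\<beta>: "dominated UNIV bk \<beta>k"
  by (rule dominated_trans[OF dominated_le B_le_\<beta>]) (rule snorm_on_point[OF r], simp)

text \<open>In the double norm that defines \<open>\<chi>\<^sub>1\<close> the inner norm over \<open>[j, k]\<close> is at least its last term.\<close>
lemma \<beta>_a_le_\<xi>: "dominated UNIV (\<lambda>k. \<beta>k k * ak k) \<xi>k"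
proof -
  have "dominated UNIV (\<lambda>k. \<beta>k k * ak k) (\<lambda>k. snorm_on r {..k} bk * ak k)"
    by (rule dominated_mult_const_right[OF \<beta>_le_B])
  also have "dominated UNIV \<dots> (\<lambda>k. snorm_on r {..k} (\<lambda>j. bk j * snorm_on q {j..k} ak))"
  proof (rule dominated_le)
    fix k
    have "snorm_on r {..k} bk * ak k = snorm_on r {..k} (\<lambda>j. ak k * bk j)"
      by (simp add: snorm_on_cmult r mult.commute)
    also have "\<dots> \<le> snorm_on r {..k} (\<lambda>j. bk j * snorm_on q {j..k} ak)"
    proof (intro snorm_on_mono r conjI)
      fix j assume "j \<in> {..k}"
      then have "ak k \<le> snorm_on q {j..k} ak" by (intro snorm_on_point q) auto
      then show "ak k * bk j \<le> bk j * snorm_on q {j..k} ak"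
        by (subst mult.commute) (rule mult_left_mono, simp_all)
    qed auto
    finally show "snorm_on r {..k} bk * ak k \<le> snorm_on r {..k} (\<lambda>j. bk j * snorm_on q {j..k} ak)" .
  qed
  also note X_le_\<xi>
  finally show ?thesis .
qed

lemma b_a_le_\<xi>: "dominated UNIV (\<lambda>k. bk k * ak k) \<xi>k"
  by (rule dominated_trans[OF dominated_mult_const_right[OF b_le_\<beta>] \<beta>_a_le_\<xi>])

lemma \<rho>_wt: "\<rho>k k * (wt 1 a k * x) = vk k * ((ak k * x) * ennreal (1 / \<xi> (dyad k)))"
proof -
  have "\<rho> (dyad k) * (dyad k powr - 1 * a (dyad k)) = v (dyad k) * (a (dyad k) * (1 / \<xi> (dyad k)))"
    using \<rho>_\<xi>[of k] pos(3)[of k] by (simp add: powr_minus field_simps)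
  then have "\<rho>k k * wt 1 a k = vk k * (ak k * ennreal (1 / \<xi> (dyad k)))"
    using nonneg[of k] by (simp only: ennreal_mult[symmetric] dyad_nonneg powr_ge_zero mult_nonneg_nonneg zero_le_divide_1_iff)
  then show ?thesis by (metis mult.assoc mult.commute)
qed

lemma inverse_\<xi>: "\<xi>k k * ennreal (1 / \<xi> (dyad k)) = 1"
  using pos(3)[of k] by (simp flip: ennreal_mult)

text \<open>By the choice of \<open>\<rho>\<close>, the product \<open>\<rho> u\<^bsup>-1\<^esup> a\<close> is \<open>v a / \<chi>\<^sub>1\<close>. Thus a factor \<open>g\<close> with \<open>g a \<lesssim> \<chi>\<^sub>1\<close> turns the weight of the
  second space into that of the first.\<close>
lemma dominated_\<rho>_wt:
  assumes "dominated UNIV (\<lambda>k. g k * ak k) \<xi>k"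
  shows "dominated (P \<times> UNIV) (\<lambda>z. g (snd z) * (\<rho>k (snd z) * (wt 1 a (snd z) * x (fst z) (snd z)))) (\<lambda>z. vk (snd z) * x (fst z) (snd z))"
proof -
  have "dominated (P \<times> UNIV) (\<lambda>z. g (snd z) * (\<rho>k (snd z) * (wt 1 a (snd z) * x (fst z) (snd z))))
    (\<lambda>z. (g (snd z) * ak (snd z)) * (ennreal (1 / \<xi> (dyad (snd z))) * vk (snd z) * x (fst z) (snd z)))"
    unfolding \<rho>_wt by (rule dominated_le) (simp only: mult_ac order_refl)
  also have "dominated (P \<times> UNIV) \<dots> (\<lambda>z. \<xi>k (snd z) * (ennreal (1 / \<xi> (dyad (snd z))) * vk (snd z) * x (fst z) (snd z)))"
    by (intro dominated_mult_const_right dominated_comp[OF assms]) simp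
  also have "dominated (P \<times> UNIV) \<dots> (\<lambda>z. vk (snd z) * x (fst z) (snd z))"
    by (rule dominated_le) (simp only: mult.assoc[symmetric] inverse_\<xi> mult_1 order_refl)
  finally show ?thesis .
qed

text \<open>Each term \<open>\<kappa> i\<close> is at most the first norm divided by \<open>v\<close>, and after this substitution all tails are
  geometric because \<open>\<theta>\<^sub>0 < 1\<close>. What remains is \<open>\<rho> (\<beta> + b) a / (t v)\<close>, which is \<open>(\<beta> + b) a / \<chi>\<^sub>1\<close> and hence
  bounded.\<close>
lemma holmstedt_le_norm0: "dominated (UNIV \<times> UNIV) (\<lambda>z. holmstedt (fst z) (snd z)) (\<lambda>z. norm0 (fst z))"
proof -
  (* The weight of the tail norm divided by that of the first norm. *)
  define g where "g u = (u powr (- 1) * a u) * (1 / v u)" for u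
  have "regvar ((- 1 + 0) + - (- \<theta>0)) g" unfolding g_def
    by (intro regvar_mult regvar_inverse regvar_powr_id a v)
  then have g: "regvar (\<theta>0 - 1) g" by (simp add: algebra_simps)
  then have "regvar (0 + (\<theta>0 - 1)) (\<lambda>u. b u * g u)" by (intro regvar_mult b)
  then have bg: "regvar (\<theta>0 - 1) (\<lambda>u. b u * g u)" by simp
  have gv: "wt 1 a i * x = ennreal (g (dyad i)) * (vk i * x)" for i x
  proof -
    have "dyad i powr - 1 * a (dyad i) = g (dyad i) * v (dyad i)" using pos(5)[of i] by (simp add: g_def)
    then show ?thesis using regvar_pos[OF g dyad_pos, of i] nonneg[of i]
      by (simp add: ennreal_mult mult.assoc)
  qed
  have \<rho>g: "\<rho>k k * ennreal (g (dyad k)) = ak k * ennreal (1 / \<xi> (dyad k))" for k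
  proof -
    have "\<rho> (dyad k) * g (dyad k) = a (dyad k) * (1 / \<xi> (dyad k))"
      using \<rho>_\<xi>[of k] pos(3,5)[of k] by (simp add: g_def powr_minus field_simps)
    then show ?thesis using nonneg[of k] regvar_pos[OF g dyad_pos, of k]
      by (simp only: ennreal_mult[symmetric] less_imp_le zero_le_divide_1_iff)
  qed
  let ?P = "(UNIV :: (int \<Rightarrow> ennreal) set) \<times> (UNIV :: int set)"
  have R_le: "dominated ?P (\<lambda>z. tail_norm (fst z) (snd z)) (\<lambda>z. ennreal (g (dyad (snd z))) * norm0 (fst z))"
  proof -
    have "dominated ?P (\<lambda>z. tail_norm (fst z) (snd z)) (\<lambda>z. snorm_on q {snd z..} (\<lambda>i. ennreal (g (dyad i))) * norm0 (fst z))"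
    proof (rule dominated_le)
      fix z :: "(int \<Rightarrow> ennreal) \<times> int"
      have "tail_norm (fst z) (snd z) \<le> snorm_on q {snd z..} (\<lambda>i. norm0 (fst z) * ennreal (g (dyad i)))"
        unfolding tail_norm_def norm0_def gv
        by (intro snorm_on_mono q conjI, assumption, subst mult.commute)
           (intro mult_right_mono snorm_point[OF r0], simp)
      then show "tail_norm (fst z) (snd z) \<le> snorm_on q {snd z..} (\<lambda>i. ennreal (g (dyad i))) * norm0 (fst z)"
        unfolding snorm_on_cmult[OF q] by (simp only: mult.commute)
    qed
    also have "dominated ?P \<dots> (\<lambda>z. ennreal (g (dyad (snd z))) * norm0 (fst z))"
      by (intro dominated_mult_const_right dominated_comp[OF dominated_geometric_tail[OF q g]]) (use \<theta>0 in auto)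
    finally show ?thesis .
  qed
  have RR_le: "dominated ?P (\<lambda>z. tail_tail_norm (fst z) (snd z)) (\<lambda>z. (bk (snd z) * ennreal (g (dyad (snd z)))) * norm0 (fst z))"
  proof -
    have "dominated ?P (\<lambda>z. tail_tail_norm (fst z) (snd z)) (\<lambda>z. snorm_on r {snd z..} (\<lambda>i. norm0 (fst z) * ennreal (b (dyad i) * g (dyad i))))"
      unfolding tail_tail_norm_def
    proof (rule dominated_snorm_on'[OF r])
      have "dominated {z. fst z \<in> ?P \<and> snd z \<in> {snd (fst z)..}} (\<lambda>z. bk (snd z) * tail_norm (fst (fst z)) (snd z))
        (\<lambda>z. bk (snd z) * (ennreal (g (dyad (snd z))) * norm0 (fst (fst z))))"
        using dominated_comp[OF R_le, of _ "\<lambda>z. (fst (fst z), snd z)"] by (intro dominated_mult_left) simp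
      then show "dominated {z. fst z \<in> ?P \<and> snd z \<in> {snd (fst z)..}} (\<lambda>z. bk (snd z) * tail_norm (fst (fst z)) (snd z))
        (\<lambda>z. norm0 (fst (fst z)) * ennreal (b (dyad (snd z)) * g (dyad (snd z))))"
        using nonneg(2) regvar_pos[OF g dyad_pos] by (simp add: ennreal_mult' mult_ac less_imp_le)
    qed
    also have "dominated ?P \<dots> (\<lambda>z. norm0 (fst z) * ennreal (b (dyad (snd z)) * g (dyad (snd z))))"
      unfolding snorm_on_cmult[OF r]
      by (intro dominated_mult_left dominated_comp[OF dominated_geometric_tail[OF r bg]]) (use \<theta>0 in auto)
    finally show ?thesis using nonneg(2) by (simp add: ennreal_mult' mult_ac)
  qed
  have "dominated ?P (\<lambda>z. \<rho>k (snd z) * (\<beta>k (snd z) * tail_norm (fst z) (snd z) + tail_tail_norm (fst z) (snd z)))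
    (\<lambda>z. \<rho>k (snd z) * (\<beta>k (snd z) * (ennreal (g (dyad (snd z))) * norm0 (fst z)) + (bk (snd z) * ennreal (g (dyad (snd z)))) * norm0 (fst z)))"
    by (intro dominated_mult_left dominated_add R_le RR_le)
  also have "dominated ?P \<dots> (\<lambda>z. (\<beta>k (snd z) * ak (snd z) + bk (snd z) * ak (snd z)) * (ennreal (1 / \<xi> (dyad (snd z))) * norm0 (fst z)))"
  proof (rule dominated_le)
    fix z :: "(int \<Rightarrow> ennreal) \<times> int"
    show "\<rho>k (snd z) * (\<beta>k (snd z) * (ennreal (g (dyad (snd z))) * norm0 (fst z)) + (bk (snd z) * ennreal (g (dyad (snd z)))) * norm0 (fst z))
      \<le> (\<beta>k (snd z) * ak (snd z) + bk (snd z) * ak (snd z)) * (ennreal (1 / \<xi> (dyad (snd z))) * norm0 (fst z))" (is "?l \<le> ?r")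
    proof -
      have "?l = (\<beta>k (snd z) + bk (snd z)) * ((\<rho>k (snd z) * ennreal (g (dyad (snd z)))) * norm0 (fst z))"
        by (simp only: distrib_left distrib_right mult_ac)
      also have "\<dots> = ?r" unfolding \<rho>g by (simp only: distrib_left distrib_right mult_ac)
      finally show ?thesis by simp
    qed
  qed
  also have "dominated ?P \<dots> (\<lambda>z. \<xi>k (snd z) * (ennreal (1 / \<xi> (dyad (snd z))) * norm0 (fst z)))"
    by (intro dominated_mult_const_right dominated_add_least dominated_comp[OF \<beta>_a_le_\<xi>] dominated_comp[OF b_a_le_\<xi>]) auto
  also have "dominated ?P \<dots> (\<lambda>z. norm0 (fst z))"
    by (rule dominated_le) (simp only: mult.assoc[symmetric] inverse_\<xi> mult_1 order_refl)
  finally have "dominated ?P (\<lambda>z. \<rho>k (snd z) * (\<beta>k (snd z) * tail_norm (fst z) (snd z) + tail_tail_norm (fst z) (snd z))) (\<lambda>z. norm0 (fst z))" .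
  then show ?thesis unfolding holmstedt_def
    by (intro dominated_add_least) (auto simp: head_norm_def norm0_def intro!: dominated_le snorm_on_le_snorm r0)
qed

text \<open>The sequences of values of a quasiconcave function at powers of 2.\<close>
definition quasiconcave_seqs :: "(int \<Rightarrow> ennreal) set" where
  "quasiconcave_seqs = {\<kappa>. \<forall>i k. i \<le> k \<longrightarrow> \<kappa> i \<le> \<kappa> k \<and> \<kappa> k \<le> ennreal (dyad k / dyad i) * \<kappa> i}"

text \<open>For \<open>i \<le> k\<close> quasiconcavity gives \<open>\<kappa> k / 2\<^sup>k \<le> \<kappa> i / 2\<^sup>i\<close>. Hence the part of the second norm over \<open>j \<le> i \<le> k\<close> is at
  least \<open>\<chi>\<^sub>1\<close> times \<open>\<kappa> k / 2\<^sup>k\<close>.\<close>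
lemma term_le_norm1: "dominated (quasiconcave_seqs \<times> UNIV) (\<lambda>z. \<xi>k (snd z) * fst z (snd z)) (\<lambda>z. ennreal (dyad (snd z)) * norm1 (fst z))"
proof -
  have "dominated (quasiconcave_seqs \<times> UNIV) (\<lambda>z. \<xi>k (snd z) * fst z (snd z))
    (\<lambda>z. snorm_on r {..snd z} (\<lambda>j. bk j * snorm_on q {j..snd z} ak) * fst z (snd z))"
    by (intro dominated_mult_const_right dominated_comp[OF \<xi>_le_X]) simp
  also have "dominated (quasiconcave_seqs \<times> UNIV) \<dots> (\<lambda>z. ennreal (dyad (snd z)) * norm1 (fst z))"
  proof (rule dominated_le, clarify, unfold fst_conv snd_conv)
    fix \<kappa> :: "int \<Rightarrow> ennreal" and k :: int assume \<kappa>: "\<kappa> \<in> quasiconcave_seqs"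
    have R: "\<kappa> k * snorm_on q {j..k} ak \<le> ennreal (dyad k) * tail_norm \<kappa> j" for j
    proof -
      have "\<kappa> k * snorm_on q {j..k} ak = snorm_on q {j..k} (\<lambda>i. \<kappa> k * ak i)"
        by (simp add: snorm_on_cmult q)
      also have "\<dots> \<le> snorm_on q {j..} (\<lambda>i. ennreal (dyad k) * (wt 1 a i * \<kappa> i))"
      proof (intro snorm_on_mono q conjI)
        fix i assume "i \<in> {j..k}"
        then have "\<kappa> k \<le> ennreal (dyad k / dyad i) * \<kappa> i" using \<kappa> by (auto simp: quasiconcave_seqs_def)
        then have "\<kappa> k * ak i \<le> (ennreal (dyad k / dyad i) * \<kappa> i) * ak i" by (rule mult_right_mono) simp
        also have "\<dots> = (ennreal (dyad k / dyad i) * ak i) * \<kappa> i" by (simp only: mult_ac)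
        also have "ennreal (dyad k / dyad i) * ak i = ennreal (dyad k) * wt 1 a i"
          using nonneg[of i] by (simp add: powr_minus divide_inverse mult_ac flip: ennreal_mult)
        finally show "\<kappa> k * ak i \<le> ennreal (dyad k) * (wt 1 a i * \<kappa> i)" by (simp only: mult.assoc)
      qed auto
      finally show ?thesis by (simp add: snorm_on_cmult q tail_norm_def)
    qed
    have "snorm_on r {..k} (\<lambda>j. bk j * snorm_on q {j..k} ak) * \<kappa> k
        = snorm_on r {..k} (\<lambda>j. \<kappa> k * (bk j * snorm_on q {j..k} ak))"
      by (simp add: snorm_on_cmult r mult.commute)
    also have "\<dots> \<le> snorm_on r UNIV (\<lambda>j. ennreal (dyad k) * (bk j * tail_norm \<kappa> j))"
    proof (intro snorm_on_mono r conjI)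
      fix j
      have "bk j * (\<kappa> k * snorm_on q {j..k} ak) \<le> bk j * (ennreal (dyad k) * tail_norm \<kappa> j)"
        by (intro mult_left_mono R) simp
      then show "\<kappa> k * (bk j * snorm_on q {j..k} ak) \<le> ennreal (dyad k) * (bk j * tail_norm \<kappa> j)"
        by (simp only: mult_ac)
    qed auto
    finally show "snorm_on r {..k} (\<lambda>j. bk j * snorm_on q {j..k} ak) * \<kappa> k \<le> ennreal (dyad k) * norm1 \<kappa>"
      by (simp add: snorm_cmult r norm1_def)
  qed
  finally show ?thesis .
qed

lemma vk_eq: "vk k * ennreal (dyad k) = \<rho>k k * \<xi>k k"
  using \<rho>_\<xi>[of k] nonneg[of k] by (simp add: mult.commute flip: ennreal_mult)

lemma term_le_\<rho>_norm1: "dominated (quasiconcave_seqs \<times> UNIV) (\<lambda>z. vk (snd z) * fst z (snd z)) (\<lambda>z. \<rho>k (snd z) * norm1 (fst z))"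
proof -
  have inv: "ennreal (1 / dyad k) * ennreal (dyad k) = 1" for k by (simp flip: ennreal_mult)
  have "dominated (quasiconcave_seqs \<times> UNIV) (\<lambda>z. vk (snd z) * fst z (snd z))
      (\<lambda>z. (ennreal (1 / dyad (snd z)) * \<rho>k (snd z)) * (\<xi>k (snd z) * fst z (snd z)))"
  proof (rule dominated_le)
    fix z :: "(int \<Rightarrow> ennreal) \<times> int"
    have "vk (snd z) = ennreal (1 / dyad (snd z)) * (vk (snd z) * ennreal (dyad (snd z)))"
      using inv[of "snd z"] by (metis mult.commute mult.left_commute mult_1)
    then have "vk (snd z) = ennreal (1 / dyad (snd z)) * (\<rho>k (snd z) * \<xi>k (snd z))" unfolding vk_eq .
    then have "vk (snd z) * fst z (snd z) = ennreal (1 / dyad (snd z)) * (\<rho>k (snd z) * \<xi>k (snd z)) * fst z (snd z)"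
      by (rule arg_cong)
    then show "vk (snd z) * fst z (snd z) \<le> (ennreal (1 / dyad (snd z)) * \<rho>k (snd z)) * (\<xi>k (snd z) * fst z (snd z))"
      by (simp only: mult.assoc order_refl)
  qed
  also have "dominated (quasiconcave_seqs \<times> UNIV) \<dots> (\<lambda>z. (ennreal (1 / dyad (snd z)) * \<rho>k (snd z)) * (ennreal (dyad (snd z)) * norm1 (fst z)))"
    by (rule dominated_mult_left[OF term_le_norm1])
  also have "dominated (quasiconcave_seqs \<times> UNIV) \<dots> (\<lambda>z. \<rho>k (snd z) * norm1 (fst z))"
  proof (rule dominated_le)
    fix z :: "(int \<Rightarrow> ennreal) \<times> int"
    have "(ennreal (1 / dyad (snd z)) * \<rho>k (snd z)) * (ennreal (dyad (snd z)) * norm1 (fst z))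
      = (ennreal (1 / dyad (snd z)) * ennreal (dyad (snd z))) * (\<rho>k (snd z) * norm1 (fst z))" by (simp only: mult_ac)
    then show "(ennreal (1 / dyad (snd z)) * \<rho>k (snd z)) * (ennreal (dyad (snd z)) * norm1 (fst z)) \<le> \<rho>k (snd z) * norm1 (fst z)"
      unfolding inv by simp
  qed
  finally show ?thesis .
qed

text \<open>The terms of the head norm are at most \<open>\<rho>\<close> times the second norm, and \<open>\<rho>\<close> has positive index, so their sum is
  geometric. The other two terms are restrictions of the second norm, since the tail
  norm decreases.\<close>
lemma holmstedt_le_norm1: "dominated (quasiconcave_seqs \<times> UNIV) (\<lambda>z. holmstedt (fst z) (snd z)) (\<lambda>z. \<rho>k (snd z) * norm1 (fst z))"
proof -
  let ?P = "quasiconcave_seqs \<times> (UNIV :: int set)"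
  have 1: "dominated ?P (\<lambda>z. head_norm (fst z) (snd z)) (\<lambda>z. \<rho>k (snd z) * norm1 (fst z))"
  proof -
    have "dominated ?P (\<lambda>z. head_norm (fst z) (snd z)) (\<lambda>z. snorm_on r0 {..snd z} (\<lambda>i. norm1 (fst z) * \<rho>k i))"
      unfolding head_norm_def
    proof (rule dominated_snorm_on'[OF r0])
      have "dominated {z. fst z \<in> ?P \<and> snd z \<in> {..snd (fst z)}} (\<lambda>z. vk (snd (fst (fst z), snd z)) * fst (fst (fst z), snd z) (snd (fst (fst z), snd z)))
        (\<lambda>z. \<rho>k (snd (fst (fst z), snd z)) * norm1 (fst (fst (fst z), snd z)))"
        by (rule dominated_comp[OF term_le_\<rho>_norm1]) auto
      then show "dominated {z. fst z \<in> ?P \<and> snd z \<in> {..snd (fst z)}} (\<lambda>z. vk (snd z) * fst (fst z) (snd z))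
        (\<lambda>z. norm1 (fst (fst z)) * \<rho>k (snd z))" unfolding fst_conv snd_conv by (simp only: mult.commute)
    qed
    also have "dominated ?P \<dots> (\<lambda>z. norm1 (fst z) * \<rho>k (snd z))"
      unfolding snorm_on_cmult[OF r0]
      by (intro dominated_mult_left dominated_comp[OF dominated_geometric_head[OF r0 \<rho>]]) (use \<theta>0 in auto)
    finally show ?thesis by (simp only: mult.commute)
  qed
  have 2: "dominated ?P (\<lambda>z. \<beta>k (snd z) * tail_norm (fst z) (snd z)) (\<lambda>z. norm1 (fst z))"
  proof -
    have "dominated ?P (\<lambda>z. \<beta>k (snd z) * tail_norm (fst z) (snd z)) (\<lambda>z. snorm_on r {..snd z} bk * tail_norm (fst z) (snd z))"
      by (intro dominated_mult_const_right dominated_comp[OF \<beta>_le_B]) simp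
    also have "dominated ?P \<dots> (\<lambda>z. norm1 (fst z))"
    proof (rule dominated_le)
      fix z :: "(int \<Rightarrow> ennreal) \<times> int"
      have "snorm_on r {..snd z} bk * tail_norm (fst z) (snd z) = snorm_on r {..snd z} (\<lambda>j. tail_norm (fst z) (snd z) * bk j)"
        unfolding snorm_on_cmult[OF r] by (simp only: mult.commute)
      also have "\<dots> \<le> snorm_on r UNIV (\<lambda>j. bk j * tail_norm (fst z) j)"
      proof (intro snorm_on_mono r conjI)
        fix j assume "j \<in> {..snd z}"
        then have "tail_norm (fst z) (snd z) * bk j \<le> tail_norm (fst z) j * bk j"
          by (intro mult_right_mono tail_norm_decreasing) auto
        then show "tail_norm (fst z) (snd z) * bk j \<le> bk j * tail_norm (fst z) j" by (simp only: mult.commute)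
      qed auto
      finally show "snorm_on r {..snd z} bk * tail_norm (fst z) (snd z) \<le> norm1 (fst z)" by (simp add: norm1_def)
    qed
    finally show ?thesis .
  qed
  have 3: "dominated ?P (\<lambda>z. tail_tail_norm (fst z) (snd z)) (\<lambda>z. norm1 (fst z))"
    unfolding tail_tail_norm_def norm1_def by (rule dominated_le) (rule snorm_on_le_snorm[OF r])
  show ?thesis unfolding holmstedt_def
    by (intro dominated_add_least dominated_mult_left 1 2 3)
qed

lemma term_le_head_norm: "vk k * \<kappa> k \<le> head_norm \<kappa> k"
  unfolding head_norm_def by (rule snorm_on_point[OF r0, of k _ "\<lambda>i. vk i * \<kappa> i"]) simp

lemma head_norm_le_holmstedt: "head_norm \<kappa> k \<le> holmstedt \<kappa> k"
  unfolding holmstedt_def by simp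

text \<open>The hypothesis describes the component in the first space of a decomposition that is nearly optimal at \<open>2\<^sup>k\<close>. The terms beyond \<open>k\<close>
  form a geometric tail dominated by the term with index \<open>k\<close>.\<close>
lemma norm0_le_holmstedt:
  "dominated {(\<kappa>', \<kappa>, k). (\<forall>i\<le>k. \<kappa>' i \<le> ennreal c * \<kappa> i) \<and> (\<forall>i\<ge>k. \<kappa>' i \<le> ennreal c * \<kappa> k)}
    (\<lambda>(\<kappa>', \<kappa>, k). norm0 \<kappa>') (\<lambda>(\<kappa>', \<kappa>, k). holmstedt \<kappa> k)" (is "dominated ?P _ _")
proof -
  have "dominated ?P (\<lambda>y. snorm_on r0 UNIV (\<lambda>i. vk i * fst y i))
    (\<lambda>y. snorm_on r0 {..snd (snd y)} (\<lambda>i. vk i * fst y i) + snorm_on r0 {snd (snd y)..} (\<lambda>i. vk i * fst y i))"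
    by (rule dominated_snorm_on_split[OF r0]) auto
  also have "dominated ?P \<dots> (\<lambda>y. ennreal c * head_norm (fst (snd y)) (snd (snd y)) +
      ennreal c * (fst (snd y) (snd (snd y)) * snorm_on r0 {snd (snd y)..} vk))"
  proof (intro dominated_add dominated_le)
    fix y assume y: "y \<in> ?P"
    show "snorm_on r0 {..snd (snd y)} (\<lambda>i. vk i * fst y i) \<le> ennreal c * head_norm (fst (snd y)) (snd (snd y))"
      unfolding head_norm_def snorm_on_cmult[OF r0, symmetric]
    proof (intro snorm_on_mono r0 conjI)
      fix i assume "i \<in> {..snd (snd y)}"
      then have "vk i * fst y i \<le> vk i * (ennreal c * fst (snd y) i)"
        using y by (intro mult_left_mono) auto
      then show "vk i * fst y i \<le> ennreal c * (vk i * fst (snd y) i)" by (simp only: mult_ac)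
    qed auto
    show "snorm_on r0 {snd (snd y)..} (\<lambda>i. vk i * fst y i) \<le> ennreal c * (fst (snd y) (snd (snd y)) * snorm_on r0 {snd (snd y)..} vk)"
      unfolding snorm_on_cmult[OF r0, symmetric]
    proof (intro snorm_on_mono r0 conjI)
      fix i assume "i \<in> {snd (snd y)..}"
      then have "vk i * fst y i \<le> vk i * (ennreal c * fst (snd y) (snd (snd y)))"
        using y by (intro mult_left_mono) auto
      then show "vk i * fst y i \<le> ennreal c * (fst (snd y) (snd (snd y)) * vk i)" by (simp only: mult_ac)
    qed auto
  qed
  also have "dominated ?P \<dots> (\<lambda>y. holmstedt (fst (snd y)) (snd (snd y)))"
  proof (intro dominated_add_least)
    have J: "dominated ?P (\<lambda>y. head_norm (fst (snd y)) (snd (snd y))) (\<lambda>y. holmstedt (fst (snd y)) (snd (snd y)))"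
      by (rule dominated_le) (rule head_norm_le_holmstedt)
    show "dominated ?P (\<lambda>y. ennreal c * head_norm (fst (snd y)) (snd (snd y))) (\<lambda>y. holmstedt (fst (snd y)) (snd (snd y)))"
      by (rule dominated_trans[OF dominated_cmult_left J])
    have "dominated ?P (\<lambda>y. ennreal c * (fst (snd y) (snd (snd y)) * snorm_on r0 {snd (snd y)..} vk))
      (\<lambda>y. fst (snd y) (snd (snd y)) * snorm_on r0 {snd (snd y)..} vk)" by (rule dominated_cmult_left)
    also have "dominated ?P \<dots> (\<lambda>y. fst (snd y) (snd (snd y)) * vk (snd (snd y)))"
      by (intro dominated_mult_left dominated_comp[OF dominated_geometric_tail[OF r0 v]]) (use \<theta>0 in auto)
    also have "dominated ?P \<dots> (\<lambda>y. head_norm (fst (snd y)) (snd (snd y)))"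
      by (rule dominated_le) (subst mult.commute, rule term_le_head_norm)
    also note J
    finally show "dominated ?P (\<lambda>y. ennreal c * (fst (snd y) (snd (snd y)) * snorm_on r0 {snd (snd y)..} vk))
      (\<lambda>y. holmstedt (fst (snd y)) (snd (snd y)))" .
  qed
  finally show ?thesis by (simp add: norm0_def case_prod_unfold)
qed

text \<open>The hypothesis describes the other component. Below \<open>k\<close> it has a linear bound, and there the double norm of the weights
  produces \<open>\<chi>\<^sub>1\<close> times \<open>\<kappa> k / 2\<^sup>k\<close>. By the choice of \<open>\<rho>\<close>, multiplication by \<open>\<rho>\<close> turns this into the
  last term of the head norm.\<close>
lemma norm1_le_holmstedt:
  "dominated {(\<kappa>', \<kappa>, k). (\<forall>i\<ge>k. \<kappa>' i \<le> ennreal c * \<kappa> i) \<and> (\<forall>i\<le>k. \<kappa>' i \<le> ennreal (dyad i / dyad k) * (ennreal c * \<kappa> k))}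
    (\<lambda>(\<kappa>', \<kappa>, k). \<rho>k k * norm1 \<kappa>') (\<lambda>(\<kappa>', \<kappa>, k). holmstedt \<kappa> k)" (is "dominated ?P _ _")
proof -
  let ?k = "\<lambda>y :: (int \<Rightarrow> ennreal) \<times> (int \<Rightarrow> ennreal) \<times> int. snd (snd y)"
  let ?\<kappa> = "\<lambda>y :: (int \<Rightarrow> ennreal) \<times> (int \<Rightarrow> ennreal) \<times> int. fst (snd y)"
  let ?m = "\<lambda>y. ennreal (1 / dyad (?k y)) * ?\<kappa> y (?k y)"
  have tail: "tail_norm (fst y) j \<le> ennreal c * tail_norm (?\<kappa> y) j" if "y \<in> ?P" "?k y \<le> j" for y j
    unfolding tail_norm_def snorm_on_cmult[OF q, symmetric]
  proof (intro snorm_on_mono q conjI)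
    fix i assume "i \<in> {j..}"
    then have "wt 1 a i * fst y i \<le> wt 1 a i * (ennreal c * ?\<kappa> y i)"
      using that by (intro mult_left_mono) auto
    then show "wt 1 a i * fst y i \<le> ennreal c * (wt 1 a i * ?\<kappa> y i)" by (simp only: mult_ac)
  qed auto
  let ?Q = "{z. fst z \<in> ?P \<and> snd z \<in> {..?k (fst z)}}"
  have head: "dominated ?Q (\<lambda>z. tail_norm (fst (fst z)) (snd z))
    (\<lambda>z. snorm_on q {snd z..?k (fst z)} ak * ?m (fst z) + tail_norm (?\<kappa> (fst z)) (?k (fst z)))"
  proof -
    have "dominated ?Q (\<lambda>z. tail_norm (fst (fst z)) (snd z)) (\<lambda>z. snorm_on q {snd z..?k (fst z)} (\<lambda>i. wt 1 a i * fst (fst z) i) +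
        tail_norm (fst (fst z)) (?k (fst z)))"
      unfolding tail_norm_def by (rule dominated_snorm_on_split[OF q]) auto
    also have "dominated ?Q \<dots> (\<lambda>z. ennreal c * (snorm_on q {snd z..?k (fst z)} ak * ?m (fst z)) + ennreal c * tail_norm (?\<kappa> (fst z)) (?k (fst z)))"
    proof (intro dominated_add dominated_le)
      fix z assume z: "z \<in> ?Q"
      show "tail_norm (fst (fst z)) (?k (fst z)) \<le> ennreal c * tail_norm (?\<kappa> (fst z)) (?k (fst z))"
        using z by (intro tail) auto
      have "snorm_on q {snd z..?k (fst z)} (\<lambda>i. wt 1 a i * fst (fst z) i)
          \<le> snorm_on q {snd z..?k (fst z)} (\<lambda>i. (ennreal c * ?m (fst z)) * ak i)"
      proof (intro snorm_on_mono q conjI)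
        fix i assume "i \<in> {snd z..?k (fst z)}"
        then have "wt 1 a i * fst (fst z) i \<le> wt 1 a i * (ennreal (dyad i / dyad (?k (fst z))) * (ennreal c * ?\<kappa> (fst z) (?k (fst z))))"
          using z by (intro mult_left_mono) auto
        also have "\<dots> = (wt 1 a i * ennreal (dyad i / dyad (?k (fst z)))) * (ennreal c * ?\<kappa> (fst z) (?k (fst z)))"
          by (simp only: mult_ac)
        also have "wt 1 a i * ennreal (dyad i / dyad (?k (fst z))) = ak i * ennreal (1 / dyad (?k (fst z)))"
          using nonneg[of i] by (simp add: powr_minus divide_inverse mult_ac flip: ennreal_mult)
        finally show "wt 1 a i * fst (fst z) i \<le> (ennreal c * ?m (fst z)) * ak i" by (simp only: mult_ac)
      qed auto
      then show "snorm_on q {snd z..?k (fst z)} (\<lambda>i. wt 1 a i * fst (fst z) i)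
          \<le> ennreal c * (snorm_on q {snd z..?k (fst z)} ak * ?m (fst z))"
        unfolding snorm_on_cmult[OF q] by (simp only: mult_ac)
    qed
    also have "dominated ?Q \<dots> (\<lambda>z. snorm_on q {snd z..?k (fst z)} ak * ?m (fst z) + tail_norm (?\<kappa> (fst z)) (?k (fst z)))"
      by (intro dominated_add dominated_cmult_left)
    finally show ?thesis .
  qed
  have M1: "dominated ?P (\<lambda>y. norm1 (fst y)) (\<lambda>y. \<xi>k (?k y) * ?m y + \<beta>k (?k y) * tail_norm (?\<kappa> y) (?k y) + tail_tail_norm (?\<kappa> y) (?k y))"
  proof -
    have "dominated ?P (\<lambda>y. snorm_on r UNIV (\<lambda>i. bk i * tail_norm (fst y) i))
        (\<lambda>y. snorm_on r {..?k y} (\<lambda>i. bk i * tail_norm (fst y) i) + snorm_on r {?k y..} (\<lambda>i. bk i * tail_norm (fst y) i))"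
      by (rule dominated_snorm_on_split[OF r]) auto
    also have "dominated ?P \<dots> (\<lambda>y. (\<xi>k (?k y) * ?m y + \<beta>k (?k y) * tail_norm (?\<kappa> y) (?k y)) + tail_tail_norm (?\<kappa> y) (?k y))"
    proof (rule dominated_add)
      have "dominated ?P (\<lambda>y. snorm_on r {..?k y} (\<lambda>i. bk i * tail_norm (fst y) i))
        (\<lambda>y. snorm_on r {..?k y} (\<lambda>i. ?m y * (bk i * snorm_on q {i..?k y} ak) + tail_norm (?\<kappa> y) (?k y) * bk i))"
        by (rule dominated_snorm_on'[OF r])
           (use dominated_mult_left[OF head, of "\<lambda>z. bk (snd z)"] in \<open>simp add: distrib_left mult_ac\<close>)
      also have "dominated ?P \<dots> (\<lambda>y. ?m y * snorm_on r {..?k y} (\<lambda>i. bk i * snorm_on q {i..?k y} ak) + tail_norm (?\<kappa> y) (?k y) * snorm_on r {..?k y} bk)"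
        unfolding snorm_on_cmult[OF r, symmetric] by (rule dominated_snorm_on_add[OF r])
      also have "dominated ?P \<dots> (\<lambda>y. ?m y * \<xi>k (?k y) + tail_norm (?\<kappa> y) (?k y) * \<beta>k (?k y))"
        by (intro dominated_add dominated_mult_left dominated_comp[OF X_le_\<xi>] dominated_comp[OF B_le_\<beta>]) auto
      finally show "dominated ?P (\<lambda>y. snorm_on r {..?k y} (\<lambda>i. bk i * tail_norm (fst y) i)) (\<lambda>y. \<xi>k (?k y) * ?m y + \<beta>k (?k y) * tail_norm (?\<kappa> y) (?k y))"
        by (simp only: mult.commute)
      have "dominated ?P (\<lambda>y. snorm_on r {?k y..} (\<lambda>i. bk i * tail_norm (fst y) i)) (\<lambda>y. ennreal c * tail_tail_norm (?\<kappa> y) (?k y))"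
        unfolding tail_tail_norm_def snorm_on_cmult[OF r, symmetric]
      proof (intro dominated_le snorm_on_mono r conjI)
        fix y i assume "y \<in> ?P" "i \<in> {?k y..}"
        then have "bk i * tail_norm (fst y) i \<le> bk i * (ennreal c * tail_norm (?\<kappa> y) i)" by (intro mult_left_mono tail) auto
        then show "bk i * tail_norm (fst y) i \<le> ennreal c * (bk i * tail_norm (?\<kappa> y) i)" by (simp only: mult_ac)
      qed auto
      also have "dominated ?P \<dots> (\<lambda>y. tail_tail_norm (?\<kappa> y) (?k y))" by (rule dominated_cmult_left)
      finally show "dominated ?P (\<lambda>y. snorm_on r {?k y..} (\<lambda>i. bk i * tail_norm (fst y) i)) (\<lambda>y. tail_tail_norm (?\<kappa> y) (?k y))" .
    qed
    finally show ?thesis by (simp add: norm1_def)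
  qed
  have "dominated ?P (\<lambda>y. \<rho>k (?k y) * norm1 (fst y))
    (\<lambda>y. \<rho>k (?k y) * (\<xi>k (?k y) * ?m y + \<beta>k (?k y) * tail_norm (?\<kappa> y) (?k y) + tail_tail_norm (?\<kappa> y) (?k y)))"
    by (rule dominated_mult_left[OF M1])
  also have "dominated ?P \<dots> (\<lambda>y. holmstedt (?\<kappa> y) (?k y))"
  proof (rule dominated_le)
    fix y :: "(int \<Rightarrow> ennreal) \<times> (int \<Rightarrow> ennreal) \<times> int"
    have "ennreal (dyad (?k y)) * ennreal (1 / dyad (?k y)) = 1" by (simp flip: ennreal_mult)
    then have "\<rho>k (?k y) * (\<xi>k (?k y) * ?m y) = vk (?k y) * ?\<kappa> y (?k y)"
      by (simp only: mult.assoc[symmetric] vk_eq[symmetric]) (simp only: mult.assoc mult_1_right)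
    also have "\<dots> \<le> head_norm (?\<kappa> y) (?k y)" by (rule term_le_head_norm)
    finally show "\<rho>k (?k y) * (\<xi>k (?k y) * ?m y + \<beta>k (?k y) * tail_norm (?\<kappa> y) (?k y) + tail_tail_norm (?\<kappa> y) (?k y)) \<le> holmstedt (?\<kappa> y) (?k y)"
      unfolding holmstedt_def by (simp add: distrib_left add.assoc add_right_mono)
  qed
  finally show ?thesis by (simp only: case_prod_unfold)
qed

end

section \<open>Weighted norms of the Holmstedt expression\<close>

context sequence_weights
begin

text \<open>The outer weight \<open>w\<^bsup>-\<theta>\<^esup> \<omega>(w)\<close> at \<open>w = \<rho>(2\<^sup>k)\<close>, where \<open>\<alpha> = \<omega> \<circ> \<rho>\<close>.\<close>
definition weight :: "(real \<Rightarrow> real) \<Rightarrow> real \<Rightarrow> int \<Rightarrow> ennreal" where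
  "weight \<alpha> \<theta> k = ennreal (\<rho> (dyad k) powr (- \<theta>) * \<alpha> (dyad k))"

lemma weight_mult: "0 \<le> y \<Longrightarrow> weight \<alpha> \<theta> k * ennreal y = ennreal (\<rho> (dyad k) powr (- \<theta>) * \<alpha> (dyad k) * y)"
  unfolding weight_def by (rule ennreal_mult''[symmetric])

lemma regvar_weight: "regvar 0 \<alpha> \<Longrightarrow> regvar (- \<theta> * (1 - \<theta>0)) (\<lambda>u. \<rho> u powr (- \<theta>) * \<alpha> u)"
  using regvar_mult[OF regvar_powr[OF \<rho>, of "- \<theta>"], of 0 \<alpha>] by simp

text \<open>For \<open>\<theta> < 1\<close> the weight \<open>\<rho>\<^bsup>1-\<theta>\<^esup> \<alpha>\<close> has positive index. One Hardy inequality removes the single tail norm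
  and two of them remove the iterated one.\<close>
lemma outer_part_dominated:
  assumes s: "0 < s" and \<alpha>: "regvar 0 \<alpha>" and "\<theta> < 1"
  shows "dominated P (\<lambda>\<kappa>. snorm s (\<lambda>k. weight \<alpha> \<theta> k * (\<rho>k k * (\<beta>k k * tail_norm \<kappa> k + tail_tail_norm \<kappa> k))))
    (\<lambda>\<kappa>. snorm s (\<lambda>k. weight \<alpha> \<theta> k * (vk k * \<kappa> k)))"
proof -
  define w where "w = (\<lambda>u. \<rho> u powr (- \<theta>) * \<alpha> u * \<rho> u)"
  define \<delta> where "\<delta> = (1 - \<theta>) * (1 - \<theta>0)"
  have \<delta>: "0 < \<delta>" using assms(3) \<theta>0 by (simp add: \<delta>_def)
  have w: "regvar \<delta> w"
    using regvar_mult[OF regvar_weight[OF \<alpha>, of \<theta>] \<rho>] by (simp add: w_def \<delta>_def algebra_simps)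
  have w\<beta>: "regvar \<delta> (\<lambda>u. w u * \<beta> u)" using regvar_mult[OF w \<beta>] by simp
  have wb: "regvar \<delta> (\<lambda>u. w u * b u)" using regvar_mult[OF w b] by simp
  have wk: "ennreal (w (dyad k)) = weight \<alpha> \<theta> k * \<rho>k k" for k
    using nonneg[of k] by (simp add: w_def weight_mult)
  have wgk: "ennreal (w (dyad k) * g (dyad k)) = weight \<alpha> \<theta> k * \<rho>k k * ennreal (g (dyad k))" if "\<And>u. 0 < u \<Longrightarrow> 0 < g u" for g k
    using that[OF dyad_pos, of k] by (simp add: ennreal_mult'' wk)
  have R_dom: "dominated P (\<lambda>\<kappa>. snorm s (\<lambda>k. weight \<alpha> \<theta> k * \<rho>k k * ennreal (g (dyad k)) * tail_norm \<kappa> k))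
      (\<lambda>\<kappa>. snorm s (\<lambda>k. weight \<alpha> \<theta> k * (vk k * \<kappa> k)))"
    if g: "regvar \<delta> (\<lambda>u. w u * g u)" "\<And>u. 0 < u \<Longrightarrow> 0 < g u" "dominated UNIV (\<lambda>k. ennreal (g (dyad k)) * ak k) \<xi>k" for g
  proof -
    have wg: "ennreal (w (dyad k) * g (dyad k)) = weight \<alpha> \<theta> k * \<rho>k k * ennreal (g (dyad k))" for k
      by (rule wgk) (rule g(2))
    have "dominated P (\<lambda>\<kappa>. snorm s (\<lambda>k. ennreal (w (dyad k) * g (dyad k)) * tail_norm \<kappa> k))
      (\<lambda>\<kappa>. snorm s (\<lambda>k. ennreal (w (dyad k) * g (dyad k)) * (wt 1 a k * \<kappa> k)))"
      unfolding tail_norm_def by (rule dominated_hardy_tail[OF q s g(1) \<delta>])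
    also have "dominated P \<dots> (\<lambda>\<kappa>. snorm s (\<lambda>k. weight \<alpha> \<theta> k * (vk k * \<kappa> k)))"
    proof (rule dominated_snorm'[OF s])
      have "dominated (P \<times> UNIV) (\<lambda>z. weight \<alpha> \<theta> (snd z) * (ennreal (g (dyad (snd z))) * (\<rho>k (snd z) * (wt 1 a (snd z) * fst z (snd z)))))
        (\<lambda>z. weight \<alpha> \<theta> (snd z) * (vk (snd z) * fst z (snd z)))"
        by (rule dominated_mult_left[OF dominated_\<rho>_wt[OF g(3), where x = "\<lambda>\<kappa>. \<kappa>"]])
      then show "dominated (P \<times> UNIV) (\<lambda>z. ennreal (w (dyad (snd z)) * g (dyad (snd z))) * (wt 1 a (snd z) * fst z (snd z)))
        (\<lambda>z. weight \<alpha> \<theta> (snd z) * (vk (snd z) * fst z (snd z)))"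
        unfolding wg by (simp only: mult_ac)
    qed
    finally show ?thesis unfolding wg .
  qed
  have 1: "dominated P (\<lambda>\<kappa>. snorm s (\<lambda>k. weight \<alpha> \<theta> k * \<rho>k k * \<beta>k k * tail_norm \<kappa> k)) (\<lambda>\<kappa>. snorm s (\<lambda>k. weight \<alpha> \<theta> k * (vk k * \<kappa> k)))"
    by (rule R_dom[OF w\<beta> regvar_pos[OF \<beta>] \<beta>_a_le_\<xi>])
  have "dominated P (\<lambda>\<kappa>. snorm s (\<lambda>k. ennreal (w (dyad k)) * tail_tail_norm \<kappa> k)) (\<lambda>\<kappa>. snorm s (\<lambda>k. ennreal (w (dyad k)) * (bk k * tail_norm \<kappa> k)))"
    unfolding tail_tail_norm_def by (rule dominated_hardy_tail[OF r s w \<delta>])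
  also have "dominated P \<dots> (\<lambda>\<kappa>. snorm s (\<lambda>k. weight \<alpha> \<theta> k * (vk k * \<kappa> k)))"
    using R_dom[OF wb regvar_pos[OF b] b_a_le_\<xi>] by (simp only: wk mult.assoc)
  finally have 2: "dominated P (\<lambda>\<kappa>. snorm s (\<lambda>k. weight \<alpha> \<theta> k * \<rho>k k * tail_tail_norm \<kappa> k)) (\<lambda>\<kappa>. snorm s (\<lambda>k. weight \<alpha> \<theta> k * (vk k * \<kappa> k)))"
    unfolding wk .
  have "dominated P (\<lambda>\<kappa>. snorm s (\<lambda>k. weight \<alpha> \<theta> k * \<rho>k k * \<beta>k k * tail_norm \<kappa> k + weight \<alpha> \<theta> k * \<rho>k k * tail_tail_norm \<kappa> k))
     (\<lambda>\<kappa>. snorm s (\<lambda>k. weight \<alpha> \<theta> k * (vk k * \<kappa> k)))"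
    by (rule dominated_snorm_add_least[OF s 1 2])
  then show ?thesis by (simp only: distrib_left mult.assoc)
qed

text \<open>For \<open>\<theta> > 0\<close> the weight \<open>\<rho>\<^bsup>-\<theta>\<^esup> \<alpha>\<close> has negative index.\<close>
lemma inner_part_dominated:
  assumes s: "0 < s" and \<alpha>: "regvar 0 \<alpha>" and "0 < \<theta>"
  shows "dominated P (\<lambda>\<kappa>. snorm s (\<lambda>k. weight \<alpha> \<theta> k * head_norm \<kappa> k)) (\<lambda>\<kappa>. snorm s (\<lambda>k. weight \<alpha> \<theta> k * (vk k * \<kappa> k)))"
proof -
  have "- \<theta> * (1 - \<theta>0) < 0" using assms(3) \<theta>0 by (simp add: mult_less_0_iff)
  from dominated_hardy_head[OF r0 s regvar_weight[OF \<alpha>] this] show ?thesis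
    unfolding head_norm_def weight_def .
qed

lemma snorm_holmstedt_interior:
  assumes s: "0 < s" and \<alpha>: "regvar 0 \<alpha>" and "0 < \<theta>" "\<theta> < 1"
  shows "dominated P (\<lambda>\<kappa>. snorm s (\<lambda>k. weight \<alpha> \<theta> k * holmstedt \<kappa> k)) (\<lambda>\<kappa>. snorm s (\<lambda>k. weight \<alpha> \<theta> k * (vk k * \<kappa> k)))"
    and "dominated P (\<lambda>\<kappa>. snorm s (\<lambda>k. weight \<alpha> \<theta> k * (vk k * \<kappa> k))) (\<lambda>\<kappa>. snorm s (\<lambda>k. weight \<alpha> \<theta> k * holmstedt \<kappa> k))"
proof -
  show "dominated P (\<lambda>\<kappa>. snorm s (\<lambda>k. weight \<alpha> \<theta> k * holmstedt \<kappa> k)) (\<lambda>\<kappa>. snorm s (\<lambda>k. weight \<alpha> \<theta> k * (vk k * \<kappa> k)))"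
    unfolding holmstedt_def distrib_left[of "weight \<alpha> \<theta> _"]
    by (intro dominated_snorm_add_least s inner_part_dominated outer_part_dominated assms)
  show "dominated P (\<lambda>\<kappa>. snorm s (\<lambda>k. weight \<alpha> \<theta> k * (vk k * \<kappa> k))) (\<lambda>\<kappa>. snorm s (\<lambda>k. weight \<alpha> \<theta> k * holmstedt \<kappa> k))"
    by (intro dominated_le snorm_mono s mult_left_mono order_trans[OF term_le_head_norm head_norm_le_holmstedt]) simp
qed

lemma snorm_holmstedt_zero:
  assumes s: "0 < s" and \<alpha>: "regvar 0 \<alpha>"
  shows "dominated P (\<lambda>\<kappa>. snorm s (\<lambda>k. weight \<alpha> 0 k * holmstedt \<kappa> k)) (\<lambda>\<kappa>. snorm s (\<lambda>k. weight \<alpha> 0 k * head_norm \<kappa> k))"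
    and "dominated P (\<lambda>\<kappa>. snorm s (\<lambda>k. weight \<alpha> 0 k * head_norm \<kappa> k)) (\<lambda>\<kappa>. snorm s (\<lambda>k. weight \<alpha> 0 k * holmstedt \<kappa> k))"
proof -
  have "dominated P (\<lambda>\<kappa>. snorm s (\<lambda>k. weight \<alpha> 0 k * (\<rho>k k * (\<beta>k k * tail_norm \<kappa> k + tail_tail_norm \<kappa> k)))) (\<lambda>\<kappa>. snorm s (\<lambda>k. weight \<alpha> 0 k * (vk k * \<kappa> k)))"
    by (rule outer_part_dominated[OF s \<alpha>]) simp
  also have "dominated P \<dots> (\<lambda>\<kappa>. snorm s (\<lambda>k. weight \<alpha> 0 k * head_norm \<kappa> k))"
    by (intro dominated_le snorm_mono s mult_left_mono term_le_head_norm) simp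
  finally show "dominated P (\<lambda>\<kappa>. snorm s (\<lambda>k. weight \<alpha> 0 k * holmstedt \<kappa> k)) (\<lambda>\<kappa>. snorm s (\<lambda>k. weight \<alpha> 0 k * head_norm \<kappa> k))"
    unfolding holmstedt_def distrib_left[of "weight \<alpha> 0 _"] by (intro dominated_snorm_add_least s dominated_refl)
  show "dominated P (\<lambda>\<kappa>. snorm s (\<lambda>k. weight \<alpha> 0 k * head_norm \<kappa> k)) (\<lambda>\<kappa>. snorm s (\<lambda>k. weight \<alpha> 0 k * holmstedt \<kappa> k))"
    by (intro dominated_le snorm_mono s mult_left_mono head_norm_le_holmstedt) simp
qed

lemma snorm_holmstedt_one:
  assumes s: "0 < s" and \<alpha>: "regvar 0 \<alpha>"
  shows "dominated P (\<lambda>\<kappa>. snorm s (\<lambda>k. weight \<alpha> 1 k * holmstedt \<kappa> k))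
      (\<lambda>\<kappa>. snorm s (\<lambda>k. weight \<alpha> 1 k * (vk k * \<kappa> k)) +
        (snorm s (\<lambda>k. ennreal (\<beta> (dyad k) * \<alpha> (dyad k)) * tail_norm \<kappa> k) + snorm s (\<lambda>k. ennreal (\<alpha> (dyad k)) * tail_tail_norm \<kappa> k)))"
    and "dominated P (\<lambda>\<kappa>. snorm s (\<lambda>k. weight \<alpha> 1 k * (vk k * \<kappa> k))) (\<lambda>\<kappa>. snorm s (\<lambda>k. weight \<alpha> 1 k * holmstedt \<kappa> k))"
    and "dominated P (\<lambda>\<kappa>. snorm s (\<lambda>k. ennreal (\<beta> (dyad k) * \<alpha> (dyad k)) * tail_norm \<kappa> k)) (\<lambda>\<kappa>. snorm s (\<lambda>k. weight \<alpha> 1 k * holmstedt \<kappa> k))"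
    and "dominated P (\<lambda>\<kappa>. snorm s (\<lambda>k. ennreal (\<alpha> (dyad k)) * tail_tail_norm \<kappa> k)) (\<lambda>\<kappa>. snorm s (\<lambda>k. weight \<alpha> 1 k * holmstedt \<kappa> k))"
proof -
  have e\<rho>: "weight \<alpha> 1 k * \<rho>k k = ennreal (\<alpha> (dyad k))" for k
    unfolding weight_mult[OF nonneg(6)] using pos(6)[of k] by (simp add: powr_minus field_simps)
  have e\<rho>\<beta>: "weight \<alpha> 1 k * (\<rho>k k * (\<beta>k k * x)) = ennreal (\<beta> (dyad k) * \<alpha> (dyad k)) * x" for k x
    unfolding ennreal_mult'[OF nonneg(4)] e\<rho>[symmetric] by (simp only: mult_ac)
  have eH: "weight \<alpha> 1 k * holmstedt \<kappa> k = weight \<alpha> 1 k * head_norm \<kappa> k + (ennreal (\<beta> (dyad k) * \<alpha> (dyad k)) * tail_norm \<kappa> k + ennreal (\<alpha> (dyad k)) * tail_tail_norm \<kappa> k)" for \<kappa> k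
    unfolding holmstedt_def distrib_left e\<rho>\<beta> by (simp only: mult.assoc[symmetric] e\<rho>)
  have "dominated P (\<lambda>\<kappa>. snorm s (\<lambda>k. weight \<alpha> 1 k * holmstedt \<kappa> k)) (\<lambda>\<kappa>. snorm s (\<lambda>k. weight \<alpha> 1 k * head_norm \<kappa> k) +
      snorm s (\<lambda>k. ennreal (\<beta> (dyad k) * \<alpha> (dyad k)) * tail_norm \<kappa> k + ennreal (\<alpha> (dyad k)) * tail_tail_norm \<kappa> k))"
    unfolding eH by (rule dominated_snorm_add[OF s])
  also have "dominated P \<dots> (\<lambda>\<kappa>. snorm s (\<lambda>k. weight \<alpha> 1 k * (vk k * \<kappa> k)) +
        (snorm s (\<lambda>k. ennreal (\<beta> (dyad k) * \<alpha> (dyad k)) * tail_norm \<kappa> k) + snorm s (\<lambda>k. ennreal (\<alpha> (dyad k)) * tail_tail_norm \<kappa> k)))"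
    by (intro dominated_add inner_part_dominated dominated_snorm_add s \<alpha>) simp
  finally show "dominated P (\<lambda>\<kappa>. snorm s (\<lambda>k. weight \<alpha> 1 k * holmstedt \<kappa> k))
      (\<lambda>\<kappa>. snorm s (\<lambda>k. weight \<alpha> 1 k * (vk k * \<kappa> k)) +
        (snorm s (\<lambda>k. ennreal (\<beta> (dyad k) * \<alpha> (dyad k)) * tail_norm \<kappa> k) + snorm s (\<lambda>k. ennreal (\<alpha> (dyad k)) * tail_tail_norm \<kappa> k)))" .
  show "dominated P (\<lambda>\<kappa>. snorm s (\<lambda>k. weight \<alpha> 1 k * (vk k * \<kappa> k))) (\<lambda>\<kappa>. snorm s (\<lambda>k. weight \<alpha> 1 k * holmstedt \<kappa> k))"
    by (intro dominated_le snorm_mono s mult_left_mono order_trans[OF term_le_head_norm head_norm_le_holmstedt]) simp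
  show "dominated P (\<lambda>\<kappa>. snorm s (\<lambda>k. ennreal (\<beta> (dyad k) * \<alpha> (dyad k)) * tail_norm \<kappa> k)) (\<lambda>\<kappa>. snorm s (\<lambda>k. weight \<alpha> 1 k * holmstedt \<kappa> k))"
    "dominated P (\<lambda>\<kappa>. snorm s (\<lambda>k. ennreal (\<alpha> (dyad k)) * tail_tail_norm \<kappa> k)) (\<lambda>\<kappa>. snorm s (\<lambda>k. weight \<alpha> 1 k * holmstedt \<kappa> k))"
    unfolding eH by (rule dominated_le, rule snorm_mono[OF s], simp add: add_increasing add_increasing2)+
qed

lemma holmstedt_add:
  "dominated {z. \<forall>i. fst (fst z) i \<le> ennreal c * (fst (snd (fst z)) i + snd (snd (fst z)) i)}
    (\<lambda>z. holmstedt (fst (fst z)) (snd z)) (\<lambda>z. holmstedt (fst (snd (fst z))) (snd z) + holmstedt (snd (snd (fst z))) (snd z))" (is "dominated ?P _ _")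
proof -
  have le: "u i * fst (fst z) i \<le> ennreal c * (u i * fst (snd (fst z)) i + u i * snd (snd (fst z)) i)" if "z \<in> ?P" for u z i
  proof -
    have "u i * fst (fst z) i \<le> u i * (ennreal c * (fst (snd (fst z)) i + snd (snd (fst z)) i))"
      using that by (intro mult_left_mono) auto
    then show ?thesis by (simp only: distrib_left mult_ac)
  qed
  have J: "dominated ?P (\<lambda>z. head_norm (fst (fst z)) (snd z)) (\<lambda>z. head_norm (fst (snd (fst z))) (snd z) + head_norm (snd (snd (fst z))) (snd z))"
  proof -
    have "dominated ?P (\<lambda>z. head_norm (fst (fst z)) (snd z)) (\<lambda>z. snorm_on r0 {..snd z} (\<lambda>i. vk i * fst (snd (fst z)) i + vk i * snd (snd (fst z)) i))"
      unfolding head_norm_def by (rule dominated_snorm_on'[OF r0], rule dominatedI[where C = c], rule le) simp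
    also have "dominated ?P \<dots> (\<lambda>z. head_norm (fst (snd (fst z))) (snd z) + head_norm (snd (snd (fst z))) (snd z))"
      unfolding head_norm_def by (rule dominated_snorm_on_add[OF r0])
    finally show ?thesis .
  qed
  have R: "dominated ?P (\<lambda>z. tail_norm (fst (fst z)) (snd z)) (\<lambda>z. tail_norm (fst (snd (fst z))) (snd z) + tail_norm (snd (snd (fst z))) (snd z))"
  proof -
    have "dominated ?P (\<lambda>z. tail_norm (fst (fst z)) (snd z)) (\<lambda>z. snorm_on q {snd z..} (\<lambda>i. wt 1 a i * fst (snd (fst z)) i + wt 1 a i * snd (snd (fst z)) i))"
      unfolding tail_norm_def by (rule dominated_snorm_on'[OF q], rule dominatedI[where C = c], rule le) simp
    also have "dominated ?P \<dots> (\<lambda>z. tail_norm (fst (snd (fst z))) (snd z) + tail_norm (snd (snd (fst z))) (snd z))"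
      unfolding tail_norm_def by (rule dominated_snorm_on_add[OF q])
    finally show ?thesis .
  qed
  have RR: "dominated ?P (\<lambda>z. tail_tail_norm (fst (fst z)) (snd z)) (\<lambda>z. tail_tail_norm (fst (snd (fst z))) (snd z) + tail_tail_norm (snd (snd (fst z))) (snd z))"
  proof -
    have "dominated ?P (\<lambda>z. tail_tail_norm (fst (fst z)) (snd z)) (\<lambda>z. snorm_on r {snd z..} (\<lambda>i. bk i * tail_norm (fst (snd (fst z))) i + bk i * tail_norm (snd (snd (fst z))) i))"
      unfolding tail_tail_norm_def
    proof (rule dominated_snorm_on'[OF r])
      let ?Q = "{y. fst y \<in> ?P \<and> snd y \<in> {snd (fst y)..}}"
      have "dominated ?Q (\<lambda>y. tail_norm (fst (fst (fst (fst y), snd y))) (snd (fst (fst y), snd y)))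
        (\<lambda>y. tail_norm (fst (snd (fst (fst (fst y), snd y)))) (snd (fst (fst y), snd y)) + tail_norm (snd (snd (fst (fst (fst y), snd y)))) (snd (fst (fst y), snd y)))"
        by (rule dominated_comp[OF R]) simp
      from dominated_mult_left[OF this, of "\<lambda>y. bk (snd y)"]
      show "dominated ?Q (\<lambda>y. bk (snd y) * tail_norm (fst (fst (fst y))) (snd y))
        (\<lambda>y. bk (snd y) * tail_norm (fst (snd (fst (fst y)))) (snd y) + bk (snd y) * tail_norm (snd (snd (fst (fst y)))) (snd y))"
        by (simp only: fst_conv snd_conv distrib_left)
    qed
    also have "dominated ?P \<dots> (\<lambda>z. tail_tail_norm (fst (snd (fst z))) (snd z) + tail_tail_norm (snd (snd (fst z))) (snd z))"
      unfolding tail_tail_norm_def by (rule dominated_snorm_on_add[OF r])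
    finally show ?thesis .
  qed
  have "dominated ?P (\<lambda>z. holmstedt (fst (fst z)) (snd z)) (\<lambda>z. (head_norm (fst (snd (fst z))) (snd z) + head_norm (snd (snd (fst z))) (snd z)) +
      \<rho>k (snd z) * (\<beta>k (snd z) * (tail_norm (fst (snd (fst z))) (snd z) + tail_norm (snd (snd (fst z))) (snd z)) + (tail_tail_norm (fst (snd (fst z))) (snd z) + tail_tail_norm (snd (snd (fst z))) (snd z))))"
    unfolding holmstedt_def by (intro dominated_add dominated_mult_left J R RR)
  also have "dominated ?P \<dots> (\<lambda>z. holmstedt (fst (snd (fst z))) (snd z) + holmstedt (snd (snd (fst z))) (snd z))"
    unfolding holmstedt_def by (rule dominated_le) (simp only: distrib_left add_ac order_refl)
  finally show ?thesis .
qed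

end

section \<open>The K-functional\<close>

lemma le_cmult_Inf:
  assumes "0 < c" "\<And>y. y \<in> A \<Longrightarrow> x \<le> ennreal c * y"
  shows "x \<le> ennreal c * Inf A"
proof -
  have inv: "ennreal (1 / c) * (ennreal c * y) = y" "ennreal c * (ennreal (1 / c) * y) = y" for y
    using assms(1) by (simp_all add: mult.assoc[symmetric] flip: ennreal_mult)
  have "ennreal (1 / c) * x \<le> Inf A"
  proof (rule Inf_greatest)
    fix y assume "y \<in> A"
    then have "ennreal (1 / c) * x \<le> ennreal (1 / c) * (ennreal c * y)" by (intro mult_left_mono assms) auto
    then show "ennreal (1 / c) * x \<le> y" unfolding inv .
  qed
  then have "ennreal c * (ennreal (1 / c) * x) \<le> ennreal c * Inf A" by (rule mult_left_mono) simp
  then show ?thesis unfolding inv .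
qed

text \<open>Addition in \<open>[0, \<infinity>]\<close> commutes with infima; for a finite summand it can be moved to the other side.\<close>
lemma le_Inf_add:
  assumes "\<And>y. y \<in> A \<Longrightarrow> x \<le> y + (z :: ennreal)"
  shows "x \<le> Inf A + z"
proof (cases "z = top")
  case False
  have "x - z \<le> Inf A"
    by (rule Inf_greatest) (use assms False in \<open>simp add: ennreal_minus_le_iff add.commute\<close>)
  then show ?thesis using False by (simp add: ennreal_minus_le_iff add.commute)
qed simp

lemma K_upper:
  "f0 \<in> points X0 \<Longrightarrow> f1 \<in> points X1 \<Longrightarrow> K X0 X1 t (f0 + f1) \<le> ennreal (qnorm X0 f0 + t * qnorm X1 f1)"
  unfolding K_def by (rule Inf_lower) blast

lemma quasiconcave_K:
  assumes "\<And>x. x \<in> points X0 \<Longrightarrow> 0 \<le> qnorm X0 x" "\<And>x. x \<in> points X1 \<Longrightarrow> 0 \<le> qnorm X1 x"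
  shows "quasiconcave (\<lambda>t. K X0 X1 t f)"
  unfolding quasiconcave_def
proof (intro allI impI conjI; elim conjE)
  fix s t :: real assume st: "0 < s" "s \<le> t"
  show "K X0 X1 s f \<le> K X0 X1 t f"
    unfolding K_def[of X0 X1 t]
  proof (rule Inf_greatest, clarify)
    fix f0 f1 assume f: "f0 \<in> points X0" "f1 \<in> points X1"
    have "K X0 X1 s (f0 + f1) \<le> ennreal (qnorm X0 f0 + s * qnorm X1 f1)" using f by (rule K_upper)
    also have "\<dots> \<le> ennreal (qnorm X0 f0 + t * qnorm X1 f1)"
      using st assms f by (intro ennreal_leI add_left_mono mult_right_mono) auto
    finally show "K X0 X1 s (f0 + f1) \<le> ennreal (qnorm X0 f0 + t * qnorm X1 f1)" .
  qed
  show "K X0 X1 t f \<le> ennreal (t / s) * K X0 X1 s f"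
    unfolding K_def[of X0 X1 s]
  proof (rule le_cmult_Inf)
    show "0 < t / s" using st by simp
    fix y assume "y \<in> {ennreal (qnorm X0 f0 + s * qnorm X1 f1) |f0 f1. f0 \<in> points X0 \<and> f1 \<in> points X1 \<and> f = f0 + f1}"
    then obtain f0 f1 where f: "f0 \<in> points X0" "f1 \<in> points X1" "f = f0 + f1"
      and y: "y = ennreal (qnorm X0 f0 + s * qnorm X1 f1)" by blast
    have "1 * qnorm X0 f0 \<le> t / s * qnorm X0 f0" using st assms(1)[OF f(1)] by (intro mult_right_mono) auto
    then have "qnorm X0 f0 + t * qnorm X1 f1 \<le> t / s * (qnorm X0 f0 + s * qnorm X1 f1)"
      using st by (simp add: distrib_left)
    then have "ennreal (qnorm X0 f0 + t * qnorm X1 f1) \<le> ennreal (t / s * (qnorm X0 f0 + s * qnorm X1 f1))"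
      by (rule ennreal_leI)
    also have "\<dots> = ennreal (t / s) * y" unfolding y using st by (intro ennreal_mult') auto
    finally show "K X0 X1 t f \<le> ennreal (t / s) * y"
      using K_upper[OF f(1,2), of t] f(3) by auto
  qed
qed

lemma quasi_normedD:
  assumes "quasi_normed X"
  shows "subspace (points X)" "\<And>x. x \<in> points X \<Longrightarrow> 0 \<le> qnorm X x" "qnorm X 0 = 0"
    "\<And>x. x \<in> points X \<Longrightarrow> qnorm X (- x) = qnorm X x"
proof -
  show sub: "subspace (points X)"
    using assms unfolding quasi_normed_def by (elim conjE)
  have nz: "\<forall>x\<in>points X. 0 \<le> qnorm X x \<and> (qnorm X x = 0 \<longleftrightarrow> x = 0)"
    using assms unfolding quasi_normed_def by (elim conjE)
  then show "0 \<le> qnorm X x" if "x \<in> points X" for x using that by blast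
  show "qnorm X 0 = 0" using nz subspace_0[OF sub] by blast
  have "\<forall>c. \<forall>x\<in>points X. qnorm X (c *\<^sub>R x) = \<bar>c\<bar> * qnorm X x"
    using assms unfolding quasi_normed_def by (elim conjE)
  then have "qnorm X ((- 1) *\<^sub>R x) = \<bar>- 1\<bar> * qnorm X x" if "x \<in> points X" for x
    using that by blast
  then show "qnorm X (- x) = qnorm X x" if "x \<in> points X" for x
    using that by simp
qed

lemma quasi_normed_triangle:
  assumes "quasi_normed X"
  obtains C where "1 \<le> C" "\<And>x y. x \<in> points X \<Longrightarrow> y \<in> points X \<Longrightarrow> qnorm X (x + y) \<le> C * (qnorm X x + qnorm X y)"
proof -
  obtain C where C: "\<forall>x\<in>points X. \<forall>y\<in>points X. qnorm X (x + y) \<le> C * (qnorm X x + qnorm X y)"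
    using assms unfolding quasi_normed_def by (elim conjE exE)
  show thesis
  proof (rule that[of "max C 1"])
    fix x y assume xy: "x \<in> points X" "y \<in> points X"
    then have "qnorm X (x + y) \<le> C * (qnorm X x + qnorm X y)" using C by blast
    also have "\<dots> \<le> max C 1 * (qnorm X x + qnorm X y)"
      using quasi_normedD(2)[OF assms] xy by (intro mult_right_mono) auto
    finally show "qnorm X (x + y) \<le> max C 1 * (qnorm X x + qnorm X y)" .
  qed simp
qed

lemma K_triangle:
  assumes "quasi_normed X0" "quasi_normed X1"
  obtains C :: real where "1 \<le> C" "\<And>t f g. 0 < t \<Longrightarrow> K X0 X1 t (f + g) \<le> ennreal C * (K X0 X1 t f + K X0 X1 t g)"
proof -
  obtain C0 where C0: "1 \<le> C0" "\<And>x y. x \<in> points X0 \<Longrightarrow> y \<in> points X0 \<Longrightarrow> qnorm X0 (x + y) \<le> C0 * (qnorm X0 x + qnorm X0 y)"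
    using quasi_normed_triangle[OF assms(1)] by blast
  obtain C1 where C1: "1 \<le> C1" "\<And>x y. x \<in> points X1 \<Longrightarrow> y \<in> points X1 \<Longrightarrow> qnorm X1 (x + y) \<le> C1 * (qnorm X1 x + qnorm X1 y)"
    using quasi_normed_triangle[OF assms(2)] by blast
  define C where "C = max C0 C1"
  have C: "1 \<le> C" "C0 \<le> C" "C1 \<le> C" using C0(1) by (auto simp: C_def)
  note n0 = quasi_normedD[OF assms(1)] and n1 = quasi_normedD[OF assms(2)]
  have inv: "ennreal C * (ennreal (1 / C) * y) = y" for y
    using C(1) by (simp add: mult.assoc[symmetric] flip: ennreal_mult)
  show thesis
  proof (rule that[OF C(1)])
    fix t f g assume t: "(0::real) < t"
    let ?S = "\<lambda>f. {ennreal (qnorm X0 f0 + t * qnorm X1 f1) |f0 f1. f0 \<in> points X0 \<and> f1 \<in> points X1 \<and> f = f0 + f1}"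
    have "ennreal (1 / C) * K X0 X1 t (f + g) \<le> y + z" if yz: "y \<in> ?S f" "z \<in> ?S g" for y z
    proof -
      obtain f0 f1 where f: "f0 \<in> points X0" "f1 \<in> points X1" "f = f0 + f1"
        and y: "y = ennreal (qnorm X0 f0 + t * qnorm X1 f1)" using yz(1) by blast
      obtain g0 g1 where g: "g0 \<in> points X0" "g1 \<in> points X1" "g = g0 + g1"
        and z: "z = ennreal (qnorm X0 g0 + t * qnorm X1 g1)" using yz(2) by blast
      have nn: "0 \<le> qnorm X0 f0" "0 \<le> qnorm X0 g0" "0 \<le> qnorm X1 f1" "0 \<le> qnorm X1 g1"
        using f g n0 n1 by auto
      have "K X0 X1 t ((f0 + g0) + (f1 + g1)) \<le> ennreal (qnorm X0 (f0 + g0) + t * qnorm X1 (f1 + g1))"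
        using f g n0(1) n1(1) by (intro K_upper subspace_add)
      also have "(f0 + g0) + (f1 + g1) = f + g" using f g by (simp add: add_ac)
      also have "ennreal (qnorm X0 (f0 + g0) + t * qnorm X1 (f1 + g1)) \<le> ennreal (C * ((qnorm X0 f0 + t * qnorm X1 f1) + (qnorm X0 g0 + t * qnorm X1 g1)))"
      proof (rule ennreal_leI)
        have "qnorm X0 (f0 + g0) \<le> C0 * (qnorm X0 f0 + qnorm X0 g0)" using f g C0 by blast
        also have "\<dots> \<le> C * (qnorm X0 f0 + qnorm X0 g0)" using C nn by (intro mult_right_mono) auto
        finally have a: "qnorm X0 (f0 + g0) \<le> C * (qnorm X0 f0 + qnorm X0 g0)" .
        have "qnorm X1 (f1 + g1) \<le> C1 * (qnorm X1 f1 + qnorm X1 g1)" using f g C1 by blast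
        also have "\<dots> \<le> C * (qnorm X1 f1 + qnorm X1 g1)" using C nn by (intro mult_right_mono) auto
        finally have "t * qnorm X1 (f1 + g1) \<le> t * (C * (qnorm X1 f1 + qnorm X1 g1))" using t by (intro mult_left_mono) auto
        with a show "qnorm X0 (f0 + g0) + t * qnorm X1 (f1 + g1) \<le> C * ((qnorm X0 f0 + t * qnorm X1 f1) + (qnorm X0 g0 + t * qnorm X1 g1))"
          by (simp add: algebra_simps)
      qed
      finally have "ennreal (1 / C) * K X0 X1 t (f + g) \<le> ennreal (1 / C) * ennreal (C * ((qnorm X0 f0 + t * qnorm X1 f1) + (qnorm X0 g0 + t * qnorm X1 g1)))"
        by (rule mult_left_mono) simp
      also have "\<dots> = ennreal ((qnorm X0 f0 + t * qnorm X1 f1) + (qnorm X0 g0 + t * qnorm X1 g1))"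
        using C(1) nn t by (simp flip: ennreal_mult)
      also have "\<dots> = y + z" unfolding y z using nn t by (simp flip: ennreal_plus)
      finally show ?thesis .
    qed
    then have "ennreal (1 / C) * K X0 X1 t (f + g) \<le> K X0 X1 t f + z" if "z \<in> ?S g" for z
      using that unfolding K_def[of X0 X1 t f] by (intro le_Inf_add)
    then have "ennreal (1 / C) * K X0 X1 t (f + g) \<le> z + K X0 X1 t f" if "z \<in> ?S g" for z
      using that by (subst add.commute)
    then have "ennreal (1 / C) * K X0 X1 t (f + g) \<le> K X0 X1 t g + K X0 X1 t f"
      unfolding K_def[of X0 X1 t g] by (rule le_Inf_add)
    then have "ennreal C * (ennreal (1 / C) * K X0 X1 t (f + g)) \<le> ennreal C * (K X0 X1 t g + K X0 X1 t f)"
      by (rule mult_left_mono) simp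
    then show "K X0 X1 t (f + g) \<le> ennreal C * (K X0 X1 t f + K X0 X1 t g)"
      unfolding inv by (simp only: add.commute)
  qed
qed

text \<open>If the K-functional vanishes, then \<open>f\<close> has decompositions whose components tend to 0 in the ambient space, which is
  Hausdorff.\<close>
lemma K_zero_imp:
  fixes A0 A1 :: "'v::hausdorff_tvs qspace"
  assumes "compatible_couple A0 A1" "0 < t" "K A0 A1 t f = 0"
  shows "f = 0"
proof (rule ccontr)
  assume "f \<noteq> 0"
  then obtain U where U: "open U" "0 \<in> U" "f \<notin> U" using hausdorff[of 0 f] by blast
  have "eventually (\<lambda>p. fst p + snd p \<in> U) (nhds (0::'v) \<times>\<^sub>F nhds (0::'v))"
    using tendsto_add_Pair[of "0::'v" "0::'v"] U by (auto dest: topological_tendstoD)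
  then have "\<exists>P Q. eventually P (nhds (0::'v)) \<and> eventually Q (nhds (0::'v)) \<and> (\<forall>x y. P x \<longrightarrow> Q y \<longrightarrow> x + y \<in> U)"
    unfolding eventually_prod_filter fst_conv snd_conv .
  then obtain P Q where PQ: "eventually P (nhds (0::'v))" "eventually Q (nhds (0::'v))"
      "\<And>x y. P x \<Longrightarrow> Q y \<Longrightarrow> x + y \<in> U"
    by blast
  obtain W0 where W0: "open W0" "0 \<in> W0" "\<And>x. x \<in> W0 \<Longrightarrow> P x" using PQ(1) unfolding eventually_nhds by blast
  obtain W1 where W1: "open W1" "0 \<in> W1" "\<And>x. x \<in> W1 \<Longrightarrow> Q x" using PQ(2) unfolding eventually_nhds by blast
  obtain d0 where d0: "0 < d0" "\<And>x. x \<in> points A0 \<Longrightarrow> qnorm A0 x < d0 \<Longrightarrow> x \<in> W0"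
  proof -
    have "\<forall>U. open U \<and> 0 \<in> U \<longrightarrow> (\<exists>\<delta>>0. \<forall>x\<in>points A0. qnorm A0 x < \<delta> \<longrightarrow> x \<in> U)"
      using assms(1) unfolding compatible_couple_def embedded_in_ambient_def by (elim conjE)
    then have "\<exists>\<delta>>0. \<forall>x\<in>points A0. qnorm A0 x < \<delta> \<longrightarrow> x \<in> W0" using W0(1,2) by simp
    then show thesis using that by blast
  qed
  obtain d1 where d1: "0 < d1" "\<And>x. x \<in> points A1 \<Longrightarrow> qnorm A1 x < d1 \<Longrightarrow> x \<in> W1"
  proof -
    have "\<forall>U. open U \<and> 0 \<in> U \<longrightarrow> (\<exists>\<delta>>0. \<forall>x\<in>points A1. qnorm A1 x < \<delta> \<longrightarrow> x \<in> U)"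
      using assms(1) unfolding compatible_couple_def embedded_in_ambient_def by (elim conjE)
    then have "\<exists>\<delta>>0. \<forall>x\<in>points A1. qnorm A1 x < \<delta> \<longrightarrow> x \<in> W1" using W1(1,2) by simp
    then show thesis using that by blast
  qed
  have n: "quasi_normed A0" "quasi_normed A1" using assms(1) by (auto simp: compatible_couple_def)
  define d where "d = min d0 (t * d1)"
  have "0 < d" using d0 d1 assms(2) by (simp add: d_def)
  then have "K A0 A1 t f < ennreal d" using assms(3) by simp
  then obtain f0 f1 where f: "f0 \<in> points A0" "f1 \<in> points A1" "f = f0 + f1" "ennreal (qnorm A0 f0 + t * qnorm A1 f1) < ennreal d"
    unfolding K_def Inf_less_iff by blast
  have nn: "0 \<le> qnorm A0 f0" "0 \<le> qnorm A1 f1" using f n quasi_normedD(2) by auto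
  have lt: "qnorm A0 f0 + t * qnorm A1 f1 < d" using f(4) nn assms(2) by (subst (asm) ennreal_less_iff) auto
  have "0 \<le> t * qnorm A1 f1" using nn assms(2) by simp
  with lt have "qnorm A0 f0 < d0" by (simp add: d_def)
  moreover have "t * qnorm A1 f1 < t * d1" using lt nn by (simp add: d_def)
  then have "qnorm A1 f1 < d1" using assms(2) by simp
  ultimately have "f0 \<in> W0" "f1 \<in> W1" using f(1,2) d0(2) d1(2) by simp_all
  then have "f \<in> U" unfolding f(3) by (intro PQ(3) W0(3) W1(3))
  with U show False by simp
qed

text \<open>The infimum need not be attained. The factor 2 makes room for a near-minimizer, as long as the
  infimum is positive and finite.\<close>
lemma K_near_optimal:
  assumes "K X0 X1 t f < top" "K X0 X1 t f \<noteq> 0"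
  obtains f0 f1 where "f0 \<in> points X0" "f1 \<in> points X1" "f = f0 + f1"
    "ennreal (qnorm X0 f0 + t * qnorm X1 f1) \<le> ennreal 2 * K X0 X1 t f"
proof -
  have "K X0 X1 t f < ennreal 2 * K X0 X1 t f"
    using assms by (cases "K X0 X1 t f") (auto simp: ennreal_less_iff simp flip: ennreal_mult ennreal_numeral)
  then have "\<exists>y\<in>{ennreal (qnorm X0 f0 + t * qnorm X1 f1) |f0 f1. f0 \<in> points X0 \<and> f1 \<in> points X1 \<and> f = f0 + f1}.
      y < ennreal 2 * K X0 X1 t f"
    unfolding K_def[of X0 X1 t f] Inf_less_iff .
  then obtain f0 f1 where "f0 \<in> points X0" "f1 \<in> points X1" "f = f0 + f1"
    "ennreal (qnorm X0 f0 + t * qnorm X1 f1) < ennreal 2 * K X0 X1 t f" by blast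
  then show thesis by (intro that) auto
qed

section \<open>The Holmstedt formula and reiteration\<close>

definition K_dyadic :: "'v::real_vector qspace \<Rightarrow> 'v qspace \<Rightarrow> 'v \<Rightarrow> int \<Rightarrow> ennreal" where
  "K_dyadic A0 A1 f k = K A0 A1 (dyad k) f"

lemma finite_space_simps [simp]:
  "points (finite_space S N) = {f \<in> S. N f < top}" "qnorm (finite_space S N) f = enn2real (N f)"
  by (simp_all add: finite_space_def)

lemma sum_points_add:
  assumes "quasi_normed A0" "quasi_normed A1" "f \<in> sum_points A0 A1" "g \<in> sum_points A0 A1"
  shows "f + g \<in> sum_points A0 A1"
proof -
  obtain f0 f1 g0 g1 where "f = f0 + f1" "g = g0 + g1" "f0 \<in> points A0" "f1 \<in> points A1" "g0 \<in> points A0" "g1 \<in> points A1"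
    using assms(3,4) unfolding sum_points_def by blast
  moreover have "(f0 + f1) + (g0 + g1) = (f0 + g0) + (f1 + g1)" by (simp add: add_ac)
  ultimately show ?thesis
    using subspace_add[OF quasi_normedD(1)[OF assms(1)]] subspace_add[OF quasi_normedD(1)[OF assms(2)]]
    unfolding sum_points_def by blast
qed

lemma points_subset_sum:
  assumes "quasi_normed A0" "quasi_normed A1"
  shows "f \<in> points A0 \<Longrightarrow> f \<in> sum_points A0 A1" "f \<in> points A1 \<Longrightarrow> f \<in> sum_points A0 A1"
proof -
  have z: "0 \<in> points A0" "0 \<in> points A1"
    using subspace_0[OF quasi_normedD(1)[OF assms(1)]] subspace_0[OF quasi_normedD(1)[OF assms(2)]] .
  show "f \<in> sum_points A0 A1" if "f \<in> points A0"
    unfolding sum_points_def mem_Collect_eq by (rule exI[of _ f], rule exI[of _ 0]) (simp add: that z)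
  show "f \<in> sum_points A0 A1" if "f \<in> points A1"
    unfolding sum_points_def mem_Collect_eq by (rule exI[of _ 0], rule exI[of _ f]) (simp add: that z)
qed

lemma K_sum_finite:
  assumes "f \<in> sum_points A0 A1"
  shows "K A0 A1 t f < top"
proof -
  obtain f0 f1 where f: "f = f0 + f1" "f0 \<in> points A0" "f1 \<in> points A1"
    using assms unfolding sum_points_def by blast
  have "K A0 A1 t f \<le> ennreal (qnorm A0 f0 + t * qnorm A1 f1)" unfolding f(1) by (rule K_upper[OF f(2,3)])
  then show ?thesis by (rule order_le_less_trans) simp
qed

lemma K_le_qnorm:
  assumes "quasi_normed A0" "quasi_normed A1"
  shows "f \<in> points A0 \<Longrightarrow> K A0 A1 t f \<le> ennreal (qnorm A0 f)"
    and "f \<in> points A1 \<Longrightarrow> K A0 A1 t f \<le> ennreal (t * qnorm A1 f)"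
proof -
  have z: "0 \<in> points A0" "0 \<in> points A1"
    using subspace_0[OF quasi_normedD(1)[OF assms(1)]] subspace_0[OF quasi_normedD(1)[OF assms(2)]] .
  show "K A0 A1 t f \<le> ennreal (qnorm A0 f)" if "f \<in> points A0"
    using K_upper[OF that z(2), of t] quasi_normedD(3)[OF assms(2)] by simp
  show "K A0 A1 t f \<le> ennreal (t * qnorm A1 f)" if "f \<in> points A1"
    using K_upper[OF z(1) that, of t] quasi_normedD(3)[OF assms(1)] by simp
qed

lemma quasiconcave_K_dyadic:
  assumes "quasiconcave (\<lambda>t. K A0 A1 t f)" "i \<le> k"
  shows "K_dyadic A0 A1 f i \<le> K_dyadic A0 A1 f k" "K_dyadic A0 A1 f k \<le> ennreal (dyad k / dyad i) * K_dyadic A0 A1 f i"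
    "ennreal (dyad i / dyad k) * K_dyadic A0 A1 f k \<le> K_dyadic A0 A1 f i"
proof -
  show "K_dyadic A0 A1 f i \<le> K_dyadic A0 A1 f k" and le: "K_dyadic A0 A1 f k \<le> ennreal (dyad k / dyad i) * K_dyadic A0 A1 f i"
    unfolding K_dyadic_def using quasiconcaveD[OF assms(1) dyad_pos dyad_mono[OF assms(2)]] .
  have "ennreal (dyad i / dyad k) * K_dyadic A0 A1 f k \<le> ennreal (dyad i / dyad k) * (ennreal (dyad k / dyad i) * K_dyadic A0 A1 f i)"
    by (rule mult_left_mono[OF le]) simp
  also have "\<dots> = (ennreal (dyad i / dyad k) * ennreal (dyad k / dyad i)) * K_dyadic A0 A1 f i" by (simp only: mult.assoc)
  also have "ennreal (dyad i / dyad k) * ennreal (dyad k / dyad i) = 1" by (simp flip: ennreal_mult)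
  finally show "ennreal (dyad i / dyad k) * K_dyadic A0 A1 f k \<le> K_dyadic A0 A1 f i" by simp
qed

lemma add_twice_le:
  assumes "x \<le> ennreal C * (y + ennreal 2 * z)" "z \<le> y" "0 \<le> C"
  shows "x \<le> ennreal (3 * C) * y"
proof -
  have "y + ennreal 2 * z \<le> ennreal 1 * y + ennreal 2 * y"
    using mult_left_mono[OF assms(2), of "ennreal 2"] by (intro add_mono) auto
  also have "\<dots> = ennreal 3 * y" by (simp only: distrib_right[symmetric]) simp
  finally have "ennreal C * (y + ennreal 2 * z) \<le> ennreal C * (ennreal 3 * y)" by (rule mult_left_mono) simp
  also have "\<dots> = ennreal (3 * C) * y" using assms(3) by (simp only: ennreal_mult zero_le_numeral mult_ac)
  finally show ?thesis using assms(1) by (rule order_trans[rotated])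
qed

text \<open>A decomposition with cost at most twice \<open>K(2\<^sup>k)\<close> bounds each component directly on one side of \<open>k\<close>. On the
  other side the component is \<open>f\<close> minus the other component, and the triangle inequality
  applies. If \<open>K(2\<^sup>k)\<close> vanishes, so does \<open>f\<close>.\<close>
lemma good_decomposition:
  fixes A0 A1 :: "'v::hausdorff_tvs qspace"
  assumes "compatible_couple A0 A1"
  obtains c :: real where "0 < c"
    "\<And>f k. f \<in> sum_points A0 A1 \<Longrightarrow> \<exists>f0 f1. f = f0 + f1 \<and> f0 \<in> points A0 \<and> f1 \<in> points A1 \<and>
      (\<forall>i\<le>k. K_dyadic A0 A1 f0 i \<le> ennreal c * K_dyadic A0 A1 f i) \<and> (\<forall>i\<ge>k. K_dyadic A0 A1 f0 i \<le> ennreal c * K_dyadic A0 A1 f k) \<and>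
      (\<forall>i\<ge>k. K_dyadic A0 A1 f1 i \<le> ennreal c * K_dyadic A0 A1 f i) \<and>
      (\<forall>i\<le>k. K_dyadic A0 A1 f1 i \<le> ennreal (dyad i / dyad k) * (ennreal c * K_dyadic A0 A1 f k))"
proof -
  have qn: "quasi_normed A0" "quasi_normed A1" using assms by (auto simp: compatible_couple_def)
  note n0 = quasi_normedD[OF qn(1)] and n1 = quasi_normedD[OF qn(2)]
  obtain C :: real where C: "1 \<le> C" "\<And>t f g. 0 < t \<Longrightarrow> K A0 A1 t (f + g) \<le> ennreal C * (K A0 A1 t f + K A0 A1 t g)"
    using K_triangle[OF qn] by blast
  have C0: "0 \<le> C" using C(1) by simp
  have qc: "quasiconcave (\<lambda>t. K A0 A1 t f)" for f by (rule quasiconcave_K[OF n0(2) n1(2)])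
  let ?\<kappa> = "K_dyadic A0 A1"
  (* The triangle inequality gives C (K + 2 K), where 2 comes from near-optimality. *)
  show thesis
  proof (rule that[of "3 * C"])
    show "0 < 3 * C" using C(1) by simp
    fix f k assume f: "f \<in> sum_points A0 A1"
    show "\<exists>f0 f1. f = f0 + f1 \<and> f0 \<in> points A0 \<and> f1 \<in> points A1 \<and>
      (\<forall>i\<le>k. ?\<kappa> f0 i \<le> ennreal (3 * C) * ?\<kappa> f i) \<and> (\<forall>i\<ge>k. ?\<kappa> f0 i \<le> ennreal (3 * C) * ?\<kappa> f k) \<and>
      (\<forall>i\<ge>k. ?\<kappa> f1 i \<le> ennreal (3 * C) * ?\<kappa> f i) \<and>
      (\<forall>i\<le>k. ?\<kappa> f1 i \<le> ennreal (dyad i / dyad k) * (ennreal (3 * C) * ?\<kappa> f k))"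
    proof (cases "?\<kappa> f k = 0")
      case True
      then have "f = 0" using K_zero_imp[OF assms dyad_pos] by (simp add: K_dyadic_def)
      have z: "0 \<in> points A0" "0 \<in> points A1" using subspace_0[OF n0(1)] subspace_0[OF n1(1)] .
      have "?\<kappa> 0 i = 0" for i
        using K_le_qnorm(1)[OF qn z(1), of "dyad i"] n0(3) by (simp add: K_dyadic_def)
      then show ?thesis using z \<open>f = 0\<close> by (intro exI[of _ 0] conjI allI impI) simp_all
    next
      case False
      obtain f0 f1 where d: "f0 \<in> points A0" "f1 \<in> points A1" "f = f0 + f1"
        "ennreal (qnorm A0 f0 + dyad k * qnorm A1 f1) \<le> ennreal 2 * K A0 A1 (dyad k) f"
        using K_near_optimal[OF K_sum_finite[OF f]] False unfolding K_dyadic_def by blast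
      have nn: "0 \<le> qnorm A0 f0" "0 \<le> qnorm A1 f1" using d n0 n1 by auto
      have "ennreal (qnorm A0 f0) \<le> ennreal (qnorm A0 f0 + dyad k * qnorm A1 f1)"
        "ennreal (dyad k * qnorm A1 f1) \<le> ennreal (qnorm A0 f0 + dyad k * qnorm A1 f1)"
        using nn by (intro ennreal_leI; simp)+
      note q = this[THEN order_trans, OF d(4), folded K_dyadic_def]
      have K0: "?\<kappa> g i \<le> ennreal 2 * ?\<kappa> f k" if "g = f0 \<or> g = - f0" for g i
      proof -
        have "g \<in> points A0" "qnorm A0 g = qnorm A0 f0" using that d(1) subspace_neg[OF n0(1)] n0(4) by auto
        then have "?\<kappa> g i \<le> ennreal (qnorm A0 f0)" unfolding K_dyadic_def using K_le_qnorm(1)[OF qn, of g "dyad i"] by simp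
        also note q(1)
        finally show ?thesis .
      qed
      have K1: "?\<kappa> g i \<le> ennreal (dyad i / dyad k) * (ennreal 2 * ?\<kappa> f k)" if "g = f1 \<or> g = - f1" for g i
      proof -
        have "g \<in> points A1" "qnorm A1 g = qnorm A1 f1" using that d(2) subspace_neg[OF n1(1)] n1(4) by auto
        then have "?\<kappa> g i \<le> ennreal (dyad i * qnorm A1 f1)" unfolding K_dyadic_def using K_le_qnorm(2)[OF qn, of g "dyad i"] by simp
        also have "\<dots> = ennreal ((dyad i / dyad k) * (dyad k * qnorm A1 f1))" by simp
        also have "\<dots> = ennreal (dyad i / dyad k) * ennreal (dyad k * qnorm A1 f1)" by (rule ennreal_mult') simp
        also have "\<dots> \<le> ennreal (dyad i / dyad k) * (ennreal 2 * ?\<kappa> f k)" by (intro mult_left_mono q) simp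
        finally show ?thesis .
      qed
      have two: "ennreal 2 * x \<le> ennreal (3 * C) * x" for x
        using C(1) by (intro mult_right_mono ennreal_leI) auto
      have 1: "?\<kappa> f0 i \<le> ennreal (3 * C) * ?\<kappa> f i" if "i \<le> k" for i
      proof (rule add_twice_le[OF _ quasiconcave_K_dyadic(3)[OF qc that] C0])
        have "?\<kappa> f0 i = K A0 A1 (dyad i) (f + - f1)" using d(3) by (simp add: K_dyadic_def)
        also have "\<dots> \<le> ennreal C * (?\<kappa> f i + ?\<kappa> (- f1) i)" unfolding K_dyadic_def by (rule C(2)) simp
        also have "\<dots> \<le> ennreal C * (?\<kappa> f i + ennreal (dyad i / dyad k) * (ennreal 2 * ?\<kappa> f k))"
          by (intro mult_left_mono add_left_mono K1) auto
        also have "ennreal (dyad i / dyad k) * (ennreal 2 * ?\<kappa> f k) = ennreal 2 * (ennreal (dyad i / dyad k) * ?\<kappa> f k)"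
          by (simp only: mult_ac)
        finally show "?\<kappa> f0 i \<le> ennreal C * (?\<kappa> f i + ennreal 2 * (ennreal (dyad i / dyad k) * ?\<kappa> f k))" .
      qed
      have 2: "?\<kappa> f0 i \<le> ennreal (3 * C) * ?\<kappa> f k" for i
        by (rule order_trans[OF K0 two]) simp
      have 3: "?\<kappa> f1 i \<le> ennreal (3 * C) * ?\<kappa> f i" if "k \<le> i" for i
      proof (rule add_twice_le[OF _ quasiconcave_K_dyadic(1)[OF qc that] C0])
        have "?\<kappa> f1 i = K A0 A1 (dyad i) (f + - f0)" using d(3) by (simp add: K_dyadic_def)
        also have "\<dots> \<le> ennreal C * (?\<kappa> f i + ?\<kappa> (- f0) i)" unfolding K_dyadic_def by (rule C(2)) simp
        also have "\<dots> \<le> ennreal C * (?\<kappa> f i + ennreal 2 * ?\<kappa> f k)"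
          by (intro mult_left_mono add_left_mono K0) auto
        finally show "?\<kappa> f1 i \<le> ennreal C * (?\<kappa> f i + ennreal 2 * ?\<kappa> f k)" .
      qed
      have 4: "?\<kappa> f1 i \<le> ennreal (dyad i / dyad k) * (ennreal (3 * C) * ?\<kappa> f k)" for i
        by (rule order_trans[OF K1 mult_left_mono[OF two]]) simp_all
      show ?thesis using d 1 2 3 4 by (intro exI[of _ f0] exI[of _ f1] conjI allI impI) simp_all
    qed
  qed
qed

context sequence_weights
begin

lemma K_le_holmstedt:
  fixes A0 A1 :: "'v::hausdorff_tvs qspace"
  assumes cc: "compatible_couple A0 A1"
    and N0: "dominated (sum_points A0 A1) N0 (\<lambda>f. norm0 (K_dyadic A0 A1 f))" and N1: "dominated (sum_points A0 A1) N1 (\<lambda>f. norm1 (K_dyadic A0 A1 f))"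
  shows "dominated (sum_points A0 A1 \<times> UNIV)
    (\<lambda>z. K (finite_space (sum_points A0 A1) N0) (finite_space (sum_points A0 A1) N1) (\<rho> (dyad (snd z))) (fst z))
    (\<lambda>z. holmstedt (K_dyadic A0 A1 (fst z)) (snd z))"
proof -
  let ?S = "sum_points A0 A1" and ?\<kappa> = "K_dyadic A0 A1"
  let ?X0 = "finite_space ?S N0" and ?X1 = "finite_space ?S N1"
  have qn: "quasi_normed A0" "quasi_normed A1" using cc by (auto simp: compatible_couple_def)
  obtain c :: real where c: "0 < c"
    "\<And>f k. f \<in> ?S \<Longrightarrow> \<exists>f0 f1. f = f0 + f1 \<and> f0 \<in> points A0 \<and> f1 \<in> points A1 \<and>
      (\<forall>i\<le>k. ?\<kappa> f0 i \<le> ennreal c * ?\<kappa> f i) \<and> (\<forall>i\<ge>k. ?\<kappa> f0 i \<le> ennreal c * ?\<kappa> f k) \<and>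
      (\<forall>i\<ge>k. ?\<kappa> f1 i \<le> ennreal c * ?\<kappa> f i) \<and>
      (\<forall>i\<le>k. ?\<kappa> f1 i \<le> ennreal (dyad i / dyad k) * (ennreal c * ?\<kappa> f k))"
    using good_decomposition[OF cc] by blast
  let ?P0 = "{(g, f, k). g \<in> ?S \<and> (\<forall>i\<le>k. ?\<kappa> g i \<le> ennreal c * ?\<kappa> f i) \<and> (\<forall>i\<ge>k. ?\<kappa> g i \<le> ennreal c * ?\<kappa> f k)}"
  let ?P1 = "{(g, f, k). g \<in> ?S \<and> (\<forall>i\<ge>k. ?\<kappa> g i \<le> ennreal c * ?\<kappa> f i) \<and> (\<forall>i\<le>k. ?\<kappa> g i \<le> ennreal (dyad i / dyad k) * (ennreal c * ?\<kappa> f k))}"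
  let ?h = "\<lambda>z. (?\<kappa> (fst z), ?\<kappa> (fst (snd z)), snd (snd z))"
  have "dominated ?P0 (\<lambda>z. N0 (fst z)) (\<lambda>z. norm0 (?\<kappa> (fst z)))" by (rule dominated_comp[OF N0]) auto
  also have "dominated ?P0 \<dots> (\<lambda>z. holmstedt (?\<kappa> (fst (snd z))) (snd (snd z)))"
    using dominated_comp[OF norm0_le_holmstedt[of c], of ?P0 ?h] by (auto simp: case_prod_unfold)
  finally have c0': "dominated (?P0) (\<lambda>z. N0 (fst z)) (\<lambda>z. holmstedt (?\<kappa> (fst (snd z))) (snd (snd z)))" .
  obtain c0 :: real where c0: "0 < c0" "\<And>z. z \<in> ?P0 \<Longrightarrow> N0 (fst z) \<le> ennreal c0 * holmstedt (?\<kappa> (fst (snd z))) (snd (snd z))"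
    using dominatedE[OF c0'] by blast
  have "dominated ?P1 (\<lambda>z. \<rho>k (snd (snd z)) * N1 (fst z)) (\<lambda>z. \<rho>k (snd (snd z)) * norm1 (?\<kappa> (fst z)))"
    by (rule dominated_mult_left, rule dominated_comp[OF N1]) auto
  also have "dominated ?P1 \<dots> (\<lambda>z. holmstedt (?\<kappa> (fst (snd z))) (snd (snd z)))"
    using dominated_comp[OF norm1_le_holmstedt[of c], of ?P1 ?h] by (auto simp: case_prod_unfold)
  finally have c1': "dominated (?P1) (\<lambda>z. \<rho>k (snd (snd z)) * N1 (fst z)) (\<lambda>z. holmstedt (?\<kappa> (fst (snd z))) (snd (snd z)))" .
  obtain c1 :: real where c1: "0 < c1" "\<And>z. z \<in> ?P1 \<Longrightarrow> \<rho>k (snd (snd z)) * N1 (fst z) \<le> ennreal c1 * holmstedt (?\<kappa> (fst (snd z))) (snd (snd z))"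
    using dominatedE[OF c1'] by blast
  show ?thesis
  proof (rule dominatedI[where C = "c0 + c1"])
    fix z assume z: "z \<in> ?S \<times> (UNIV :: int set)"
    define f k where "f = fst z" and "k = snd z"
    have f: "f \<in> ?S" using z by (auto simp: f_def)
    obtain f0 f1 where d: "f = f0 + f1" "f0 \<in> points A0" "f1 \<in> points A1"
      "\<forall>i\<le>k. ?\<kappa> f0 i \<le> ennreal c * ?\<kappa> f i" "\<forall>i\<ge>k. ?\<kappa> f0 i \<le> ennreal c * ?\<kappa> f k"
      "\<forall>i\<ge>k. ?\<kappa> f1 i \<le> ennreal c * ?\<kappa> f i"
      "\<forall>i\<le>k. ?\<kappa> f1 i \<le> ennreal (dyad i / dyad k) * (ennreal c * ?\<kappa> f k)"
      using c(2)[OF f, of k] by blast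
    have S: "f0 \<in> ?S" "f1 \<in> ?S" using d points_subset_sum[OF qn] by auto
    have b0: "N0 f0 \<le> ennreal c0 * holmstedt (?\<kappa> f) k" using c0(2)[of "(f0, f, k)"] S d by auto
    have b1: "\<rho>k k * N1 f1 \<le> ennreal c1 * holmstedt (?\<kappa> f) k" using c1(2)[of "(f1, f, k)"] S d by auto
    have "K ?X0 ?X1 (\<rho> (dyad k)) f \<le> ennreal (c0 + c1) * holmstedt (?\<kappa> f) k"
    proof (cases "holmstedt (?\<kappa> f) k = top")
      case True
      then show ?thesis using c0(1) c1(1) by (simp add: ennreal_mult_top)
    next
      case False
      then have "N0 f0 < top" using b0 by (auto intro: order_le_less_trans simp: ennreal_mult_less_top less_top)
      moreover have "\<rho>k k * N1 f1 < top"
        by (rule order_le_less_trans[OF b1]) (use False in \<open>simp add: ennreal_mult_less_top less_top\<close>)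
      then have "N1 f1 < top" using pos(6)[of k] by (auto simp: ennreal_mult_less_top)
      ultimately have fin: "N0 f0 < top" "N1 f1 < top" by auto
      have "K ?X0 ?X1 (\<rho> (dyad k)) f \<le> ennreal (qnorm ?X0 f0 + \<rho> (dyad k) * qnorm ?X1 f1)"
        unfolding d(1) using S fin by (intro K_upper) auto
      also have "\<dots> = N0 f0 + \<rho>k k * N1 f1"
        using fin nonneg(6)[of k] by (simp add: ennreal_mult ennreal_enn2real)
      also have "\<dots> \<le> ennreal c0 * holmstedt (?\<kappa> f) k + ennreal c1 * holmstedt (?\<kappa> f) k" using b0 b1 by (rule add_mono)
      also have "\<dots> = ennreal (c0 + c1) * holmstedt (?\<kappa> f) k" using c0(1) c1(1) by (simp add: distrib_right)
      finally show ?thesis .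
    qed
    then show "K ?X0 ?X1 (\<rho> (dyad (snd z))) (fst z) \<le> ennreal (c0 + c1) * holmstedt (?\<kappa> (fst z)) (snd z)"
      by (simp add: f_def k_def)
  qed
qed

lemma holmstedt_le_K:
  fixes A0 A1 :: "'v::hausdorff_tvs qspace"
  assumes cc: "compatible_couple A0 A1"
    and N0: "dominated (sum_points A0 A1) (\<lambda>f. norm0 (K_dyadic A0 A1 f)) N0" and N1: "dominated (sum_points A0 A1) (\<lambda>f. norm1 (K_dyadic A0 A1 f)) N1"
  shows "dominated (sum_points A0 A1 \<times> UNIV) (\<lambda>z. holmstedt (K_dyadic A0 A1 (fst z)) (snd z))
    (\<lambda>z. K (finite_space (sum_points A0 A1) N0) (finite_space (sum_points A0 A1) N1) (\<rho> (dyad (snd z))) (fst z))"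
proof -
  let ?S = "sum_points A0 A1" and ?\<kappa> = "K_dyadic A0 A1"
  let ?X0 = "finite_space ?S N0" and ?X1 = "finite_space ?S N1"
  have qn: "quasi_normed A0" "quasi_normed A1" using cc by (auto simp: compatible_couple_def)
  note n0 = quasi_normedD[OF qn(1)] and n1 = quasi_normedD[OF qn(2)]
  obtain C :: real where C: "1 \<le> C" "\<And>t f g. 0 < t \<Longrightarrow> K A0 A1 t (f + g) \<le> ennreal C * (K A0 A1 t f + K A0 A1 t g)"
    using K_triangle[OF qn] by blast
  have qc: "quasiconcave (\<lambda>t. K A0 A1 t f)" for f by (rule quasiconcave_K[OF n0(2) n1(2)])
  have sc: "?\<kappa> f \<in> quasiconcave_seqs" for f
    unfolding quasiconcave_seqs_def using quasiconcave_K_dyadic(1,2)[OF qc] by blast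
  obtain c :: real where c: "0 < c" "\<And>z. z \<in> {z. \<forall>i. fst (fst z) i \<le> ennreal C * (fst (snd (fst z)) i + snd (snd (fst z)) i)} \<Longrightarrow>
      holmstedt (fst (fst z)) (snd z) \<le> ennreal c * (holmstedt (fst (snd (fst z))) (snd z) + holmstedt (snd (snd (fst z))) (snd z))"
    using dominatedE[OF holmstedt_add[of C]] by blast
  have "dominated (?S \<times> UNIV) (\<lambda>z. holmstedt (?\<kappa> (fst z)) (snd z)) (\<lambda>z. norm0 (?\<kappa> (fst z)))"
    using dominated_comp[OF holmstedt_le_norm0, of "?S \<times> UNIV" "\<lambda>z. (?\<kappa> (fst z), snd z)"] by simp
  also have "dominated (?S \<times> UNIV) \<dots> (\<lambda>z. N0 (fst z))" by (rule dominated_comp[OF N0]) auto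
  finally have c0': "dominated (?S \<times> UNIV) (\<lambda>z. holmstedt (?\<kappa> (fst z)) (snd z)) (\<lambda>z. N0 (fst z))" .
  obtain c0 :: real where c0: "0 < c0" "\<And>z. z \<in> ?S \<times> UNIV \<Longrightarrow> holmstedt (?\<kappa> (fst z)) (snd z) \<le> ennreal c0 * N0 (fst z)"
    using dominatedE[OF c0'] by blast
  have "dominated (?S \<times> UNIV) (\<lambda>z. holmstedt (?\<kappa> (fst z)) (snd z)) (\<lambda>z. \<rho>k (snd z) * norm1 (?\<kappa> (fst z)))"
    using dominated_comp[OF holmstedt_le_norm1, of "?S \<times> UNIV" "\<lambda>z. (?\<kappa> (fst z), snd z)"] sc by simp
  also have "dominated (?S \<times> UNIV) \<dots> (\<lambda>z. \<rho>k (snd z) * N1 (fst z))" by (rule dominated_mult_left, rule dominated_comp[OF N1]) auto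
  finally have c1': "dominated (?S \<times> UNIV) (\<lambda>z. holmstedt (?\<kappa> (fst z)) (snd z)) (\<lambda>z. (\<rho>k (snd z) * N1 (fst z)))" .
  obtain c1 :: real where c1: "0 < c1" "\<And>z. z \<in> ?S \<times> UNIV \<Longrightarrow> holmstedt (?\<kappa> (fst z)) (snd z) \<le> ennreal c1 * (\<rho>k (snd z) * N1 (fst z))"
    using dominatedE[OF c1'] by blast
  define D where "D = max c0 c1"
  have D: "0 < D" "c0 \<le> D" "c1 \<le> D" using c0(1) by (auto simp: D_def)
  show ?thesis
  proof (rule dominatedI[where C = "c * D"])
    fix z assume z: "z \<in> ?S \<times> (UNIV :: int set)"
    show "holmstedt (?\<kappa> (fst z)) (snd z) \<le> ennreal (c * D) * K ?X0 ?X1 (\<rho> (dyad (snd z))) (fst z)"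
      unfolding K_def[of ?X0 ?X1]
    proof (rule le_cmult_Inf)
      show "0 < c * D" using c(1) D by simp
      fix y assume "y \<in> {ennreal (qnorm ?X0 f0 + \<rho> (dyad (snd z)) * qnorm ?X1 f1) |f0 f1.
          f0 \<in> points ?X0 \<and> f1 \<in> points ?X1 \<and> fst z = f0 + f1}"
      then obtain f0 f1 where f: "f0 \<in> points ?X0" "f1 \<in> points ?X1" "fst z = f0 + f1"
        and y: "y = ennreal (qnorm ?X0 f0 + \<rho> (dyad (snd z)) * qnorm ?X1 f1)" by blast
      have S: "f0 \<in> ?S" "f1 \<in> ?S" and fin: "N0 f0 < top" "N1 f1 < top" using f by auto
      have y': "y = N0 f0 + \<rho>k (snd z) * N1 f1"
        unfolding y using fin nonneg(6)[of "snd z"] by (simp add: ennreal_mult ennreal_enn2real)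
      have "\<forall>i. ?\<kappa> (fst z) i \<le> ennreal C * (?\<kappa> f0 i + ?\<kappa> f1 i)"
        unfolding f(3) K_dyadic_def by (intro allI C(2)) simp
      then have "holmstedt (?\<kappa> (fst z)) (snd z) \<le> ennreal c * (holmstedt (?\<kappa> f0) (snd z) + holmstedt (?\<kappa> f1) (snd z))"
        using c(2)[of "((?\<kappa> (fst z), ?\<kappa> f0, ?\<kappa> f1), snd z)"] by simp
      also have "\<dots> \<le> ennreal c * (ennreal D * N0 f0 + ennreal D * (\<rho>k (snd z) * N1 f1))"
        using le_mult_ennreal_mono[OF c0(2)[of "(f0, snd z)"] D(2)] le_mult_ennreal_mono[OF c1(2)[of "(f1, snd z)"] D(3)] S
        by (intro mult_left_mono add_mono) auto
      also have "\<dots> = ennreal (c * D) * y"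
        unfolding y' using c(1) D by (simp add: ennreal_mult distrib_left mult.assoc)
      finally show "holmstedt (?\<kappa> (fst z)) (snd z) \<le> ennreal (c * D) * y" .
    qed
  qed
qed

end

text \<open>The space \<open>T\<close> on which the first norm is defined may be smaller than \<open>S\<close>. It must then contain all elements of
  finite norm.\<close>
lemma space_eqI:
  assumes Y: "points Y = {f \<in> S. N f < top}" "\<And>f. f \<in> points Y \<Longrightarrow> qnorm Y f = enn2real (N f)"
    and T: "T \<subseteq> S" "\<And>f. f \<in> S \<Longrightarrow> M f < top \<Longrightarrow> f \<in> T"
    and MN: "dominated S M N" "dominated S N M"
  shows "space_eq (finite_space T M) Y"
proof -
  obtain c :: real where c: "0 < c" "\<And>f. f \<in> S \<Longrightarrow> M f \<le> ennreal c * N f" using dominatedE[OF MN(1)] by blast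
  obtain d :: real where d: "0 < d" "\<And>f. f \<in> S \<Longrightarrow> N f \<le> ennreal d * M f" using dominatedE[OF MN(2)] by blast
  have less: "x < top" if "x \<le> ennreal c * y" "y < top" for x y and c :: real
    using that by (auto intro: order_le_less_trans simp: ennreal_mult_less_top)
  have real: "enn2real x \<le> c * enn2real y" if "x \<le> ennreal c * y" "y < top" "0 < c" for x y and c :: real
  proof -
    have "enn2real x \<le> enn2real (ennreal c * y)"
      using that by (intro enn2real_mono) (simp_all add: ennreal_mult_less_top)
    then show ?thesis using that(3) by (simp add: enn2real_mult)
  qed
  have pts: "points (finite_space T M) = points Y"
    using T less[OF c(2)] less[OF d(2)] unfolding Y(1) by auto
  show ?thesis unfolding space_eq_def cont_embedded_def pts
  proof (intro conjI order_refl exI ballI)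
    fix f assume f: "f \<in> points Y"
    then have f': "f \<in> S" "N f < top" "M f < top" using Y(1) less[OF c(2)] by auto
    show "qnorm Y f \<le> d * qnorm (finite_space T M) f"
      using real[OF d(2)[OF f'(1)] f'(3) d(1)] Y(2)[OF f] by simp
    show "qnorm (finite_space T M) f \<le> c * qnorm Y f"
      using real[OF c(2)[OF f'(1)] f'(2) c(1)] Y(2)[OF f] by simp
  qed
qed

context sequence_weights
begin

text \<open>The last claim holds because an element outside \<open>X\<^sub>0 + X\<^sub>1\<close> has an infinite K-functional, the
  infimum of the empty set.\<close>
lemma reiteration_norm:
  fixes A0 A1 :: "'v::hausdorff_tvs qspace"
  assumes cc: "compatible_couple A0 A1"
    and N0: "dominated (sum_points A0 A1) N0 (\<lambda>f. norm0 (K_dyadic A0 A1 f))" "dominated (sum_points A0 A1) (\<lambda>f. norm0 (K_dyadic A0 A1 f)) N0"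
    and N1: "dominated (sum_points A0 A1) N1 (\<lambda>f. norm1 (K_dyadic A0 A1 f))" "dominated (sum_points A0 A1) (\<lambda>f. norm1 (K_dyadic A0 A1 f)) N1"
    and s: "0 < s" and \<omega>: "regvar 0 \<omega>"
  defines "X0 \<equiv> finite_space (sum_points A0 A1) N0" and "X1 \<equiv> finite_space (sum_points A0 A1) N1"
  shows "dominated (sum_points A0 A1) (\<lambda>f. wnorm s \<theta> \<omega> {0<..} (\<lambda>t. K X0 X1 t f))
      (\<lambda>f. snorm s (\<lambda>k. weight (\<lambda>u. \<omega> (\<rho> u)) \<theta> k * holmstedt (K_dyadic A0 A1 f) k))"
    and "dominated (sum_points A0 A1) (\<lambda>f. snorm s (\<lambda>k. weight (\<lambda>u. \<omega> (\<rho> u)) \<theta> k * holmstedt (K_dyadic A0 A1 f) k))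
      (\<lambda>f. wnorm s \<theta> \<omega> {0<..} (\<lambda>t. K X0 X1 t f))"
    and "sum_points X0 X1 \<subseteq> sum_points A0 A1"
    and "\<And>f. f \<in> sum_points A0 A1 \<Longrightarrow> wnorm s \<theta> \<omega> {0<..} (\<lambda>t. K X0 X1 t f) < top \<Longrightarrow> f \<in> sum_points X0 X1"
proof -
  let ?S = "sum_points A0 A1"
  have qn: "quasi_normed A0" "quasi_normed A1" using cc by (auto simp: compatible_couple_def)
  have qc: "quasiconcave (\<lambda>t. K X0 X1 t f)" for f by (rule quasiconcave_K) (auto simp: X0_def X1_def)
  let ?G = "\<lambda>f t. ennreal (t powr (- \<theta>) * \<omega> t) * K X0 X1 t f"
  have full: "dominated ?S (\<lambda>f. wnorm s \<theta> \<omega> {0<..} (\<lambda>t. K X0 X1 t f)) (\<lambda>f. snorm s (\<lambda>k. ?G f (dyad k)))"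
    "dominated ?S (\<lambda>f. snorm s (\<lambda>k. ?G f (dyad k))) (\<lambda>f. wnorm s \<theta> \<omega> {0<..} (\<lambda>t. K X0 X1 t f))"
    by (rule wnorm_full[OF s \<omega> sampled_quasiconcave], rule qc)+
  have w: "regvar (- \<theta> + 0) (\<lambda>t. t powr (- \<theta>) * \<omega> t)" by (intro regvar_mult regvar_powr_id \<omega>)
  have comp: "comparable ?S ?G" by (rule comparable_weight[OF w qc])
  have "0 < 1 - \<theta>0" using \<theta>0 by simp
  note cv = snorm_change_variable[OF s \<rho> this comp]
  have HK: "dominated ?S (\<lambda>f. snorm s (\<lambda>k. ?G f (\<rho> (dyad k)))) (\<lambda>f. snorm s (\<lambda>k. weight (\<lambda>u. \<omega> (\<rho> u)) \<theta> k * holmstedt (K_dyadic A0 A1 f) k))"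
    "dominated ?S (\<lambda>f. snorm s (\<lambda>k. weight (\<lambda>u. \<omega> (\<rho> u)) \<theta> k * holmstedt (K_dyadic A0 A1 f) k)) (\<lambda>f. snorm s (\<lambda>k. ?G f (\<rho> (dyad k))))"
    unfolding weight_def X0_def X1_def
    by (rule dominated_snorm'[OF s], rule dominated_mult_left, rule K_le_holmstedt[OF cc N0(1) N1(1)])
       (rule dominated_snorm'[OF s], rule dominated_mult_left, rule holmstedt_le_K[OF cc N0(2) N1(2)])
  show "dominated ?S (\<lambda>f. wnorm s \<theta> \<omega> {0<..} (\<lambda>t. K X0 X1 t f)) (\<lambda>f. snorm s (\<lambda>k. weight (\<lambda>u. \<omega> (\<rho> u)) \<theta> k * holmstedt (K_dyadic A0 A1 f) k))"
    by (rule dominated_trans[OF full(1) dominated_trans[OF cv(2) HK(1)]])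
  show "dominated ?S (\<lambda>f. snorm s (\<lambda>k. weight (\<lambda>u. \<omega> (\<rho> u)) \<theta> k * holmstedt (K_dyadic A0 A1 f) k)) (\<lambda>f. wnorm s \<theta> \<omega> {0<..} (\<lambda>t. K X0 X1 t f))"
    by (rule dominated_trans[OF HK(2) dominated_trans[OF cv(1) full(2)]])
  show "sum_points X0 X1 \<subseteq> ?S"
  proof
    fix f assume "f \<in> sum_points X0 X1"
    then obtain f0 f1 where "f = f0 + f1" "f0 \<in> points X0" "f1 \<in> points X1" unfolding sum_points_def by blast
    then show "f \<in> ?S" using sum_points_add[OF qn] by (auto simp: X0_def X1_def)
  qed
  fix f assume f: "f \<in> ?S" "wnorm s \<theta> \<omega> {0<..} (\<lambda>t. K X0 X1 t f) < top"
  obtain c :: real where c: "0 < c" "\<And>f. f \<in> ?S \<Longrightarrow> snorm s (\<lambda>k. ?G f (dyad k)) \<le> ennreal c * wnorm s \<theta> \<omega> {0<..} (\<lambda>t. K X0 X1 t f)"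
    using dominatedE[OF full(2)] by blast
  have "?G f (dyad 0) \<le> snorm s (\<lambda>k. ?G f (dyad k))" by (rule snorm_point[OF s])
  also have "\<dots> \<le> ennreal c * wnorm s \<theta> \<omega> {0<..} (\<lambda>t. K X0 X1 t f)" by (rule c(2)[OF f(1)])
  also have "\<dots> < top" using f(2) by (simp add: ennreal_mult_less_top)
  finally have "K X0 X1 (dyad 0) f < top"
    using regvar_pos[OF w dyad_pos, of 0] by (auto simp: ennreal_mult_less_top)
  then have "\<exists>y\<in>{ennreal (qnorm X0 f0 + dyad 0 * qnorm X1 f1) |f0 f1. f0 \<in> points X0 \<and> f1 \<in> points X1 \<and> f = f0 + f1}. y < top"
    unfolding K_def Inf_less_iff .
  then show "f \<in> sum_points X0 X1" unfolding sum_points_def by blast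
qed

end

lemma sampled_at_dyad:
  assumes "sampled (UNIV :: unit set) (\<lambda>_. N) (\<lambda>_. X)" "\<And>t. 0 < t \<Longrightarrow> N t < \<infinity>"
  shows "dominated UNIV X (\<lambda>k. ennreal (enn2real (N (dyad k))))" "dominated UNIV (\<lambda>k. ennreal (enn2real (N (dyad k)))) X"
proof -
  obtain c :: real where c: "0 < c" "\<And>p k u. p \<in> (UNIV :: unit set) \<Longrightarrow> u \<in> block k \<Longrightarrow> N u \<le> ennreal c * X k"
    "\<And>p k u. p \<in> (UNIV :: unit set) \<Longrightarrow> u \<in> block k \<Longrightarrow> X k \<le> ennreal c * N u"
    using sampledE[OF assms(1)] by blast
  have N: "ennreal (enn2real (N (dyad k))) = N (dyad k)" for k
    using assms(2)[OF dyad_pos, of k] by simp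
  have d: "dyad k \<in> block k" for k by (simp add: dyad_add)
  show "dominated UNIV X (\<lambda>k. ennreal (enn2real (N (dyad k))))" "dominated UNIV (\<lambda>k. ennreal (enn2real (N (dyad k)))) X"
    unfolding N by (rule dominatedI[where C = c], rule c(3)[OF UNIV_I d]) (rule dominatedI[where C = c], rule c(2)[OF UNIV_I d])
qed

text \<open>The finiteness assumption on \<open>\<chi>\<^sub>1(1)\<close> makes its discrete counterpart finite at index 0, and slow variation extends this to all
  indices. Finiteness of \<open>\<beta>\<close> then follows from \<open>\<beta> a\<^sub>1 \<lesssim> \<chi>\<^sub>1\<close>.\<close>
lemma sequence_weights_limiting:
  assumes "0 < q1" "0 < r1" "0 < r0" "a1 \<in> SV" "b1 \<in> SV" "b0 \<in> SV" "0 < \<theta>0" "\<theta>0 < 1"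
    and fin: "wnorm r1 0 b1 {0<..<1} (\<lambda>s. wnorm q1 0 a1 {s<..<1} (\<lambda>u. 1)) < \<infinity>"
  shows "sequence_weights q1 r1 r0 a1 b1 (\<lambda>u. u powr (- \<theta>0) * b0 u) (chi r1 b1 q1 a1)
    (\<lambda>t. enn2real (wnorm r1 0 b1 {0<..<t} (\<lambda>s. 1))) (rho \<theta>0 b0 (chi r1 b1 q1 a1)) \<theta>0"
proof -
  note a = regvar_SV[OF assms(4)] and b = regvar_SV[OF assms(5)] and b0 = regvar_SV[OF assms(6)]
  let ?a = "\<lambda>k. ennreal (a1 (dyad k))" and ?b = "\<lambda>k. ennreal (b1 (dyad k))"
  let ?N = "\<lambda>t. wnorm r1 0 b1 {0<..<t} (\<lambda>s. wnorm q1 0 a1 {s<..<t} (\<lambda>u. 1))"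
  let ?X = "\<lambda>k. snorm_on r1 {..k} (\<lambda>j. ?b j * snorm_on q1 {j..k} ?a)"
  let ?B = "\<lambda>k. snorm_on r1 {..k} ?b"
  have ab: "0 < ?a k" "0 < ?b k" for k using regvar_pos[OF a dyad_pos] regvar_pos[OF b dyad_pos] by simp_all
  have sX: "sampled (UNIV :: unit set) (\<lambda>_. ?N) (\<lambda>_. ?X)" by (rule sampled_chi[OF assms(1,2) a b])
  have slowX: "slow ?X" by (rule slow_chi[OF assms(1,2) slow_regvar[OF a] slow_regvar[OF b]])
  have "1 \<in> block 0" by (simp add: dyad_def)
  obtain c :: real where c: "0 < c" "\<And>p k u. p \<in> (UNIV :: unit set) \<Longrightarrow> u \<in> block k \<Longrightarrow> ?N u \<le> ennreal c * ?X k"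
    "\<And>p k u. p \<in> (UNIV :: unit set) \<Longrightarrow> u \<in> block k \<Longrightarrow> ?X k \<le> ennreal c * ?N u"
    using sampledE[OF sX] by blast
  have "?X 0 \<le> ennreal c * ?N 1" by (rule c(3)[OF UNIV_I \<open>1 \<in> block 0\<close>])
  also have "\<dots> < top" using fin by (simp add: ennreal_mult_less_top)
  finally have X0: "?X 0 < \<infinity>" by simp
  have aB: "?a k * ?B k \<le> ?X k" for k
    unfolding snorm_on_cmult[OF assms(2), symmetric]
  proof (intro snorm_on_mono assms(2) conjI)
    fix j assume "j \<in> {..k}"
    then have "?a k \<le> snorm_on q1 {j..k} ?a" by (intro snorm_on_point assms(1)) simp
    then show "?a k * ?b j \<le> ?b j * snorm_on q1 {j..k} ?a"
      by (subst mult.commute) (rule mult_left_mono, simp_all)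
  qed auto
  have Bpos: "0 < ?B k" for k
  proof -
    have "?b k \<le> ?B k" by (rule snorm_on_point[OF assms(2), of k "{..k}" ?b]) simp
    with ab(2)[of k] show ?thesis by (rule order_less_le_trans)
  qed
  have Xpos: "0 < ?X k" for k
  proof -
    have "0 < ?a k * ?B k" using ab(1) Bpos by (simp only: ennreal_zero_less_mult_iff)
    then show ?thesis using aB by (rule order_less_le_trans)
  qed
  have "?a 0 * ?B 0 < top" using aB[of 0] X0 by (simp add: order_le_less_trans)
  then have B0: "?B 0 < \<infinity>" using ab(1)[of 0] by (auto simp: ennreal_mult_less_top)
  have "sampled (UNIV :: unit set) (\<lambda>_ t. wnorm r1 0 b1 {0<..<t} (\<lambda>s. 1)) (\<lambda>_ k. snorm_on r1 {..k} (\<lambda>i. wt 0 b1 i * 1))"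
    by (rule sampled_head[OF assms(2) b sampled_const steady_const])
  then have sB: "sampled (UNIV :: unit set) (\<lambda>_ t. wnorm r1 0 b1 {0<..<t} (\<lambda>s. 1)) (\<lambda>_. ?B)" by simp
  have slowB: "slow ?B" by (rule slow_head[OF assms(2) slow_regvar[OF b]])
  note rX = regvar_enn2real[OF sX slowX X0 Xpos]
  note rB = regvar_enn2real[OF sB slowB B0 Bpos]
  have chi: "regvar 0 (chi r1 b1 q1 a1)" using rX(1) by (simp add: chi_def[abs_def])
  have "regvar ((1 - \<theta>0) + (0 + - 0)) (\<lambda>t. t powr (1 - \<theta>0) * (b0 t * (1 / chi r1 b1 q1 a1 t)))"
    by (intro regvar_mult regvar_powr_id regvar_inverse b0 chi)
  then have rho: "regvar (1 - \<theta>0) (rho \<theta>0 b0 (chi r1 b1 q1 a1))" by (simp add: rho_def[abs_def])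
  have v: "regvar (- \<theta>0) (\<lambda>u. u powr (- \<theta>0) * b0 u)"
    using regvar_mult[OF regvar_powr_id[of "- \<theta>0"] b0] by simp
  show ?thesis
  proof
    show "rho \<theta>0 b0 (chi r1 b1 q1 a1) (dyad k) * chi r1 b1 q1 a1 (dyad k) = dyad k * (dyad k powr - \<theta>0 * b0 (dyad k))" for k
      using regvar_pos[OF chi dyad_pos, of k] by (simp add: rho_def powr_diff powr_minus field_simps)
    show "dominated UNIV ?X (\<lambda>k. ennreal (chi r1 b1 q1 a1 (dyad k)))"
      unfolding chi_def by (rule sampled_at_dyad(1)[OF sX], rule rX(2))
    show "dominated UNIV (\<lambda>k. ennreal (chi r1 b1 q1 a1 (dyad k))) ?X"
      unfolding chi_def by (rule sampled_at_dyad(2)[OF sX], rule rX(2))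
    show "dominated UNIV ?B (\<lambda>k. ennreal (enn2real (wnorm r1 0 b1 {0<..<dyad k} (\<lambda>s. 1))))"
      by (rule sampled_at_dyad(1)[OF sB], rule rB(2))
    show "dominated UNIV (\<lambda>k. ennreal (enn2real (wnorm r1 0 b1 {0<..<dyad k} (\<lambda>s. 1)))) ?B"
      by (rule sampled_at_dyad(2)[OF sB], rule rB(2))
  qed (use assms a b chi rB(1) v rho in auto)
qed

theorem theorem44:
  fixes A0 A1 :: "'v::hausdorff_tvs qspace"
    and q1 r1 r r0 :: ennreal
    and a1 b1 a b0 \<chi>1 \<rho> :: "real \<Rightarrow> real"
    and \<theta>0 :: real
  assumes "compatible_couple A0 A1" and "quasi_banach A0" and "quasi_banach A1"
    and "points A0 \<inter> points A1 \<noteq> {0}"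
    and "0 < q1" and "0 < r1"
    and "a1 \<in> SV" and "b1 \<in> SV"
    and "wnorm r1 0 b1 {0<..<1} (\<lambda>s. wnorm q1 0 a1 {s<..<1} (\<lambda>u. 1)) < \<infinity>"
    and "0 < \<theta>0" and "\<theta>0 < 1"
    and "0 < r" and "0 < r0"
    and "a \<in> SV" and "b0 \<in> SV"
    and "\<chi>1 = chi r1 b1 q1 a1"
    and "\<rho> = rho \<theta>0 b0 \<chi>1"
  shows
    "(\<forall>\<theta>. 0 < \<theta> \<and> \<theta> < 1 \<longrightarrow>
        space_eq
          (interp (interp A0 A1 \<theta>0 r0 b0) (interp_R A0 A1 1 r1 b1 q1 a1) \<theta> r a)
          (interp A0 A1 ((1 - \<theta>) * \<theta>0 + \<theta>) r (a_sharp \<theta> b0 \<chi>1 a \<rho>))) \<and>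
     (wnorm r 0 a {1<..} (\<lambda>s. 1) < \<infinity> \<longrightarrow>
        space_eq
          (interp (interp A0 A1 \<theta>0 r0 b0) (interp_R A0 A1 1 r1 b1 q1 a1) 0 r a)
          (interp_L A0 A1 \<theta>0 r (a \<circ> \<rho>) r0 b0)) \<and>
     (wnorm r 0 a {0<..<1} (\<lambda>s. 1) < \<infinity> \<longrightarrow>
        space_eq
          (interp (interp A0 A1 \<theta>0 r0 b0) (interp_R A0 A1 1 r1 b1 q1 a1) 1 r a)
          (space_inter (interp A0 A1 1 r (a_sharp 1 b0 \<chi>1 a \<rho>))
             (space_inter (interp_R A0 A1 1 r (B_one r1 b1 a \<rho>) q1 a1)
                (interp_RR A0 A1 1 r (a \<circ> \<rho>) r1 b1 q1 a1))))"
proof -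
  let ?\<beta> = "\<lambda>t. enn2real (wnorm r1 0 b1 {0<..<t} (\<lambda>s. 1))"
  let ?v = "\<lambda>u. u powr (- \<theta>0) * b0 u"
  interpret W: sequence_weights q1 r1 r0 a1 b1 ?v \<chi>1 ?\<beta> \<rho> \<theta>0
    unfolding assms(16,17) using assms by (intro sequence_weights_limiting)
  let ?S = "sum_points A0 A1" and ?\<kappa> = "K_dyadic A0 A1"
  have qn: "quasi_normed A0" "quasi_normed A1" using assms(1) by (auto simp: compatible_couple_def)
  have qc: "quasiconcave (\<lambda>t. K A0 A1 t f)" for f
    by (rule quasiconcave_K[OF quasi_normedD(2)[OF qn(1)] quasi_normedD(2)[OF qn(2)]])
  have samp: "sampled ?S (\<lambda>f t. K A0 A1 t f) ?\<kappa>" and stead: "steady ?S ?\<kappa>"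
    using sampled_quasiconcave[of ?S "\<lambda>f t. K A0 A1 t f"] steady_quasiconcave[of ?S "\<lambda>f t. K A0 A1 t f"] qc
    unfolding K_dyadic_def[abs_def] by simp_all
  have ra: "regvar 0 a" by (rule regvar_SV[OF assms(14)])
  have rb0: "regvar 0 b0" by (rule regvar_SV[OF assms(15)])
  have r\<alpha>: "regvar 0 (\<lambda>u. a (\<rho> u))" by (rule regvar_comp[OF ra W.\<rho>])
  have wt0: "wt 0 w k = ennreal (w (dyad k))" for w k by simp

  let ?N0 = "\<lambda>f. wnorm r0 \<theta>0 b0 {0<..} (\<lambda>u. K A0 A1 u f)"
  let ?N1 = "\<lambda>f. wnorm r1 0 b1 {0<..} (\<lambda>t. wnorm q1 1 a1 {t<..} (\<lambda>u. K A0 A1 u f))"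
  have N0: "dominated ?S ?N0 (\<lambda>f. W.norm0 (?\<kappa> f))" "dominated ?S (\<lambda>f. W.norm0 (?\<kappa> f)) ?N0"
    unfolding W.norm0_def by (rule wnorm_full[OF assms(13) rb0 samp])+
  have sR: "sampled ?S (\<lambda>f t. wnorm q1 1 a1 {t<..} (\<lambda>u. K A0 A1 u f)) (\<lambda>f. W.tail_norm (?\<kappa> f))"
    unfolding W.tail_norm_def[abs_def] by (rule sampled_tail[OF assms(5) W.a samp stead])
  have "regvar (- 1 + 0) (\<lambda>u. u powr (- 1) * a1 u)" by (intro regvar_mult regvar_powr_id W.a)
  from steady_tail[OF assms(5) steady_weight[OF this stead]]
  have stR: "steady ?S (\<lambda>f. W.tail_norm (?\<kappa> f))" unfolding W.tail_norm_def[abs_def] .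
  have N1: "dominated ?S ?N1 (\<lambda>f. W.norm1 (?\<kappa> f))" "dominated ?S (\<lambda>f. W.norm1 (?\<kappa> f)) ?N1"
    unfolding W.norm1_def using wnorm_full[OF assms(6) W.b sR, of 0] unfolding wt0 .
  note reit = W.reiteration_norm[OF assms(1) N0 N1 assms(12) ra]
  have X: "interp A0 A1 \<theta>0 r0 b0 = finite_space ?S ?N0" "interp_R A0 A1 1 r1 b1 q1 a1 = finite_space ?S ?N1"
    by (simp_all add: interp_def interp_R_def)

  have sharp: "dyad k powr (- ((1 - \<theta>) * \<theta>0 + \<theta>)) * a_sharp \<theta> b0 \<chi>1 a \<rho> (dyad k)
      = \<rho> (dyad k) powr (- \<theta>) * a (\<rho> (dyad k)) * ?v (dyad k)" for \<theta> k
  proof -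
    have p: "0 < b0 (dyad k)" "0 < \<chi>1 (dyad k)" using regvar_pos[OF rb0 dyad_pos] regvar_pos[OF W.\<xi> dyad_pos] by auto
    have "(b0 (dyad k) / \<chi>1 (dyad k)) powr (- \<theta>) = b0 (dyad k) powr (- \<theta>) * \<chi>1 (dyad k) powr \<theta>"
      using p by (simp add: powr_divide powr_minus field_simps)
    then have "\<rho> (dyad k) powr (- \<theta>) = dyad k powr ((1 - \<theta>0) * - \<theta>) * (b0 (dyad k) powr (- \<theta>) * \<chi>1 (dyad k) powr \<theta>)"
      unfolding assms(17) rho_def by (simp only: powr_mult powr_powr)
    moreover have "dyad k powr (- ((1 - \<theta>) * \<theta>0 + \<theta>)) = dyad k powr ((1 - \<theta>0) * - \<theta>) * dyad k powr (- \<theta>0)"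
      by (simp add: powr_add[symmetric] algebra_simps)
    moreover have "b0 (dyad k) powr (1 - \<theta>) = b0 (dyad k) powr (- \<theta>) * b0 (dyad k)"
      using p(1) by (simp add: powr_diff powr_minus field_simps)
    ultimately show ?thesis by (simp add: a_sharp_def mult_ac)
  qed
  have rsharp: "regvar 0 (a_sharp \<theta> b0 \<chi>1 a \<rho>)" for \<theta>
    using regvar_mult[OF regvar_mult[OF regvar_powr[OF rb0, of "1 - \<theta>"] regvar_powr[OF W.\<xi>, of \<theta>]] r\<alpha>]
    by (simp add: a_sharp_def[abs_def])
  have Nsharp: "dominated ?S (\<lambda>f. wnorm r ((1 - \<theta>) * \<theta>0 + \<theta>) (a_sharp \<theta> b0 \<chi>1 a \<rho>) {0<..} (\<lambda>u. K A0 A1 u f))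
      (\<lambda>f. snorm r (\<lambda>k. W.weight (\<lambda>u. a (\<rho> u)) \<theta> k * (ennreal (?v (dyad k)) * ?\<kappa> f k)))"
    "dominated ?S (\<lambda>f. snorm r (\<lambda>k. W.weight (\<lambda>u. a (\<rho> u)) \<theta> k * (ennreal (?v (dyad k)) * ?\<kappa> f k)))
      (\<lambda>f. wnorm r ((1 - \<theta>) * \<theta>0 + \<theta>) (a_sharp \<theta> b0 \<chi>1 a \<rho>) {0<..} (\<lambda>u. K A0 A1 u f))" for \<theta>
  proof -
    have "wt ((1 - \<theta>) * \<theta>0 + \<theta>) (a_sharp \<theta> b0 \<chi>1 a \<rho>) k * x = W.weight (\<lambda>u. a (\<rho> u)) \<theta> k * (ennreal (?v (dyad k)) * x)" for k x
      unfolding sharp mult.assoc[of "W.weight _ _ _", symmetric] using W.weight_mult[OF W.nonneg(5)] by simp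
    note full = wnorm_full[OF assms(12) rsharp samp, of "(1 - \<theta>) * \<theta>0 + \<theta>" \<theta>, unfolded this]
    show "dominated ?S (\<lambda>f. wnorm r ((1 - \<theta>) * \<theta>0 + \<theta>) (a_sharp \<theta> b0 \<chi>1 a \<rho>) {0<..} (\<lambda>u. K A0 A1 u f))
      (\<lambda>f. snorm r (\<lambda>k. W.weight (\<lambda>u. a (\<rho> u)) \<theta> k * (ennreal (?v (dyad k)) * ?\<kappa> f k)))"
      "dominated ?S (\<lambda>f. snorm r (\<lambda>k. W.weight (\<lambda>u. a (\<rho> u)) \<theta> k * (ennreal (?v (dyad k)) * ?\<kappa> f k)))
      (\<lambda>f. wnorm r ((1 - \<theta>) * \<theta>0 + \<theta>) (a_sharp \<theta> b0 \<chi>1 a \<rho>) {0<..} (\<lambda>u. K A0 A1 u f))"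
      by (rule full)+
  qed

  show ?thesis
  proof (intro conjI allI impI)
    fix \<theta> :: real assume \<theta>: "0 < \<theta> \<and> \<theta> < 1"
    note H = dominated_comp[OF W.snorm_holmstedt_interior(1)[OF assms(12) r\<alpha> conjunct1[OF \<theta>] conjunct2[OF \<theta>], of UNIV], of ?S ?\<kappa>]
      dominated_comp[OF W.snorm_holmstedt_interior(2)[OF assms(12) r\<alpha> conjunct1[OF \<theta>] conjunct2[OF \<theta>], of UNIV], of ?S ?\<kappa>]
    show "space_eq (interp (interp A0 A1 \<theta>0 r0 b0) (interp_R A0 A1 1 r1 b1 q1 a1) \<theta> r a)
          (interp A0 A1 ((1 - \<theta>) * \<theta>0 + \<theta>) r (a_sharp \<theta> b0 \<chi>1 a \<rho>))"
      unfolding X interp_def[of "finite_space _ _"]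
    proof (rule space_eqI)
      show "points (interp A0 A1 ((1 - \<theta>) * \<theta>0 + \<theta>) r (a_sharp \<theta> b0 \<chi>1 a \<rho>)) =
        {f \<in> ?S. wnorm r ((1 - \<theta>) * \<theta>0 + \<theta>) (a_sharp \<theta> b0 \<chi>1 a \<rho>) {0<..} (\<lambda>u. K A0 A1 u f) < top}"
        by (simp add: interp_def)
    qed (simp add: interp_def, rule reit(3), rule reit(4), assumption+,
      rule dominated_trans[OF reit(1) dominated_trans[OF H(1) Nsharp(2)]], simp,
      rule dominated_trans[OF Nsharp(1) dominated_trans[OF H(2) reit(2)]], simp)
  next
    note H = dominated_comp[OF W.snorm_holmstedt_zero(1)[OF assms(12) r\<alpha>, of UNIV], of ?S ?\<kappa>]
      dominated_comp[OF W.snorm_holmstedt_zero(2)[OF assms(12) r\<alpha>, of UNIV], of ?S ?\<kappa>]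
    have sJ: "sampled ?S (\<lambda>f t. wnorm r0 \<theta>0 b0 {0<..<t} (\<lambda>u. K A0 A1 u f)) (\<lambda>f. W.head_norm (?\<kappa> f))"
      unfolding W.head_norm_def[abs_def] by (rule sampled_head[OF assms(13) rb0 samp stead])
    have r\<alpha>': "regvar 0 (a \<circ> \<rho>)" using r\<alpha> by (simp add: comp_def)
    have e0: "W.weight (\<lambda>u. a (\<rho> u)) 0 k = wt 0 (a \<circ> \<rho>) k" for k
      using W.pos(6)[of k] by (simp add: W.weight_def)
    note N = wnorm_full[OF assms(12) r\<alpha>' sJ, of 0, folded e0]
    show "space_eq (interp (interp A0 A1 \<theta>0 r0 b0) (interp_R A0 A1 1 r1 b1 q1 a1) 0 r a)
          (interp_L A0 A1 \<theta>0 r (a \<circ> \<rho>) r0 b0)"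
      unfolding X interp_def[of "finite_space _ _"]
    proof (rule space_eqI)
      show "points (interp_L A0 A1 \<theta>0 r (a \<circ> \<rho>) r0 b0) =
        {f \<in> ?S. wnorm r 0 (a \<circ> \<rho>) {0<..} (\<lambda>t. wnorm r0 \<theta>0 b0 {0<..<t} (\<lambda>u. K A0 A1 u f)) < top}"
        by (simp add: interp_L_def)
    qed (simp add: interp_L_def, rule reit(3), rule reit(4), assumption+,
      rule dominated_trans[OF reit(1) dominated_trans[OF H(1) N(2)]], simp,
      rule dominated_trans[OF N(1) dominated_trans[OF H(2) reit(2)]], simp)
  next
    let ?\<alpha> = "\<lambda>u. a (\<rho> u)"
    note H = dominated_comp[OF W.snorm_holmstedt_one(1)[OF assms(12) r\<alpha>, of UNIV], of ?S ?\<kappa>, OF UNIV_I]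
      dominated_comp[OF W.snorm_holmstedt_one(2)[OF assms(12) r\<alpha>, of UNIV], of ?S ?\<kappa>, OF UNIV_I]
      dominated_comp[OF W.snorm_holmstedt_one(3)[OF assms(12) r\<alpha>, of UNIV], of ?S ?\<kappa>, OF UNIV_I]
      dominated_comp[OF W.snorm_holmstedt_one(4)[OF assms(12) r\<alpha>, of UNIV], of ?S ?\<kappa>, OF UNIV_I]
    let ?n1 = "\<lambda>f. wnorm r 1 (a_sharp 1 b0 \<chi>1 a \<rho>) {0<..} (\<lambda>u. K A0 A1 u f)"
    let ?n2 = "\<lambda>f. wnorm r 0 (B_one r1 b1 a \<rho>) {0<..} (\<lambda>t. wnorm q1 1 a1 {t<..} (\<lambda>u. K A0 A1 u f))"
    let ?n3 = "\<lambda>f. wnorm r 0 (a \<circ> \<rho>) {0<..} (\<lambda>t. wnorm r1 0 b1 {t<..} (\<lambda>u. wnorm q1 1 a1 {u<..} (\<lambda>v. K A0 A1 v f)))"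
    have rB: "regvar 0 (B_one r1 b1 a \<rho>)"
      using regvar_mult[OF W.\<beta> r\<alpha>] by (simp add: B_one_def[abs_def])
    have n1: "dominated ?S ?n1 (\<lambda>f. snorm r (\<lambda>k. W.weight ?\<alpha> 1 k * (ennreal (?v (dyad k)) * ?\<kappa> f k)))"
      "dominated ?S (\<lambda>f. snorm r (\<lambda>k. W.weight ?\<alpha> 1 k * (ennreal (?v (dyad k)) * ?\<kappa> f k))) ?n1"
      using Nsharp[of 1] by simp_all
    have n2: "dominated ?S ?n2 (\<lambda>f. snorm r (\<lambda>k. ennreal (?\<beta> (dyad k) * ?\<alpha> (dyad k)) * W.tail_norm (?\<kappa> f) k))"
      "dominated ?S (\<lambda>f. snorm r (\<lambda>k. ennreal (?\<beta> (dyad k) * ?\<alpha> (dyad k)) * W.tail_norm (?\<kappa> f) k)) ?n2"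
      using wnorm_full[OF assms(12) rB sR, of 0] unfolding wt0 B_one_def by simp_all
    have sRR: "sampled ?S (\<lambda>f t. wnorm r1 0 b1 {t<..} (\<lambda>u. wnorm q1 1 a1 {u<..} (\<lambda>v. K A0 A1 v f))) (\<lambda>f. W.tail_tail_norm (?\<kappa> f))"
      unfolding W.tail_tail_norm_def[abs_def] using sampled_tail[OF assms(6) W.b sR stR, of 0] unfolding wt0 .
    have r\<alpha>': "regvar 0 (a \<circ> \<rho>)" using r\<alpha> by (simp add: comp_def)
    have n3: "dominated ?S ?n3 (\<lambda>f. snorm r (\<lambda>k. ennreal (?\<alpha> (dyad k)) * W.tail_tail_norm (?\<kappa> f) k))"
      "dominated ?S (\<lambda>f. snorm r (\<lambda>k. ennreal (?\<alpha> (dyad k)) * W.tail_tail_norm (?\<kappa> f) k)) ?n3"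
      using wnorm_full[OF assms(12) r\<alpha>' sRR, of 0] unfolding wt0 comp_def by simp_all
    let ?Y = "space_inter (interp A0 A1 1 r (a_sharp 1 b0 \<chi>1 a \<rho>))
             (space_inter (interp_R A0 A1 1 r (B_one r1 b1 a \<rho>) q1 a1) (interp_RR A0 A1 1 r (a \<circ> \<rho>) r1 b1 q1 a1))"
    let ?M = "\<lambda>f. max (?n1 f) (max (?n2 f) (?n3 f))"
    have max_real: "max (enn2real x) (enn2real y) = enn2real (max x y)" if "x < top" "y < top" for x y
      using that by (cases "x \<le> y") (auto simp: max_def enn2real_mono intro: antisym enn2real_mono)
    show "space_eq (interp (interp A0 A1 \<theta>0 r0 b0) (interp_R A0 A1 1 r1 b1 q1 a1) 1 r a) ?Y"
      unfolding X interp_def[of "finite_space _ _"]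
    proof (rule space_eqI[where N = ?M])
      show pY: "points ?Y = {f \<in> ?S. ?M f < top}"
        by (auto simp: space_inter_def interp_def interp_R_def interp_RR_def)
      show "qnorm ?Y f = enn2real (?M f)" if "f \<in> points ?Y" for f
        using that unfolding pY by (simp add: space_inter_def interp_def interp_R_def interp_RR_def max_real)
      have "dominated ?S (\<lambda>f. wnorm r 1 a {0<..} (\<lambda>u. K (finite_space ?S ?N0) (finite_space ?S ?N1) u f))
        (\<lambda>f. ?n1 f + (?n2 f + ?n3 f))"
        by (rule dominated_trans[OF reit(1) dominated_trans[OF H(1) dominated_add[OF n1(2) dominated_add[OF n2(2) n3(2)]]]])
      also have "dominated ?S \<dots> ?M"
        by (intro dominated_add_least; rule dominated_le) (simp_all add: le_max_iff_disj)
      finally show "dominated ?S (\<lambda>f. wnorm r 1 a {0<..} (\<lambda>u. K (finite_space ?S ?N0) (finite_space ?S ?N1) u f)) ?M" .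
      show "dominated ?S ?M (\<lambda>f. wnorm r 1 a {0<..} (\<lambda>u. K (finite_space ?S ?N0) (finite_space ?S ?N1) u f))"
        by (intro dominated_max dominated_trans[OF n1(1) dominated_trans[OF H(2) reit(2)]]
          dominated_trans[OF n2(1) dominated_trans[OF H(3) reit(2)]] dominated_trans[OF n3(1) dominated_trans[OF H(4) reit(2)]])
    qed (rule reit(3), rule reit(4))
  qed
qed

end
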